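(* Let $\mathbf{U}_l,\mathbf{V}_l,\mathbf{N}_l,\mathbf{M}_l,\mathbf{U}_r,\mathbf{V}_r,\mathbf{N}_r,\mathbf{M}_r\in\mathcal{RH}_\infty$ be a doubly-coprime factorization of the plant $\mathbf{G}$, so that in particular $\mathbf{G}=\mathbf{M}_l^{-1}\mathbf{N}_l$. A controller $\mathbf{K}$ internally stabilizes $\mathbf{G}$ if and only if there exist $\mathbf{X},\mathbf{Y}\in\mathcal{RH}_\infty$ with $\mathbf{K}=\mathbf{Y}\mathbf{X}^{-1}$ and a real number $\epsilon$ such that $$\|\mathbf{M}_l\mathbf{X}-\mathbf{N}_l\mathbf{Y}-I\|_\infty<\epsilon<1.$$ Moreover, if $\mathbf{X},\mathbf{Y}\in\mathcal{RH}_\infty$ and $\epsilon$ satisfy $\|\mathbf{M}_l\mathbf{X}-\mathbf{N}_l\mathbf{Y}-I\|_\infty<\epsilon<1$, then $\mathbf{K}=\mathbf{Y}\mathbf{X}^{-1}$ is an internally stabilizing controller and the closed-loop response satisfies $$\left\|\begin{bmatrix}I&-\mathbf{G}\\-\mathbf{K}&I\end{bmatrix}^{-1}-\begin{bmatrix}\mathbf{X}\mathbf{M}_l&\mathbf{X}\mathbf{N}_l\\\mathbf{Y}\mathbf{M}_l&I+\mathbf{Y}\mathbf{N}_l\end{bmatrix}\right\|_\infty\le\frac{\epsilon}{1-\epsilon}\left\|\begin{bmatrix}\mathbf{X}\\\mathbf{Y}\end{bmatrix}\right\|_\infty\left\|\begin{bmatrix}\mathbf{M}_l&\mathbf{N}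_l\end{bmatrix}\right\|_\infty.$$
   Context: $\mathcal{RH}_\infty$ denotes the set of real-rational proper stable transfer matrices in discrete time (all poles in the open unit disc), of whatever dimensions are compatible; $\|\cdot\|_\infty$ is the $\mathcal{H}_\infty$ norm, $\|\mathbf{T}\|_\infty=\sup_{|z|=1}\sigma_{\max}(\mathbf{T}(z))$. Plant: $x[t+1]=A_p x[t]+B_p u[t]+\delta_x[t]$, $y[t]=C_p x[t]+\delta_y[t]$, with $x[t]\in\mathbb{R}^n$, $u[t]\in\mathbb{R}^m$, $y[t]\in\mathbb{R}^p$, where $(A_p,B_p)$ is stabilizable and $(C_p,A_p)$ is detectable. Its transfer matrix is the strictly proper $\mathbf{G}(z)=C_p(zI-A_p)^{-1}B_p$. Controller: a proper LTI controller $\mathbf{u}=\mathbf{K}\mathbf{y}+\delta_{\mathbf{u}}$ with state-space realization $\xi[t+1]=A_K\xi[t]+B_K y[t]$, $u[t]=C_K\xi[t]+D_K y[t]+\delta_u[t]$, $\xi[t]\in\mathbb{R}^q$ (any $q$). The realization is taken stabilizable and detectable. $\mathbf{K}$ internally stabilizes $\mathbf{G}$ if the closed loop is well-posed (automatic here, as the plant is strictly proper) and, with all disturbances $\delta_x,\delta_y,\delta_u$ zero, $(x[t],\xi[t])\to 0$ as $t\to\infty$ for all initial states. Doubly-coprime factorization of $\mathbf{G}$: a collection $\mathbf{U}_l,\mathbf{V}_l,\mathbf{N}_l,\mathbf{M}_l,\mathbf{U}_r,\mathbf{V}_r,\mathbf{N}_r,\mathbf{M}_r\in\mathcal{RH}_\infty$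 such that $\mathbf{G}=\mathbf{N}_r\mathbf{M}_r^{-1}=\mathbf{M}_l^{-1}\mathbf{N}_l$ and $$\begin{bmatrix}\mathbf{U}_l&-\mathbf{V}_l\\-\mathbf{N}_l&\mathbf{M}_l\end{bmatrix}\begin{bmatrix}\mathbf{M}_r&\mathbf{V}_r\\\mathbf{N}_r&\mathbf{U}_r\end{bmatrix}=I.$$ *)

theory Defs
  imports
    Complex_Main
    "HOL-Computational_Algebra.Computational_Algebra"
    "HOL-Computational_Algebra.Field_as_Ring"
    "Jordan_Normal_Form.Gauss_Jordan_Elimination"
    "Jordan_Normal_Form.Schur_Decomposition"
begin

section \<open>Real-rational transfer matrices\<close>

text \<open>
  A scalar transfer function is an element of the field \<open>real poly fract\<close> of real rational
  functions in \<open>z\<close>. The function \<open>quot_of_fract\<close> returns its numerator and denominator in lowest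
  terms, so the complex roots of the latter are exactly the finite poles.
\<close>

type_synonym tf = "real poly fract"

definition tf_num :: "tf \<Rightarrow> real poly" where
  "tf_num r = fst (quot_of_fract r)"

definition tf_den :: "tf \<Rightarrow> real poly" where
  "tf_den r = snd (quot_of_fract r)"

definition tf_proper :: "tf \<Rightarrow> bool" where
  "tf_proper r \<longleftrightarrow> degree (tf_num r) \<le> degree (tf_den r)"

definition tf_pole :: "tf \<Rightarrow> complex \<Rightarrow> bool" where
  "tf_pole r z \<longleftrightarrow> poly (map_poly complex_of_real (tf_den r)) z = 0"

text \<open>Meaningful only where \<open>z\<close> is not a pole; at a pole the division by zero yields \<open>0\<close>.\<close>

definition tf_eval :: "tf \<Rightarrow> complex \<Rightarrow> complex" where
  "tf_eval r z = poly (map_poly complex_of_real (tf_num r)) z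
               / poly (map_poly complex_of_real (tf_den r)) z"

definition RHinf :: "nat \<Rightarrow> nat \<Rightarrow> tf mat set" where
  "RHinf k l = {T \<in> carrier_mat k l. \<forall>i<k. \<forall>j<l.
      tf_proper (T $$ (i, j)) \<and> (\<forall>z. tf_pole (T $$ (i, j)) z \<longrightarrow> cmod z < 1)}"

definition const_tf :: "real mat \<Rightarrow> tf mat" where
  "const_tf A = map_mat (\<lambda>a. to_fract [:a:]) A"

definition tf_z :: tf where
  "tf_z = to_fract [:0, 1:]"

text \<open>The inverse of an invertible matrix over a field (unspecified for other matrices).\<close>

definition minv :: "'a::field mat \<Rightarrow> 'a mat" where
  "minv A = the (mat_inverse A)"

text \<open>The transfer matrix \<open>C (zI - A)\<^sup>-\<^sup>1 B + D\<close>.\<close>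

definition transfer_matrix :: "real mat \<Rightarrow> real mat \<Rightarrow> real mat \<Rightarrow> real mat \<Rightarrow> tf mat" where
  "transfer_matrix A B C D =
     const_tf C * minv (tf_z \<cdot>\<^sub>m 1\<^sub>m (dim_row A) - const_tf A) * const_tf B + const_tf D"

definition append_cols :: "'a::zero mat \<Rightarrow> 'a mat \<Rightarrow> 'a mat" where
  "append_cols A B = four_block_mat A B (0\<^sub>m 0 (dim_col A)) (0\<^sub>m 0 (dim_col B))"


section \<open>The H-infinity norm\<close>

definition singular_values :: "complex mat \<Rightarrow> real set" where
  "singular_values A = {s. s \<ge> 0 \<and> eigenvalue (mat_adjoint A * A) (complex_of_real (s\<^sup>2))}"

text \<open>Inserting \<open>0\<close> only matters for matrices without columns, which have no singular values.\<close>

definition sigma_max :: "complex mat \<Rightarrow> real" where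
  "sigma_max A = Max (insert 0 (singular_values A))"

text \<open>To be used for matrices without poles on the unit circle, in particular for \<open>RHinf\<close>;
  otherwise the supremum does not have its intended meaning.\<close>

definition hinf_norm :: "tf mat \<Rightarrow> real" where
  "hinf_norm T = (SUP z\<in>{z. cmod z = 1}. sigma_max (map_mat (\<lambda>r. tf_eval r z) T))"


section \<open>State-space systems and internal stability\<close>

definition schur_stable :: "real mat \<Rightarrow> bool" where
  "schur_stable A \<longleftrightarrow> (\<forall>z. eigenvalue (map_mat complex_of_real A) z \<longrightarrow> cmod z < 1)"

definition stabilizable :: "real mat \<Rightarrow> real mat \<Rightarrow> bool" where
  "stabilizable A B \<longleftrightarrow> (\<exists>F \<in> carrier_mat (dim_col B) (dim_row A). schur_stable (A + B * F))"

definition detectable :: "real mat \<Rightarrow> real mat \<Rightarrow> bool" where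
  "detectable C A \<longleftrightarrow> (\<exists>L \<in> carrier_mat (dim_row A) (dim_row C). schur_stable (A + L * C))"

text \<open>\<open>(A\<^sub>K, B\<^sub>K, C\<^sub>K, D\<^sub>K)\<close> is a stabilizable and detectable realization, with \<open>q\<close> states,
  of the controller \<open>K\<close> with \<open>p\<close> inputs and \<open>m\<close> outputs.\<close>

definition controller_realization ::
  "nat \<Rightarrow> nat \<Rightarrow> nat \<Rightarrow> real mat \<Rightarrow> real mat \<Rightarrow> real mat \<Rightarrow> real mat \<Rightarrow> tf mat \<Rightarrow> bool" where
  "controller_realization q m p AK BK CK DK K \<longleftrightarrow>
     AK \<in> carrier_mat q q \<and> BK \<in> carrier_mat q p \<and>
     CK \<in> carrier_mat m q \<and> DK \<in> carrier_mat m p \<and>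
     stabilizable AK BK \<and> detectable CK AK \<and>
     K = transfer_matrix AK BK CK DK"

text \<open>Every disturbance-free closed-loop trajectory tends to \<open>0\<close>. Vectors carry no topology here,
  so convergence is componentwise.\<close>

definition internally_stabilizes ::
  "real mat \<Rightarrow> real mat \<Rightarrow> real mat \<Rightarrow> real mat \<Rightarrow> real mat \<Rightarrow> real mat \<Rightarrow> real mat \<Rightarrow> bool" where
  "internally_stabilizes Ap Bp Cp AK BK CK DK \<longleftrightarrow>
     (\<forall>(x :: nat \<Rightarrow> real vec) (\<xi> :: nat \<Rightarrow> real vec) (u :: nat \<Rightarrow> real vec) (y :: nat \<Rightarrow> real vec).
        x 0 \<in> carrier_vec (dim_row Ap) \<and> \<xi> 0 \<in> carrier_vec (dim_row AK) \<and>
        (\<forall>t. x (Suc t) = Ap *\<^sub>v x t + Bp *\<^sub>v u t \<and>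
             y t = Cp *\<^sub>v x t \<and>
             \<xi> (Suc t) = AK *\<^sub>v \<xi> t + BK *\<^sub>v y t \<and>
             u t = CK *\<^sub>v \<xi> t + DK *\<^sub>v y t)
        \<longrightarrow> (\<forall>i<dim_row Ap. (\<lambda>t. x t $ i) \<longlonglongrightarrow> 0) \<and>
            (\<forall>i<dim_row AK. (\<lambda>t. \<xi> t $ i) \<longlonglongrightarrow> 0))"


section \<open>Doubly-coprime factorizations\<close>

definition doubly_coprime_factorization ::
  "nat \<Rightarrow> nat \<Rightarrow> tf mat \<Rightarrow> tf mat \<Rightarrow> tf mat \<Rightarrow> tf mat \<Rightarrow> tf mat \<Rightarrow>
   tf mat \<Rightarrow> tf mat \<Rightarrow> tf mat \<Rightarrow> tf mat \<Rightarrow> bool" where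
  "doubly_coprime_factorization m p G Ul Vl Nl Ml Ur Vr Nr Mr \<longleftrightarrow>
     Ul \<in> RHinf m m \<and> Vl \<in> RHinf m p \<and> Nl \<in> RHinf p m \<and> Ml \<in> RHinf p p \<and>
     Ur \<in> RHinf p p \<and> Vr \<in> RHinf m p \<and> Nr \<in> RHinf p m \<and> Mr \<in> RHinf m m \<and>
     invertible_mat Mr \<and> invertible_mat Ml \<and>
     G = Nr * minv Mr \<and> G = minv Ml * Nl \<and>
     four_block_mat Ul (- Vl) (- Nl) Ml * four_block_mat Mr Vr Nr Ur = 1\<^sub>m (m + p)"

end

theory Submission
  imports Defs "HOL-Complex_Analysis.Conformal_Mappings" "Jordan_Normal_Form.Spectral_Radius"
begin

text \<open>Stability of a transfer matrix concerns its values at the points \<open>|z| \<ge> 1\<close> and \<open>z = \<infinity>\<close>. With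
  \<open>w = 1 / z\<close> these points form the closed unit disc, and \<open>w = 0\<close> stands for infinity. A rational
  function is stable iff it is regular at each of these points (\<open>stable_iff_reg\<close>), evaluation at one
  point is multiplicative and additive on the functions regular there, and a square matrix regular at
  \<open>w\<close> has an inverse regular at \<open>w\<close> as soon as its value there is nonsingular (\<open>mreg_minv\<close>). So every
  stability claim reduces to linear algebra over the complex numbers, one point at a time.

  If \<open>Q = M\<^sub>l X - N\<^sub>l Y\<close> is at distance less than \<open>1\<close> from the identity, then by the maximum modulus
  principle \<open>Q\<close> is nonsingular at every point of the disc and hence a unit of \<open>RH\<^sub>\<infinity>\<close>
  (\<open>small_gain\<close>). The largest singular value enters only as an operator norm, and that it is one
  (\<open>sigma_max_bound\<close>) follows from the boundedness of the powers of a matrix of spectral radius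
  below \<open>1\<close>.

  Internal stability is decided by one criterion. A stabilizing gain for a realization of \<open>K\<close> yields
  stable right factors \<open>K = Y\<^sub>F X\<^sub>F\<^sup>-\<^sup>1\<close>, and the closed-loop modes with eigenvalue \<open>\<lambda> = 1 / w\<close>
  correspond to the kernel of \<open>M\<^sub>l X\<^sub>F - N\<^sub>l Y\<^sub>F\<close> at \<open>w\<close>, so the loop is stable iff this matrix is a unit
  (\<open>stable_iff_QF\<close>). If it is one, dividing the factors by it gives \<open>X\<close> and \<open>Y\<close> with
  \<open>M\<^sub>l X - N\<^sub>l Y = I\<close>. Conversely, detectability makes any stable \<open>X\<close>, \<open>Y\<close> with \<open>K = Y X\<^sup>-\<^sup>1\<close> a right
  multiple of \<open>(X\<^sub>F, Y\<^sub>F)\<close> by a stable \<open>W\<close>, so that \<open>Q = (M\<^sub>l X\<^sub>F - N\<^sub>l Y\<^sub>F) W\<close>, and nonsingularity of \<open>Q\<close>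
  passes to the first factor.

  For the second part, \<open>X\<close> is invertible because \<open>N\<^sub>l\<close> vanishes at infinity, the plant being strictly
  proper. A realization of \<open>Y X\<^sup>-\<^sup>1\<close> is obtained from an observer of the plant driven by \<open>Y\<close> and \<open>X\<close>:
  its innovation is again a unit of \<open>RH\<^sub>\<infinity>\<close>, so the part of \<open>Y\<close> that is not state feedback is a stable
  function of the innovation. Realizing this function stably and feeding it back gives a controller
  for which both a stabilizing and a detecting gain can be written down
  (\<open>controller_has_realization\<close>). Finally the inverse of the closed-loop matrix is the claimed
  approximation with \<open>Q\<^sup>-\<^sup>1\<close> inserted in each product, so the error is
  \<open>[X; Y] (Q\<^sup>-\<^sup>1 - I) [M\<^sub>l N\<^sub>l]\<close> and \<open>\<epsilon> / (1 - \<epsilon>)\<close> bounds its middle factor (\<open>E_eq\<close>, \<open>inverse_gap\<close>).\<close>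

unbundle no vec_syntax
unbundle no inner_syntax
no_notation fps_nth (infixl "$" 75)
hide_type (open) Finite_Cartesian_Product.vec
hide_const (open) Finite_Cartesian_Product.vec Finite_Cartesian_Product.row
  Finite_Cartesian_Product.rows Finite_Cartesian_Product.mat Finite_Cartesian_Product.column
  Determinants.det

section \<open>Rational functions on the closed exterior of the unit disc\<close>

text \<open>This is \<open>w\<^sup>d a(1 / w)\<close>, continued polynomially to \<open>w = 0\<close>. Dividing two such values of the same
  degree \<open>d\<close> evaluates a rational function at \<open>z = 1 / w\<close>, infinity included.\<close>

definition hev :: "nat \<Rightarrow> real poly \<Rightarrow> complex \<Rightarrow> complex" where
  "hev d a w = (\<Sum>i\<le>d. of_real (coeff a i) * w ^ (d - i))"

lemma hev_add: "hev d (a + b) w = hev d a w + hev d b w"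
  by (simp add: hev_def algebra_simps sum.distrib)

lemma hev_at_0: "hev d a 0 = of_real (coeff a d)"
proof -
  have "hev d a 0 = (\<Sum>i\<in>{d}. of_real (coeff a i) * 0 ^ (d - i))"
    unfolding hev_def by (rule sum.mono_neutral_right) auto
  then show ?thesis by simp
qed

lemma hev_nonzero:
  assumes "w \<noteq> 0" "degree a \<le> d"
  shows "hev d a w = w ^ d * poly (map_poly of_real a) (1 / w)"
proof -
  have "poly (map_poly complex_of_real a) (1 / w) = (\<Sum>i\<le>degree a. of_real (coeff a i) * (1 / w) ^ i)"
    by (simp add: poly_altdef degree_map_poly coeff_map_poly)
  also have "\<dots> = (\<Sum>i\<le>d. of_real (coeff a i) * (1 / w) ^ i)"
    using assms(2) by (intro sum.mono_neutral_left) (auto simp: coeff_eq_0)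
  finally have "w ^ d * poly (map_poly of_real a) (1 / w) = (\<Sum>i\<le>d. of_real (coeff a i) * (w ^ d * (1 / w) ^ i))"
    by (simp add: sum_distrib_left mult_ac)
  also have "\<dots> = hev d a w"
    unfolding hev_def using assms(1)
    by (intro sum.cong) (auto simp: power_diff power_divide)
  finally show ?thesis by simp
qed

lemma coeff_mult_top:
  fixes a b :: "'a::comm_semiring_0 poly"
  assumes "degree a \<le> d" "degree b \<le> e"
  shows "coeff (a * b) (d + e) = coeff a d * coeff b e"
proof -
  have "coeff (a * b) (d + e) = (\<Sum>i\<le>d + e. coeff a i * coeff b (d + e - i))"
    by (rule coeff_mult)
  also have "\<dots> = (\<Sum>i\<in>{d}. coeff a i * coeff b (d + e - i))"
  proof (rule sum.mono_neutral_right)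
    show "\<forall>i\<in>{..d + e} - {d}. coeff a i * coeff b (d + e - i) = 0"
    proof
      fix i assume "i \<in> {..d + e} - {d}"
      then consider "i > d" | "d + e - i > e" by fastforce
      then show "coeff a i * coeff b (d + e - i) = 0"
        using assms by cases (auto simp: coeff_eq_0)
    qed
  qed auto
  finally show ?thesis by simp
qed

lemma degree_mult_le_sum:
  assumes "degree a \<le> d" "degree b \<le> e"
  shows "degree (a * b) \<le> d + e"
  using degree_mult_le[of a b] assms by linarith

lemma map_poly_of_real_mult:
  "map_poly complex_of_real (a * b) = map_poly of_real a * map_poly of_real b"
  by (rule poly_eqI) (simp add: coeff_map_poly coeff_mult)

lemma hev_mult:
  assumes "degree a \<le> d" "degree b \<le> e"
  shows "hev (d + e) (a * b) w = hev d a w * hev e b w"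
proof (cases "w = 0")
  case True
  then show ?thesis by (simp add: hev_at_0 coeff_mult_top[OF assms])
next
  case False
  with assms show ?thesis
    by (simp add: degree_mult_le_sum hev_nonzero map_poly_of_real_mult power_add)
qed

lemma tf_num_den: "r = Fract (tf_num r) (tf_den r)"
  by (simp add: tf_num_def tf_den_def)

lemma tf_den_nonzero: "tf_den r \<noteq> 0"
  by (simp add: tf_den_def)

definition tf_deg :: "tf \<Rightarrow> nat" where
  "tf_deg r = max (degree (tf_num r)) (degree (tf_den r))"

text \<open>Regularity at the point \<open>z = 1 / w\<close>. For \<open>w = 0\<close> the leading coefficients decide, which is
  properness.\<close>

definition reg :: "complex \<Rightarrow> tf \<Rightarrow> bool" where
  "reg w r \<longleftrightarrow> hev (tf_deg r) (tf_den r) w \<noteq> 0"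

definition ev :: "complex \<Rightarrow> tf \<Rightarrow> complex" where
  "ev w r = hev (tf_deg r) (tf_num r) w / hev (tf_deg r) (tf_den r) w"

lemma degree_num_den_le: "degree (tf_num r) \<le> tf_deg r" "degree (tf_den r) \<le> tf_deg r"
  by (simp_all add: tf_deg_def)

text \<open>Numerator and denominator in lowest terms are coprime, so the denominator divides that of any other
  representation, and the numerators differ by the same factor.\<close>

lemma Fract_multiple:
  assumes "b \<noteq> 0"
  obtains c where "a = tf_num (Fract a b) * c" "b = tf_den (Fract a b) * c" "c \<noteq> 0"
proof -
  define r where "r = Fract a b"
  have "Fract a b = Fract (tf_num r) (tf_den r)"
    using tf_num_den[of r] r_def by simp
  then have eq: "a * tf_den r = tf_num r * b"
    using assms tf_den_nonzero[of r] by (simp add: eq_fract)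
  have "coprime (tf_den r) (tf_num r)"
    unfolding tf_den_def tf_num_def by (metis coprime_quot_of_fract coprime_commute)
  moreover have "tf_den r dvd tf_num r * b"
    unfolding eq[symmetric] by simp
  ultimately have "tf_den r dvd b"
    by (simp add: coprime_dvd_mult_right_iff)
  then obtain c where c: "b = tf_den r * c" ..
  have "a * tf_den r = (tf_num r * c) * tf_den r"
    using eq c by (simp add: mult_ac)
  then have "a = tf_num r * c"
    using tf_den_nonzero[of r] by (simp only: mult_cancel_right) simp
  moreover have "c \<noteq> 0" using c assms by auto
  ultimately show ?thesis using that[of c] c unfolding r_def by blast
qed

text \<open>A common factor cancels, so any representation whose denominator does not vanish may be used. This
  gives the closure properties below without reducing sums and products to lowest terms.\<close>

lemma reg_ev_Fract:
  assumes "degree a \<le> d" "degree b \<le> d" "hev d b w \<noteq> 0"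
  shows "reg w (Fract a b)" "ev w (Fract a b) = hev d a w / hev d b w"
proof -
  define r where "r = Fract a b"
  have "b \<noteq> 0" using assms(3) by (auto simp: hev_def)
  then obtain c where c: "a = tf_num r * c" "b = tf_den r * c" "c \<noteq> 0"
    using Fract_multiple[of b a] r_def by metis
  \<comment> \<open>the numerator may vanish, in which case only the denominators are compared\<close>
  have "tf_deg r + degree c \<le> d"
  proof (cases "tf_num r = 0")
    case True
    then have "tf_deg r + degree c = degree b"
      using c tf_den_nonzero[of r] by (simp add: tf_deg_def degree_mult_eq)
    then show ?thesis using assms by simp
  next
    case False
    then have "degree a = degree (tf_num r) + degree c" "degree b = degree (tf_den r) + degree c"
      using c tf_den_nonzero[of r] by (simp_all add: degree_mult_eq)
    then show ?thesis using assms by (simp add: tf_deg_def max_def)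
  qed
  then obtain e where e: "d = tf_deg r + e" "degree c \<le> e"
    using le_iff_add by (metis add_le_cancel_left le_trans le_add1)
  have h: "hev d a w = hev (tf_deg r) (tf_num r) w * hev e c w"
    "hev d b w = hev (tf_deg r) (tf_den r) w * hev e c w"
    using c e by (simp_all add: hev_mult degree_num_den_le)
  then show "reg w (Fract a b)" "ev w (Fract a b) = hev d a w / hev d b w"
    using assms(3) unfolding r_def[symmetric] reg_def ev_def h by simp_all
qed

lemma reg_ev_add:
  assumes "reg w r" "reg w s"
  shows "reg w (r + s)" "ev w (r + s) = ev w r + ev w s"
proof -
  let ?a = "tf_num r" and ?b = "tf_den r" and ?c = "tf_num s" and ?d = "tf_den s"
  let ?m = "tf_deg r" and ?n = "tf_deg s"
  have eq: "r + s = Fract (?a * ?d + ?c * ?b) (?b * ?d)"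
    by (subst (1) tf_num_den[of r], subst (1) tf_num_den[of s]) (rule add_fract[OF tf_den_nonzero tf_den_nonzero])
  have deg: "degree (?a * ?d + ?c * ?b) \<le> ?m + ?n" "degree (?b * ?d) \<le> ?m + ?n"
    using degree_mult_le_sum[of ?a ?m ?d ?n] degree_mult_le_sum[of ?c ?n ?b ?m]
      degree_mult_le_sum[of ?b ?m ?d ?n] degree_num_den_le
    by (simp_all add: degree_add_le add.commute)
  have h: "hev (?m + ?n) (?b * ?d) w = hev ?m ?b w * hev ?n ?d w"
    "hev (?m + ?n) (?a * ?d + ?c * ?b) w = hev ?m ?a w * hev ?n ?d w + hev ?n ?c w * hev ?m ?b w"
    using hev_mult[of ?b ?m ?d ?n w] hev_mult[of ?a ?m ?d ?n w] hev_mult[of ?c ?n ?b ?m w]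
      degree_num_den_le by (simp_all add: hev_add add.commute)
  from h(1) have nz: "hev (?m + ?n) (?b * ?d) w \<noteq> 0"
    using assms by (simp add: reg_def)
  show "reg w (r + s)" unfolding eq by (rule reg_ev_Fract(1)[OF deg nz])
  show "ev w (r + s) = ev w r + ev w s"
    unfolding eq reg_ev_Fract(2)[OF deg nz] unfolding ev_def h
    using assms[unfolded reg_def] by (rule add_frac_eq[symmetric])
qed

lemma reg_ev_mult:
  assumes "reg w r" "reg w s"
  shows "reg w (r * s)" "ev w (r * s) = ev w r * ev w s"
proof -
  let ?a = "tf_num r" and ?b = "tf_den r" and ?c = "tf_num s" and ?d = "tf_den s"
  let ?m = "tf_deg r" and ?n = "tf_deg s"
  have eq: "r * s = Fract (?a * ?c) (?b * ?d)"
    by (subst (1) tf_num_den[of r], subst (1) tf_num_den[of s]) (rule mult_fract)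
  have deg: "degree (?a * ?c) \<le> ?m + ?n" "degree (?b * ?d) \<le> ?m + ?n"
    by (intro degree_mult_le_sum degree_num_den_le)+
  have h: "hev (?m + ?n) (?b * ?d) w = hev ?m ?b w * hev ?n ?d w"
    "hev (?m + ?n) (?a * ?c) w = hev ?m ?a w * hev ?n ?c w"
    by (simp_all add: hev_mult degree_num_den_le)
  from h(1) have nz: "hev (?m + ?n) (?b * ?d) w \<noteq> 0"
    using assms by (simp add: reg_def)
  show "reg w (r * s)" unfolding eq by (rule reg_ev_Fract(1)[OF deg nz])
  show "ev w (r * s) = ev w r * ev w s"
    unfolding eq reg_ev_Fract(2)[OF deg nz] unfolding ev_def h by simp
qed

lemma reg_ev_const: "reg w (to_fract [:c:])" "ev w (to_fract [:c:]) = of_real c"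
  using reg_ev_Fract[of "[:c:]" 0 1 w] by (simp_all add: to_fract_def hev_def)

lemma reg_ev_0: "reg w 0" "ev w 0 = 0"
  using reg_ev_const[of w 0] by simp_all

lemma reg_ev_1: "reg w 1" "ev w 1 = 1"
  using reg_ev_const[of w 1] by (simp_all flip: one_pCons)

lemma reg_ev_uminus:
  assumes "reg w r"
  shows "reg w (- r)" "ev w (- r) = - ev w r"
proof -
  have "to_fract [:-1::real:] = - 1"
    unfolding to_fract_1[symmetric] to_fract_uminus[symmetric] by (simp add: one_pCons)
  then have "- r = to_fract [:-1:] * r" by simp
  then show "reg w (- r)" "ev w (- r) = - ev w r"
    using reg_ev_mult[OF reg_ev_const(1) assms, of "-1"] reg_ev_const(2)[of w "-1"] by simp_all
qed

lemma reg_ev_diff: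
  assumes "reg w r" "reg w s"
  shows "reg w (r - s)" "ev w (r - s) = ev w r - ev w s"
  using reg_ev_add[OF assms(1) reg_ev_uminus(1)[OF assms(2)]] reg_ev_uminus(2)[OF assms(2)]
  by simp_all

lemma reg_inverse:
  assumes "reg w r" "ev w r \<noteq> 0"
  shows "reg w (inverse r)"
proof -
  have "inverse r = Fract (tf_den r) (tf_num r)"
    by (subst (1) tf_num_den[of r]) (rule inverse_fract)
  moreover have "hev (tf_deg r) (tf_num r) w \<noteq> 0"
    using assms by (simp add: ev_def)
  ultimately show ?thesis
    using reg_ev_Fract(1) degree_num_den_le by metis
qed

lemma reg_sum:
  assumes "\<And>i. i \<in> A \<Longrightarrow> reg w (f i)"
  shows "reg w (sum f A)" "ev w (sum f A) = (\<Sum>i\<in>A. ev w (f i))"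
  using assms
  by (induction A rule: infinite_finite_induct) (simp_all add: reg_ev_0 reg_ev_add)

lemma reg_prod:
  assumes "\<And>i. i \<in> A \<Longrightarrow> reg w (f i)"
  shows "reg w (prod f A)" "ev w (prod f A) = (\<Prod>i\<in>A. ev w (f i))"
  using assms
  by (induction A rule: infinite_finite_induct) (simp_all add: reg_ev_1 reg_ev_mult)

lemma reg_ev_z:
  assumes "w \<noteq> 0"
  shows "reg w tf_z" "ev w tf_z = 1 / w"
proof -
  have "hev 1 1 w = w" "hev 1 [:0, 1:] w = 1" by (simp_all add: hev_def)
  then show "reg w tf_z" "ev w tf_z = 1 / w"
    using reg_ev_Fract[of "[:0,1:]" 1 1 w] assms by (simp_all add: tf_z_def to_fract_def)
qed

text \<open>The function \<open>1 / z\<close>, whose value in the coordinate \<open>w\<close> is \<open>w\<close> itself. It has no pole at infinity,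
  unlike \<open>z\<close>.\<close>

definition tf_delay :: tf where
  "tf_delay = Fract 1 [:0, 1:]"

lemma reg_ev_delay: "reg w tf_delay" "ev w tf_delay = w"
proof -
  have "hev 1 1 w = w" "hev 1 [:0, 1:] w = 1" by (simp_all add: hev_def)
  then show "reg w tf_delay" "ev w tf_delay = w"
    using reg_ev_Fract[of 1 1 "[:0,1:]" w] by (simp_all add: tf_delay_def)
qed

lemma tf_z_delay: "tf_z * tf_delay = 1"
  by (simp add: tf_z_def tf_delay_def to_fract_def One_fract_def eq_fract)

lemma reg_ev_nonzero:
  assumes "w \<noteq> 0"
  shows "reg w r \<longleftrightarrow> \<not> tf_pole r (1 / w)" "ev w r = tf_eval r (1 / w)"
  using assms
  by (simp_all add: reg_def ev_def tf_pole_def tf_eval_def hev_nonzero degree_num_den_le)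

lemma reg_at_0: "reg 0 r \<longleftrightarrow> tf_proper r"
proof
  assume "reg 0 r"
  then show "tf_proper r"
    by (auto simp: reg_def hev_at_0 tf_proper_def tf_deg_def max_def coeff_eq_0 split: if_splits)
next
  assume "tf_proper r"
  then show "reg 0 r"
    using tf_den_nonzero[of r] by (auto simp: reg_def hev_at_0 tf_proper_def tf_deg_def max_def)
qed

lemma stable_iff_reg:
  "tf_proper r \<and> (\<forall>z. tf_pole r z \<longrightarrow> cmod z < 1) \<longleftrightarrow> (\<forall>w. cmod w \<le> 1 \<longrightarrow> reg w r)"
proof
  assume l: "tf_proper r \<and> (\<forall>z. tf_pole r z \<longrightarrow> cmod z < 1)"
  show "\<forall>w. cmod w \<le> 1 \<longrightarrow> reg w r"
  proof (intro allI impI)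
    fix w assume w: "cmod w \<le> 1"
    show "reg w r"
    proof (cases "w = 0")
      case True
      then show ?thesis using l reg_at_0 by simp
    next
      case False
      then have "\<not> cmod (1 / w) < 1" using w by (simp add: norm_divide)
      then show ?thesis using l reg_ev_nonzero(1)[OF False] by blast
    qed
  qed
next
  assume r: "\<forall>w. cmod w \<le> 1 \<longrightarrow> reg w r"
  have "cmod z < 1" if "tf_pole r z" for z
  proof (rule ccontr)
    assume "\<not> cmod z < 1"
    then have "z \<noteq> 0" "cmod (1 / z) \<le> 1" by (auto simp: norm_divide divide_simps)
    then show False
      using that r[rule_format, of "1 / z"] reg_ev_nonzero(1)[of "1 / z" r] by simp
  qed
  then show "tf_proper r \<and> (\<forall>z. tf_pole r z \<longrightarrow> cmod z < 1)"
    using r[rule_format, of 0] reg_at_0[of r] by simp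
qed

lemma holomorphic_on_hev: "hev d a holomorphic_on S"
  unfolding hev_def[abs_def] by (intro holomorphic_intros)

lemma holomorphic_on_ev:
  assumes "\<And>w. w \<in> S \<Longrightarrow> reg w r"
  shows "(\<lambda>w. ev w r) holomorphic_on S"
  unfolding ev_def using assms
  by (intro holomorphic_intros holomorphic_on_hev) (auto simp: reg_def)

section \<open>Matrices over a field\<close>

text \<open>The ring laws are stated with equations between dimensions instead of carriers, so that the
  simplifier can discharge the side conditions by computing dimensions.\<close>

lemma mat_assoc: "dim_col A = dim_row B \<Longrightarrow> dim_col B = dim_row C \<Longrightarrow> (A * B) * C = A * (B * C)"
  by (rule assoc_mult_mat[of A _ _ B _ C]) (auto intro: carrier_matI)

lemma mat_distribs:
  fixes A :: "'a::ring mat"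
  shows
  "dim_row A = dim_row B \<Longrightarrow> dim_col A = dim_col B \<Longrightarrow> dim_col A = dim_row C \<Longrightarrow> (A + B) * C = A * C + B * C"
  "dim_row B = dim_row C \<Longrightarrow> dim_col B = dim_col C \<Longrightarrow> dim_col A = dim_row B \<Longrightarrow> A * (B + C) = A * B + A * C"
  "dim_row A = dim_row B \<Longrightarrow> dim_col A = dim_col B \<Longrightarrow> dim_col A = dim_row C \<Longrightarrow> (A - B) * C = A * C - B * C"
  "dim_row B = dim_row C \<Longrightarrow> dim_col B = dim_col C \<Longrightarrow> dim_col A = dim_row B \<Longrightarrow> A * (B - C) = A * B - A * C"
  by (auto intro!: add_mult_distrib_mat[of _ "dim_row A" "dim_col A"] mult_add_distrib_mat[of _ "dim_row A" "dim_col A"]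
      minus_mult_distrib_mat[of _ "dim_row A" "dim_col A"] mult_minus_distrib_mat[of _ "dim_row A" "dim_col A"] carrier_matI)

lemma mat_minus_uminus:
  fixes A B :: "'a::group_add mat"
  shows "dim_row A = dim_row B \<Longrightarrow> dim_col A = dim_col B \<Longrightarrow> A - B = A + (- B)"
  by (rule eq_matI) auto

lemma mat_add_ac:
  fixes A B C :: "'a::ab_group_add mat"
  shows
  "dim_row A = dim_row B \<Longrightarrow> dim_col A = dim_col B \<Longrightarrow> A + B = B + A"
  "dim_row A = dim_row B \<Longrightarrow> dim_col A = dim_col B \<Longrightarrow> dim_row C = dim_row B \<Longrightarrow> dim_col C = dim_col B \<Longrightarrow>
    (A + B) + C = A + (B + C)"
  "dim_row A = dim_row B \<Longrightarrow> dim_col A = dim_col B \<Longrightarrow> dim_row C = dim_row B \<Longrightarrow> dim_col C = dim_col B \<Longrightarrow>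
    A + (B + C) = B + (A + C)"
  by (auto intro!: eq_matI simp: algebra_simps)

lemma mat_add_cancel:
  fixes A B :: "'a::ab_group_add mat"
  shows
  "dim_row A = n \<Longrightarrow> dim_col A = l \<Longrightarrow> 0\<^sub>m n l + A = A"
  "dim_row A = n \<Longrightarrow> dim_col A = l \<Longrightarrow> A + 0\<^sub>m n l = A"
  "A + - A = 0\<^sub>m (dim_row A) (dim_col A)"
  "- A + A = 0\<^sub>m (dim_row A) (dim_col A)"
  "dim_row A = dim_row B \<Longrightarrow> dim_col A = dim_col B \<Longrightarrow> A + (- A + B) = B"
  "dim_row A = dim_row B \<Longrightarrow> dim_col A = dim_col B \<Longrightarrow> - A + (A + B) = B"
  "dim_row A = dim_row B \<Longrightarrow> dim_col A = dim_col B \<Longrightarrow> - (A + B) = - A + - B"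
  by (auto intro!: eq_matI simp: algebra_simps)

lemma mat_smult_mult:
  fixes A B :: "'a::comm_ring_1 mat"
  shows "dim_col A = dim_row B \<Longrightarrow> (k \<cdot>\<^sub>m A) * B = k \<cdot>\<^sub>m (A * B)"
    "dim_col A = dim_row B \<Longrightarrow> A * (k \<cdot>\<^sub>m B) = k \<cdot>\<^sub>m (A * B)"
    "dim_row A = dim_row B \<Longrightarrow> dim_col A = dim_col B \<Longrightarrow> k \<cdot>\<^sub>m (A + B) = k \<cdot>\<^sub>m A + k \<cdot>\<^sub>m B"
    "k \<cdot>\<^sub>m (- A) = - (k \<cdot>\<^sub>m A)"
  by (auto intro!: eq_matI simp: algebra_simps)

lemmas mat_ring_simps = mat_assoc mat_distribs mat_minus_uminus mat_add_ac mat_add_cancel mat_smult_mult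

lemma mat_vec_assoc: "dim_col A = dim_row B \<Longrightarrow> dim_col B = dim_vec v \<Longrightarrow> (A * B) *\<^sub>v v = A *\<^sub>v (B *\<^sub>v v)"
  by (rule assoc_mult_mat_vec[of A _ _ B]) (auto intro: carrier_matI carrier_vecI)

lemma mat_vec_distribs:
  fixes A B :: "'a::comm_ring_1 mat"
  shows
  "dim_row A = dim_row B \<Longrightarrow> dim_col A = dim_col B \<Longrightarrow> dim_col A = dim_vec v \<Longrightarrow> (A + B) *\<^sub>v v = A *\<^sub>v v + B *\<^sub>v v"
  "dim_row A = dim_row B \<Longrightarrow> dim_col A = dim_col B \<Longrightarrow> dim_col A = dim_vec v \<Longrightarrow> (A - B) *\<^sub>v v = A *\<^sub>v v - B *\<^sub>v v"
  "dim_vec v = dim_vec w \<Longrightarrow> dim_col A = dim_vec v \<Longrightarrow> A *\<^sub>v (v + w) = A *\<^sub>v v + A *\<^sub>v w"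
  "dim_vec v = dim_vec w \<Longrightarrow> dim_col A = dim_vec v \<Longrightarrow> A *\<^sub>v (v - w) = A *\<^sub>v v - A *\<^sub>v w"
  by (auto intro!: add_mult_distrib_mat_vec[of _ "dim_row A" "dim_vec v"] minus_mult_distrib_mat_vec[of _ "dim_row A" "dim_vec v"]
      mult_add_distrib_mat_vec[of _ "dim_row A" "dim_vec v"] mult_minus_distrib_mat_vec[of _ "dim_row A" "dim_vec v"]
      carrier_matI carrier_vecI)

lemma mat_vec_smult:
  fixes A :: "'a::comm_ring_1 mat"
  shows
  "dim_col A = dim_vec v \<Longrightarrow> A *\<^sub>v (k \<cdot>\<^sub>v v) = k \<cdot>\<^sub>v (A *\<^sub>v v)"
  "dim_col A = dim_vec v \<Longrightarrow> (k \<cdot>\<^sub>m A) *\<^sub>v v = k \<cdot>\<^sub>v (A *\<^sub>v v)"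
  "dim_vec v = n \<Longrightarrow> 1\<^sub>m n *\<^sub>v v = v"
  by (auto intro!: eq_vecI carrier_vecI)

lemmas mat_vec_simps = mat_vec_assoc mat_vec_distribs mat_vec_smult

text \<open>A one-sided inverse of a square matrix over a field is two-sided, so one product determines the
  inverse.\<close>

lemma minv_eqI:
  assumes A: "A \<in> carrier_mat n n" and B: "B \<in> carrier_mat n n" and AB: "A * B = 1\<^sub>m n"
  shows "minv A = B" "invertible_mat A" "B * A = 1\<^sub>m n"
proof -
  show BA: "B * A = 1\<^sub>m n"
    by (rule mat_mult_left_right_inverse[OF A B AB])
  have "A \<in> Units (ring_mat TYPE('a) n ())"
    unfolding Units_def ring_mat_simps using A B AB BA by blast
  then obtain C where C: "mat_inverse A = Some C"
    using mat_inverse(1)[OF A, of "()"] by (cases "mat_inverse A") auto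
  have C': "A * C = 1\<^sub>m n" "C \<in> carrier_mat n n" using mat_inverse(2)[OF A C] by auto
  have "B * (A * C) = (B * A) * C" by (rule mat_assoc[symmetric]) (use A B C' in auto)
  then have "B * 1\<^sub>m n = 1\<^sub>m n * C" using BA C' by metis
  then have "B = C" using B left_mult_one_mat[OF C'(2)] by simp
  then show "minv A = B" unfolding minv_def C using A B C' by simp
  show "invertible_mat A"
    unfolding invertible_mat_def inverts_mat_def using A B AB BA by (intro conjI exI[of _ B]) auto
qed

lemma det_nonzero_minv:
  assumes A: "A \<in> carrier_mat n n" and d: "det A \<noteq> 0"
  shows "minv A = inverse (det A) \<cdot>\<^sub>m adj_mat A" "minv A \<in> carrier_mat n n"
    "A * minv A = 1\<^sub>m n" "minv A * A = 1\<^sub>m n" "invertible_mat A"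
proof -
  note adj = adj_mat[OF A]
  have c: "inverse (det A) \<cdot>\<^sub>m adj_mat A \<in> carrier_mat n n" using adj(1) by simp
  have "A * (inverse (det A) \<cdot>\<^sub>m adj_mat A) = inverse (det A) \<cdot>\<^sub>m (A * adj_mat A)"
    using A adj(1) by (simp add: mult_smult_distrib)
  also have "\<dots> = 1\<^sub>m n" unfolding adj(2) using d by (auto intro!: eq_matI)
  finally have eq: "A * (inverse (det A) \<cdot>\<^sub>m adj_mat A) = 1\<^sub>m n" .
  note m = minv_eqI[OF A c eq]
  show "minv A = inverse (det A) \<cdot>\<^sub>m adj_mat A" "minv A \<in> carrier_mat n n"
    "A * minv A = 1\<^sub>m n" "minv A * A = 1\<^sub>m n" "invertible_mat A"
    using m eq c by simp_all
qed

lemma invertible_matD: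
  assumes A: "A \<in> carrier_mat n n" and i: "invertible_mat (A :: 'a::field mat)"
  shows "minv A \<in> carrier_mat n n" "A * minv A = 1\<^sub>m n" "minv A * A = 1\<^sub>m n"
proof -
  from i obtain B where B: "A * B = 1\<^sub>m n" "B * A = 1\<^sub>m (dim_row B)"
    unfolding invertible_mat_def inverts_mat_def using A by auto
  have "dim_col B = n" using B(1) by (metis index_mult_mat(3) index_one_mat(3))
  moreover have "dim_row B = n" using B(2) A by (metis index_mult_mat(3) index_one_mat(3) carrier_matD(2))
  ultimately have "B \<in> carrier_mat n n" by auto
  from minv_eqI[OF A this B(1)] this B(1)
  show "minv A \<in> carrier_mat n n" "A * minv A = 1\<^sub>m n" "minv A * A = 1\<^sub>m n" by simp_all
qed

lemma det_nonzeroI: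
  assumes A: "(A :: 'a::field mat) \<in> carrier_mat n n"
    and "\<And>v. v \<in> carrier_vec n \<Longrightarrow> A *\<^sub>v v = 0\<^sub>v n \<Longrightarrow> v = 0\<^sub>v n"
  shows "det A \<noteq> 0"
  using det_0_iff_vec_prod_zero[OF A] assms(2) by blast

lemma det_nonzeroD:
  assumes A: "(A :: 'a::field mat) \<in> carrier_mat n n" and "det A \<noteq> 0"
    and "v \<in> carrier_vec n" "A *\<^sub>v v = 0\<^sub>v n"
  shows "v = 0\<^sub>v n"
  using det_0_iff_vec_prod_zero[OF A] assms(2-) by blast

section \<open>Matrices of rational functions regular at a point\<close>

definition mreg :: "complex \<Rightarrow> nat \<Rightarrow> nat \<Rightarrow> tf mat \<Rightarrow> bool" where
  "mreg w k l T \<longleftrightarrow> T \<in> carrier_mat k l \<and> (\<forall>i<k. \<forall>j<l. reg w (T $$ (i, j)))"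

abbreviation mev :: "complex \<Rightarrow> tf mat \<Rightarrow> complex mat" where
  "mev w T \<equiv> map_mat (ev w) T"

lemma mreg_carrier: "mreg w k l T \<Longrightarrow> T \<in> carrier_mat k l"
  by (simp add: mreg_def)

lemma RHinf_iff: "T \<in> RHinf k l \<longleftrightarrow> (\<forall>w. cmod w \<le> 1 \<longrightarrow> mreg w k l T)"
proof -
  have "T \<in> carrier_mat k l" if "\<forall>w. cmod w \<le> 1 \<longrightarrow> mreg w k l T"
    using that[rule_format, of 0] by (simp add: mreg_def)
  then show ?thesis
    unfolding RHinf_def mreg_def stable_iff_reg by auto
qed

lemma RHinf_carrier: "T \<in> RHinf k l \<Longrightarrow> T \<in> carrier_mat k l"
  by (simp add: RHinf_def)

lemma mreg_mult:
  assumes "mreg w k n T" "mreg w n l S"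
  shows "mreg w k l (T * S)" "mev w (T * S) = mev w T * mev w S"
proof -
  have c: "T \<in> carrier_mat k n" "S \<in> carrier_mat n l" using assms by (auto simp: mreg_def)
  have "reg w (\<Sum>h = 0..<n. T $$ (i, h) * S $$ (h, j)) \<and>
      ev w (\<Sum>h = 0..<n. T $$ (i, h) * S $$ (h, j)) = (\<Sum>h = 0..<n. ev w (T $$ (i, h)) * ev w (S $$ (h, j)))"
    if "i < k" "j < l" for i j
  proof -
    have r: "reg w (T $$ (i, h))" "reg w (S $$ (h, j))" if "h < n" for h
      using assms that \<open>i < k\<close> \<open>j < l\<close> by (auto simp: mreg_def)
    have 1: "reg w (\<Sum>h = 0..<n. T $$ (i, h) * S $$ (h, j))"
      by (rule reg_sum) (simp add: r reg_ev_mult)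
    have "ev w (\<Sum>h = 0..<n. T $$ (i, h) * S $$ (h, j)) = (\<Sum>h = 0..<n. ev w (T $$ (i, h) * S $$ (h, j)))"
      by (rule reg_sum) (simp add: r reg_ev_mult)
    also have "\<dots> = (\<Sum>h = 0..<n. ev w (T $$ (i, h)) * ev w (S $$ (h, j)))"
      by (rule sum.cong) (simp_all add: r reg_ev_mult)
    finally show ?thesis using 1 by blast
  qed
  then show "mreg w k l (T * S)" "mev w (T * S) = mev w T * mev w S"
    using c by (auto simp: mreg_def scalar_prod_def intro!: eq_matI)
qed

lemma mreg_add:
  assumes "mreg w k l T" "mreg w k l S"
  shows "mreg w k l (T + S)" "mev w (T + S) = mev w T + mev w S"
  using assms by (auto simp: mreg_def reg_ev_add intro!: eq_matI)

lemma mreg_diff: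
  assumes "mreg w k l T" "mreg w k l S"
  shows "mreg w k l (T - S)" "mev w (T - S) = mev w T - mev w S"
  using assms by (auto simp: mreg_def reg_ev_diff intro!: eq_matI)

lemma mreg_one: "mreg w n n (1\<^sub>m n)" "mev w (1\<^sub>m n) = 1\<^sub>m n"
  by (auto simp: mreg_def reg_ev_0 reg_ev_1 intro!: eq_matI)

lemma mreg_zero: "mreg w k l (0\<^sub>m k l)" "mev w (0\<^sub>m k l) = 0\<^sub>m k l"
  by (auto simp: mreg_def reg_ev_0 intro!: eq_matI)

lemma mreg_smult:
  assumes "reg w r" "mreg w k l T"
  shows "mreg w k l (r \<cdot>\<^sub>m T)" "mev w (r \<cdot>\<^sub>m T) = ev w r \<cdot>\<^sub>m mev w T"
  using assms by (auto simp: mreg_def reg_ev_mult intro!: eq_matI)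

abbreviation cmat :: "real mat \<Rightarrow> complex mat" where
  "cmat A \<equiv> map_mat complex_of_real A"

lemma mreg_const:
  assumes "A \<in> carrier_mat k l"
  shows "mreg w k l (const_tf A)" "mev w (const_tf A) = cmat A"
  using assms by (auto simp: mreg_def const_tf_def reg_ev_const intro!: eq_matI)

lemma mreg_four_block:
  assumes "mreg w k1 l1 A" "mreg w k1 l2 B" "mreg w k2 l1 C" "mreg w k2 l2 D"
  shows "mreg w (k1 + k2) (l1 + l2) (four_block_mat A B C D)"
  using assms by (auto simp: mreg_def)

lemma mreg_append_rows:
  assumes "mreg w k1 l A" "mreg w k2 l B"
  shows "mreg w (k1 + k2) l (A @\<^sub>r B)"
proof -
  have "dim_row A = k1" "dim_row B = k2" using assms by (auto simp: mreg_def)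
  then show ?thesis
    unfolding append_rows_def using mreg_four_block[OF assms(1) mreg_zero(1)[of w k1 0] assms(2) mreg_zero(1)[of w k2 0]]
    by simp
qed

lemma mreg_append_cols:
  assumes "mreg w k l1 A" "mreg w k l2 B"
  shows "mreg w k (l1 + l2) (append_cols A B)"
proof -
  have "dim_col A = l1" "dim_col B = l2" using assms by (auto simp: mreg_def)
  then show ?thesis
    unfolding append_cols_def using mreg_four_block[OF assms mreg_zero(1)[of w 0 l1] mreg_zero(1)[of w 0 l2]]
    by simp
qed

lemma mreg_det:
  assumes T: "mreg w n n T"
  shows "reg w (det T)" "ev w (det T) = det (mev w T)"
proof -
  have c: "T \<in> carrier_mat n n" using T by (simp add: mreg_def)
  have s: "reg w (signof p) \<and> ev w (signof p) = signof p" for p :: "nat \<Rightarrow> nat"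
    by (cases p rule: sign_cases) (simp_all add: reg_ev_1 reg_ev_uminus)
  have p: "reg w (\<Prod>i = 0..<n. T $$ (i, p i)) \<and>
      ev w (\<Prod>i = 0..<n. T $$ (i, p i)) = (\<Prod>i = 0..<n. mev w T $$ (i, p i))"
    if "p permutes {0..<n}" for p
  proof -
    have "p i < n" if "i < n" for i
      using permutes_in_image[OF \<open>p permutes {0..<n}\<close>, of i] that by simp
    then show ?thesis using T c by (auto simp: mreg_def intro!: reg_prod prod.cong)
  qed
  have sp: "reg w (signof p * (\<Prod>i = 0..<n. T $$ (i, p i)))"
    "ev w (signof p * (\<Prod>i = 0..<n. T $$ (i, p i))) = signof p * (\<Prod>i = 0..<n. mev w T $$ (i, p i))"
    if "p \<in> {p. p permutes {0..<n}}" for p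
    using s[of p] p[of p] that by (simp_all add: reg_ev_mult)
  show "reg w (det T)"
    unfolding det_def'[OF c] by (rule reg_sum(1)[OF sp(1)])
  show "ev w (det T) = det (mev w T)"
    unfolding det_def'[OF c] det_def'[OF iffD2[OF map_carrier_mat c]]
    by (rule trans[OF reg_sum(2)[OF sp(1)] sum.cong[OF refl sp(2)]])
qed

lemma mreg_adj:
  assumes T: "mreg w n n T"
  shows "mreg w n n (adj_mat T)"
proof -
  have c: "T \<in> carrier_mat n n" using T by (simp add: mreg_def)
  have "reg w (cofactor T i j)" if "i < n" "j < n" for i j
  proof -
    have "mreg w (n - 1) (n - 1) (mat_delete T i j)"
      using T that by (auto simp: mreg_def mat_delete_def)
    then have "reg w (det (mat_delete T i j))" by (rule mreg_det)
    moreover have "reg w ((-1) ^ (i + j))"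
      by (cases "even (i + j)") (simp_all add: reg_ev_1 reg_ev_uminus)
    ultimately show ?thesis unfolding cofactor_def by (rule reg_ev_mult(1)[rotated])
  qed
  then show ?thesis using c by (auto simp: mreg_def adj_mat_def)
qed

text \<open>By Cramer's rule the inverse is the adjugate over the determinant, and the determinant has a
  regular inverse because its value at \<open>w\<close> is nonzero.\<close>

lemma mreg_minv:
  assumes T: "mreg w n n T" and nz: "det (mev w T) \<noteq> 0"
  shows "mreg w n n (minv T)" "T * minv T = 1\<^sub>m n" "minv T * T = 1\<^sub>m n" "invertible_mat T"
proof -
  have c: "T \<in> carrier_mat n n" using T by (simp add: mreg_def)
  note d = mreg_det[OF T]
  have nz': "det T \<noteq> 0" using d(2) nz by (auto simp: reg_ev_0)
  note m = det_nonzero_minv[OF c nz']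
  show "T * minv T = 1\<^sub>m n" "minv T * T = 1\<^sub>m n" "invertible_mat T" using m by simp_all
  have "reg w (inverse (det T))" using d nz by (intro reg_inverse) simp_all
  then show "mreg w n n (minv T)"
    unfolding m(1) by (intro mreg_smult mreg_adj T)
qed

section \<open>The largest singular value is the operator norm\<close>

definition vnorm :: "complex vec \<Rightarrow> real" where
  "vnorm v = L2_set (\<lambda>i. cmod (v $ i)) {..<dim_vec v}"

text \<open>The Hermitian inner product, linear in the first argument.\<close>

definition cip :: "complex vec \<Rightarrow> complex vec \<Rightarrow> complex" where
  "cip u v = (\<Sum>i<dim_vec u. u $ i * cnj (v $ i))"

lemma vnorm_nonneg [simp]: "vnorm v \<ge> 0"
  by (simp add: vnorm_def)

lemma vnorm_eq_0_iff: "v \<in> carrier_vec n \<Longrightarrow> vnorm v = 0 \<longleftrightarrow> v = 0\<^sub>v n"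
  by (auto simp: vnorm_def L2_set_eq_0_iff)

lemma vnorm_uminus: "vnorm (- v) = vnorm v"
  by (simp add: vnorm_def L2_set_def)

lemma vnorm_zero [simp]: "vnorm (0\<^sub>v n) = 0"
  by (simp add: vnorm_def L2_set_def)

lemma vnorm_triangle:
  assumes "u \<in> carrier_vec n" "v \<in> carrier_vec n"
  shows "vnorm (u + v) \<le> vnorm u + vnorm v"
proof -
  have "vnorm (u + v) \<le> L2_set (\<lambda>i. cmod (u $ i) + cmod (v $ i)) {..<n}"
    using assms unfolding vnorm_def by (auto intro!: L2_set_mono norm_triangle_ineq)
  also have "\<dots> \<le> vnorm u + vnorm v"
    using assms L2_set_triangle_ineq unfolding vnorm_def by fastforce
  finally show ?thesis .
qed

lemma cip_self: "cip v v = of_real ((vnorm v)\<^sup>2)"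
  by (simp add: cip_def vnorm_def L2_set_def sum_nonneg complex_norm_square[symmetric])

lemma cip_bound:
  assumes "u \<in> carrier_vec n" "v \<in> carrier_vec n"
  shows "cmod (cip u v) \<le> vnorm u * vnorm v"
proof -
  have "cmod (cip u v) \<le> (\<Sum>i<n. cmod (u $ i * cnj (v $ i)))"
    using assms unfolding cip_def by (auto intro: norm_sum)
  also have "\<dots> = (\<Sum>i<n. \<bar>cmod (u $ i)\<bar> * \<bar>cmod (v $ i)\<bar>)"
    by (simp add: norm_mult)
  also have "\<dots> \<le> vnorm u * vnorm v"
    using assms L2_set_mult_ineq[of "\<lambda>i. cmod (u $ i)" "\<lambda>i. cmod (v $ i)" "{..<n}"] unfolding vnorm_def by simp
  finally show ?thesis .
qed

lemma cip_smult: "cip (c \<cdot>\<^sub>v u) v = c * cip u v"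
  by (simp add: cip_def sum_distrib_left mult_ac)

lemma cip_smult_right:
  assumes "u \<in> carrier_vec n" "v \<in> carrier_vec n"
  shows "cip u (c \<cdot>\<^sub>v v) = cnj c * cip u v"
  using assms by (simp add: cip_def sum_distrib_left mult_ac)

lemma index_mat_mult_vec:
  "A \<in> carrier_mat k l \<Longrightarrow> v \<in> carrier_vec l \<Longrightarrow> i < k \<Longrightarrow> (A *\<^sub>v v) $ i = (\<Sum>j<l. A $$ (i, j) * v $ j)"
  by (simp add: scalar_prod_def lessThan_atLeast0)

lemma mat_adjoint_carrier: "M \<in> carrier_mat k l \<Longrightarrow> mat_adjoint M \<in> carrier_mat l k"
  by (auto simp: mat_adjoint_def)

lemma index_mat_adjoint:
  fixes M :: "complex mat"
  shows "M \<in> carrier_mat k l \<Longrightarrow> i < l \<Longrightarrow> j < k \<Longrightarrow> mat_adjoint M $$ (i, j) = cnj (M $$ (j, i))"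
  by (simp add: mat_adjoint_def mat_of_rows_index)

lemma cip_adjoint:
  assumes M: "M \<in> carrier_mat k l" and u: "u \<in> carrier_vec k" and v: "v \<in> carrier_vec l"
  shows "cip (mat_adjoint M *\<^sub>v u) v = cip u (M *\<^sub>v v)"
proof -
  have "cip (mat_adjoint M *\<^sub>v u) v = (\<Sum>j<l. \<Sum>i<k. cnj (M $$ (i, j)) * u $ i * cnj (v $ j))"
    using M u v mat_adjoint_carrier[OF M]
    by (simp add: cip_def index_mat_mult_vec[OF mat_adjoint_carrier[OF M] u] index_mat_adjoint[OF M] sum_distrib_right
        del: index_mult_mat_vec)
  also have "\<dots> = (\<Sum>i<k. \<Sum>j<l. cnj (M $$ (i, j)) * u $ i * cnj (v $ j))"
    by (rule sum.swap)
  also have "\<dots> = cip u (M *\<^sub>v v)"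
    using u by (simp add: cip_def index_mat_mult_vec[OF M v] sum_distrib_left mult_ac del: index_mult_mat_vec)
  finally show ?thesis .
qed

lemma cip_gram:
  assumes M: "M \<in> carrier_mat k l" and u: "u \<in> carrier_vec l" and v: "v \<in> carrier_vec l"
  shows "cip ((mat_adjoint M * M) *\<^sub>v u) v = cip (M *\<^sub>v u) (M *\<^sub>v v)"
proof -
  have "(mat_adjoint M * M) *\<^sub>v u = mat_adjoint M *\<^sub>v (M *\<^sub>v u)"
    using M u mat_adjoint_carrier[OF M] by (intro assoc_mult_mat_vec)
  then show ?thesis using cip_adjoint[OF M _ v, of "M *\<^sub>v u"] M u by simp
qed

lemma gram_eigenvalue:
  assumes M: "M \<in> carrier_mat k l" and e: "eigenvector (mat_adjoint M * M) v a"
  shows "v \<in> carrier_vec l" "vnorm v \<noteq> 0" "a * of_real ((vnorm v)\<^sup>2) = of_real ((vnorm (M *\<^sub>v v))\<^sup>2)"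
proof -
  have "dim_row (mat_adjoint M * M) = l" using mat_adjoint_carrier[OF M] by simp
  then have v: "v \<in> carrier_vec l" "v \<noteq> 0\<^sub>v l" "(mat_adjoint M * M) *\<^sub>v v = a \<cdot>\<^sub>v v"
    using e by (simp_all add: eigenvector_def)
  then show "v \<in> carrier_vec l" "vnorm v \<noteq> 0" by (simp_all add: vnorm_eq_0_iff)
  show "a * of_real ((vnorm v)\<^sup>2) = of_real ((vnorm (M *\<^sub>v v))\<^sup>2)"
    using cip_gram[OF M v(1) v(1)] v(3) by (simp add: cip_smult cip_self)
qed

lemma finite_singular_values:
  assumes M: "M \<in> carrier_mat k l"
  shows "finite (singular_values M)"
proof -
  have H: "mat_adjoint M * M \<in> carrier_mat l l" using M mat_adjoint_carrier[OF M] by simp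
  have "(\<lambda>s. complex_of_real (s\<^sup>2)) ` singular_values M \<subseteq> spectrum (mat_adjoint M * M)"
    by (auto simp: singular_values_def spectrum_def)
  then have "finite ((\<lambda>s. complex_of_real (s\<^sup>2)) ` singular_values M)"
    using card_finite_spectrum(1)[OF H] finite_subset by blast
  moreover have "inj_on (\<lambda>s. complex_of_real (s\<^sup>2)) (singular_values M)"
    by (auto simp: inj_on_def singular_values_def simp flip: of_real_power)
  ultimately show ?thesis by (rule finite_imageD)
qed

lemma sigma_max_nonneg: "M \<in> carrier_mat k l \<Longrightarrow> sigma_max M \<ge> 0"
  unfolding sigma_max_def by (rule Max_ge) (auto intro: finite_singular_values)

lemma sigma_max_le:
  assumes M: "M \<in> carrier_mat k l" and c: "c \<ge> 0"
    and le: "\<And>v. v \<in> carrier_vec l \<Longrightarrow> vnorm (M *\<^sub>v v) \<le> c * vnorm v"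
  shows "sigma_max M \<le> c"
proof -
  have "s \<le> c" if s: "s \<in> singular_values M" for s
  proof -
    obtain v where v: "eigenvector (mat_adjoint M * M) v (complex_of_real (s\<^sup>2))" and s0: "s \<ge> 0"
      using s by (auto simp: singular_values_def eigenvalue_def)
    note g = gram_eigenvalue[OF M v]
    have "(s * vnorm v)\<^sup>2 = (vnorm (M *\<^sub>v v))\<^sup>2"
      using g(3) by (simp add: power_mult_distrib flip: of_real_mult of_real_power)
    then have "s * vnorm v = vnorm (M *\<^sub>v v)" using s0 by simp
    then have "s * vnorm v \<le> c * vnorm v" using le[OF g(1)] by simp
    moreover have "vnorm v > 0" using g(2) vnorm_nonneg[of v] by linarith
    ultimately show ?thesis by simp
  qed
  then show ?thesis
    unfolding sigma_max_def using finite_singular_values[OF M] c by simp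
qed

lemma pow_mat_vec_Suc:
  assumes A: "(A :: 'a::comm_ring_1 mat) \<in> carrier_mat n n" and v: "v \<in> carrier_vec n"
  shows "(A ^\<^sub>m Suc j) *\<^sub>v v = A *\<^sub>v ((A ^\<^sub>m j) *\<^sub>v v)"
  using v
proof (induction j arbitrary: v)
  case 0
  then show ?case using A by simp
next
  case (Suc j)
  have "(A ^\<^sub>m Suc (Suc j)) *\<^sub>v v = (A ^\<^sub>m Suc j) *\<^sub>v (A *\<^sub>v v)"
    using A Suc.prems by (simp add: mat_vec_simps)
  also have "\<dots> = A *\<^sub>v ((A ^\<^sub>m j) *\<^sub>v (A *\<^sub>v v))"
    by (rule Suc.IH) (use A Suc.prems in auto)
  also have "(A ^\<^sub>m j) *\<^sub>v (A *\<^sub>v v) = (A ^\<^sub>m Suc j) *\<^sub>v v"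
    using A Suc.prems by (simp add: mat_vec_simps)
  finally show ?case .
qed

lemma pow_mat_vec_add:
  assumes A: "(A :: 'a::comm_ring_1 mat) \<in> carrier_mat n n" and v: "v \<in> carrier_vec n"
  shows "(A ^\<^sub>m (i + j)) *\<^sub>v v = (A ^\<^sub>m i) *\<^sub>v ((A ^\<^sub>m j) *\<^sub>v v)"
proof (induction i)
  case 0
  have "(A ^\<^sub>m j) *\<^sub>v v \<in> carrier_vec n" by (rule mult_mat_vec_carrier[OF pow_carrier_mat[OF A] v])
  then show ?case using A by simp
next
  case (Suc i)
  have "(A ^\<^sub>m j) *\<^sub>v v \<in> carrier_vec n" by (rule mult_mat_vec_carrier[OF pow_carrier_mat[OF A] v])
  then show ?case using Suc pow_mat_vec_Suc[OF A v, of "i + j"] pow_mat_vec_Suc[OF A, of "(A ^\<^sub>m j) *\<^sub>v v" i]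
    by simp
qed

lemma self_adjoint_pow:
  assumes A: "A \<in> carrier_mat n n"
    and sa: "\<And>u v. u \<in> carrier_vec n \<Longrightarrow> v \<in> carrier_vec n \<Longrightarrow> cip (A *\<^sub>v u) v = cip u (A *\<^sub>v v)"
    and u: "u \<in> carrier_vec n" and v: "v \<in> carrier_vec n"
  shows "cip ((A ^\<^sub>m j) *\<^sub>v u) v = cip u ((A ^\<^sub>m j) *\<^sub>v v)"
  using v
proof (induction j arbitrary: v)
  case 0
  then show ?case using A u by simp
next
  case (Suc j)
  have c: "(A ^\<^sub>m j) *\<^sub>v u \<in> carrier_vec n" by (rule mult_mat_vec_carrier[OF pow_carrier_mat[OF A] u])
  have "cip ((A ^\<^sub>m Suc j) *\<^sub>v u) v = cip ((A ^\<^sub>m j) *\<^sub>v u) (A *\<^sub>v v)"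
    unfolding pow_mat_vec_Suc[OF A u] by (rule sa[OF c Suc.prems])
  also have "\<dots> = cip u ((A ^\<^sub>m j) *\<^sub>v (A *\<^sub>v v))"
    by (rule Suc.IH) (use A Suc.prems in auto)
  also have "(A ^\<^sub>m j) *\<^sub>v (A *\<^sub>v v) = (A ^\<^sub>m Suc j) *\<^sub>v v"
    using A Suc.prems by (simp add: mat_vec_simps)
  finally show ?case .
qed

lemma entrywise_bound_vnorm:
  assumes M: "M \<in> carrier_mat k l" and v: "v \<in> carrier_vec l"
    and b: "\<And>i j. i < k \<Longrightarrow> j < l \<Longrightarrow> cmod (M $$ (i, j)) \<le> b i j"
  shows "vnorm (M *\<^sub>v v) \<le> (\<Sum>i<k. \<Sum>j<l. b i j) * vnorm v"
proof -
  have "vnorm (M *\<^sub>v v) \<le> (\<Sum>i<k. cmod ((M *\<^sub>v v) $ i))"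
    using M unfolding vnorm_def by (simp add: L2_set_le_sum del: index_mult_mat_vec)
  also have "\<dots> \<le> (\<Sum>i<k. \<Sum>j<l. b i j * vnorm v)"
  proof (rule sum_mono)
    fix i assume i: "i \<in> {..<k}"
    have "cmod ((M *\<^sub>v v) $ i) \<le> (\<Sum>j<l. cmod (M $$ (i, j) * v $ j))"
      using i by (simp only: index_mat_mult_vec[OF M v] lessThan_iff norm_sum)
    also have "\<dots> \<le> (\<Sum>j<l. b i j * vnorm v)"
    proof (rule sum_mono)
      fix j assume j: "j \<in> {..<l}"
      have "cmod (v $ j) \<le> vnorm v"
        using v j unfolding vnorm_def by (auto intro!: member_le_L2_set[where f = "\<lambda>i. cmod (v $ i)"])
      moreover have "cmod (M $$ (i, j)) \<le> b i j" using b i j by simp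
      ultimately show "cmod (M $$ (i, j) * v $ j) \<le> b i j * vnorm v"
        unfolding norm_mult by (intro mult_mono) (auto intro: order.trans[OF norm_ge_zero])
    qed
    finally show "cmod ((M *\<^sub>v v) $ i) \<le> (\<Sum>j<l. b i j * vnorm v)" .
  qed
  finally show ?thesis by (simp add: sum_distrib_right)
qed

text \<open>A first term above \<open>1\<close> would be squared again and again.\<close>

lemma bounded_doubling_sequence_le_1:
  fixes c :: "nat \<Rightarrow> real"
  assumes dbl: "\<And>k. (c k)\<^sup>2 \<le> c (Suc k)" and bd: "\<And>k. c k \<le> B"
  shows "c 0 \<le> 1"
proof (rule ccontr)
  assume "\<not> c 0 \<le> 1"
  then have c0: "c 0 > 1" by simp
  have "c 0 ^ (2 ^ k) \<le> c k" for k
  proof (induction k)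
    case (Suc k)
    have "c 0 ^ (2 ^ Suc k) = (c 0 ^ (2 ^ k))\<^sup>2" by (simp only: power_Suc power_even_eq)
    also have "\<dots> \<le> (c k)\<^sup>2" using Suc c0 by (intro power_mono) auto
    also have "\<dots> \<le> c (Suc k)" by (rule dbl)
    finally show ?case .
  qed simp
  moreover obtain m where m: "B < c 0 ^ m" using real_arch_pow[OF c0] by blast
  moreover have "c 0 ^ m \<le> c 0 ^ (2 ^ m)"
    using c0 by (intro power_increasing) (auto simp: less_imp_le)
  ultimately show False using bd[of m] by (meson not_less order.trans)
qed

text \<open>For \<open>s\<close> above the largest singular value, the self-adjoint matrix \<open>A = M\<^sup>* M / s\<^sup>2\<close> has spectral radius
  below \<open>1\<close>, so its powers are bounded. Self-adjointness and the Cauchy-Schwarz inequality give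
  \<open>|A\<^sup>j v|\<^sup>2 \<le> |v| |A\<^sup>2\<^sup>j v|\<close>, and a bounded sequence with this doubling property starts with
  \<open>|A v| \<le> |v|\<close>. Then \<open>|M v|\<^sup>2 = s\<^sup>2 \<langle>A v, v\<rangle> \<le> s\<^sup>2 |v|\<^sup>2\<close>.\<close>

lemma sigma_max_bound:
  assumes M: "M \<in> carrier_mat k l" and v: "v \<in> carrier_vec l"
  shows "vnorm (M *\<^sub>v v) \<le> sigma_max M * vnorm v"
proof (cases "v = 0\<^sub>v l")
  case True
  then have "M *\<^sub>v v = 0\<^sub>v k" using M by (intro eq_vecI) (auto simp: scalar_prod_def)
  then show ?thesis using True by simp
next
  case False
  then have v0: "vnorm v > 0" using vnorm_eq_0_iff[OF v] vnorm_nonneg[of v] by linarith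
  have l: "l > 0" using False v by (cases l) auto
  have "vnorm (M *\<^sub>v v) \<le> s * vnorm v" if s: "s > sigma_max M" for s
  proof -
    have s0: "s > 0" using s sigma_max_nonneg[OF M] by linarith
    define H where "H = mat_adjoint M * M"
    \<comment> \<open>scaled to spectral radius below \<open>1\<close>\<close>
    define A where "A = complex_of_real (1 / s\<^sup>2) \<cdot>\<^sub>m H"
    have H: "H \<in> carrier_mat l l" using M mat_adjoint_carrier[OF M] by (simp add: H_def)
    then have A: "A \<in> carrier_mat l l" by (simp add: A_def)
    have Av: "A *\<^sub>v u = complex_of_real (1 / s\<^sup>2) \<cdot>\<^sub>v (H *\<^sub>v u)" if "u \<in> carrier_vec l" for u
      using H that by (simp add: A_def mat_vec_simps)
    have "spectral_radius A < 1"
    proof -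
      obtain a where a: "a \<in> spectrum A" "spectral_radius A = cmod a"
        using spectral_radius_mem_max(1)[OF A l] by auto
      then obtain u where u: "u \<in> carrier_vec l" "u \<noteq> 0\<^sub>v l" "A *\<^sub>v u = a \<cdot>\<^sub>v u"
        using A by (auto simp: spectrum_def eigenvalue_def eigenvector_def)
      have "complex_of_real (s\<^sup>2) \<cdot>\<^sub>v (A *\<^sub>v u) = H *\<^sub>v u"
        using Av[OF u(1)] s0 by (simp add: smult_smult_assoc)
      then have eH: "eigenvector H u (complex_of_real (s\<^sup>2) * a)"
        using u H by (simp add: eigenvector_def smult_smult_assoc)
      note g = gram_eigenvalue[OF M eH[unfolded H_def]]
      \<comment> \<open>an eigenvalue of the Gram matrix is the square of this singular value\<close>
      define t where "t = vnorm (M *\<^sub>v u) / vnorm u"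
      have t0: "t \<ge> 0" by (simp add: t_def)
      have eq: "complex_of_real (s\<^sup>2) * a = complex_of_real (t\<^sup>2)"
        using g(2,3) by (simp add: t_def power_divide field_simps)
      then have "eigenvalue (mat_adjoint M * M) (complex_of_real (t\<^sup>2))"
        using eH unfolding H_def eigenvalue_def by metis
      then have "t \<in> singular_values M"
        using t0 by (simp add: singular_values_def)
      then have "t \<le> sigma_max M"
        unfolding sigma_max_def using finite_singular_values[OF M] by (intro Max_ge) auto
      then have ts: "t < s" using s by simp
      have "cmod (complex_of_real (s\<^sup>2) * a) = t\<^sup>2" unfolding eq by (simp add: norm_power)
      then have "cmod a = t\<^sup>2 / s\<^sup>2" using s0 by (simp add: norm_mult norm_power field_simps)
      also have "\<dots> < 1" using ts t0 s0 by (simp add: power_strict_mono)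
      finally show ?thesis using a by simp
    qed
    then obtain C where C: "\<And>j. norm_bound (A ^\<^sub>m j) C"
      using spectral_radius_jnf_norm_bound_less_1_upper_triangular[OF A] by blast
    have sa: "cip (A *\<^sub>v x) y = cip x (A *\<^sub>v y)" if x: "x \<in> carrier_vec l" and y: "y \<in> carrier_vec l" for x y
    proof -
      have "cip (H *\<^sub>v x) y = cip (M *\<^sub>v x) (M *\<^sub>v y)" unfolding H_def by (rule cip_gram[OF M x y])
      moreover have "cip x (H *\<^sub>v y) = cip (M *\<^sub>v x) (M *\<^sub>v y)"
      proof -
        have "cip x (H *\<^sub>v y) = cnj (cip (H *\<^sub>v y) x)"
          using x H by (simp add: cip_def mult.commute)
        also have "\<dots> = cnj (cip (M *\<^sub>v y) (M *\<^sub>v x))" unfolding H_def by (simp only: cip_gram[OF M y x])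
        also have "\<dots> = cip (M *\<^sub>v x) (M *\<^sub>v y)" by (simp add: cip_def mult.commute)
        finally show ?thesis .
      qed
      moreover have "H *\<^sub>v y \<in> carrier_vec l" using H y by auto
      ultimately show ?thesis
        using x y by (simp add: Av cip_smult cip_smult_right[of _ l])
    qed
    define c where "c j = vnorm ((A ^\<^sub>m (2 ^ j)) *\<^sub>v v) / vnorm v" for j
    have Ac: "(A ^\<^sub>m j) *\<^sub>v v \<in> carrier_vec l" for j by (rule mult_mat_vec_carrier[OF pow_carrier_mat[OF A] v])
    have "c 0 \<le> 1"
    proof (rule bounded_doubling_sequence_le_1)
      fix j
      let ?w = "(A ^\<^sub>m (2 ^ j)) *\<^sub>v v"
      have "complex_of_real ((vnorm ?w)\<^sup>2) = cip v ((A ^\<^sub>m (2 ^ j)) *\<^sub>v ?w)"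
        unfolding cip_self[symmetric] by (rule self_adjoint_pow[OF A sa v Ac])
      also have "(A ^\<^sub>m (2 ^ j)) *\<^sub>v ?w = (A ^\<^sub>m (2 ^ Suc j)) *\<^sub>v v"
        using pow_mat_vec_add[OF A v, of "2 ^ j" "2 ^ j"] by (simp add: mult_2)
      finally have "cmod (complex_of_real ((vnorm ?w)\<^sup>2)) \<le> vnorm v * vnorm ((A ^\<^sub>m (2 ^ Suc j)) *\<^sub>v v)"
        using cip_bound[OF v Ac] by simp
      then have "(vnorm ?w)\<^sup>2 \<le> vnorm v * vnorm ((A ^\<^sub>m (2 ^ Suc j)) *\<^sub>v v)"
        by (simp add: norm_power)
      then have "(vnorm ?w)\<^sup>2 / (vnorm v)\<^sup>2 \<le> (vnorm v * vnorm ((A ^\<^sub>m (2 ^ Suc j)) *\<^sub>v v)) / (vnorm v)\<^sup>2"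
        by (rule divide_right_mono) simp
      then show "(c j)\<^sup>2 \<le> c (Suc j)"
        unfolding c_def power_divide using v0 by (simp add: power2_eq_square)
    next
      fix j
      have "vnorm ((A ^\<^sub>m (2 ^ j)) *\<^sub>v v) \<le> (\<Sum>i<l. \<Sum>j<l. C) * vnorm v"
        using C[of "2 ^ j"] A by (intro entrywise_bound_vnorm v) (auto simp: norm_bound_def)
      then show "c j \<le> (\<Sum>i<l. \<Sum>j<l. C)" unfolding c_def using v0 by (simp add: divide_le_eq)
    qed
    then have Avn: "vnorm (A *\<^sub>v v) \<le> vnorm v" using v0 A by (simp add: c_def)
    have "cip (A *\<^sub>v v) v = complex_of_real ((vnorm (M *\<^sub>v v))\<^sup>2 / s\<^sup>2)"
      using cip_gram[OF M v v] v by (simp add: Av H_def[symmetric] cip_smult cip_self)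
    moreover have "cmod (cip (A *\<^sub>v v) v) \<le> vnorm (A *\<^sub>v v) * vnorm v"
      using A v by (intro cip_bound) auto
    ultimately have "(vnorm (M *\<^sub>v v))\<^sup>2 / s\<^sup>2 \<le> vnorm (A *\<^sub>v v) * vnorm v"
      by (simp add: norm_divide norm_power)
    also have "\<dots> \<le> vnorm v * vnorm v" using Avn by (intro mult_right_mono) auto
    finally have "(vnorm (M *\<^sub>v v))\<^sup>2 \<le> (s * vnorm v)\<^sup>2"
      using s0 by (simp add: field_simps power2_eq_square)
    then show ?thesis using s0 by (simp add: power2_le_iff_abs_le abs_le_square_iff[symmetric])
  qed
  then have "vnorm (M *\<^sub>v v) / vnorm v \<le> s" if "s > sigma_max M" for s
    using that v0 by (simp add: divide_le_eq)
  then have "vnorm (M *\<^sub>v v) / vnorm v \<le> sigma_max M" by (rule dense_ge)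
  then show ?thesis using v0 by (simp add: divide_le_eq)
qed

section \<open>The H-infinity norm as a supremum over the unit circle\<close>

lemma eval_eq_mev:
  assumes "cmod z = 1"
  shows "map_mat (\<lambda>r. tf_eval r z) T = mev (1 / z) T"
proof -
  have "z \<noteq> 0" using assms by auto
  then show ?thesis using reg_ev_nonzero(2)[of "1 / z"] by (intro eq_matI) auto
qed

lemma bounded_ev_on_circle:
  assumes "\<And>w. cmod w \<le> 1 \<Longrightarrow> reg w r"
  obtains b where "\<And>w. cmod w = 1 \<Longrightarrow> cmod (ev w r) \<le> b"
proof -
  have "continuous_on (cball 0 1) (\<lambda>w. ev w r)"
    using assms by (intro holomorphic_on_imp_continuous_on holomorphic_on_ev) auto
  then have "bounded ((\<lambda>w. ev w r) ` cball 0 1)"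
    by (intro compact_imp_bounded compact_continuous_image) auto
  then obtain b where b: "\<forall>x\<in>(\<lambda>w. ev w r) ` cball 0 1. cmod x \<le> b"
    unfolding bounded_iff by blast
  have "cmod (ev w r) \<le> b" if "cmod w = 1" for w
    using b that by (simp del: image_iff)
  then show ?thesis by (rule that)
qed

text \<open>The supremum in the H-infinity norm of a stable matrix is a genuine one, since the entries are
  continuous on the compact unit circle.\<close>

lemma bdd_above_sigma_max:
  assumes T: "T \<in> RHinf k l"
  shows "bdd_above ((\<lambda>z. sigma_max (map_mat (\<lambda>r. tf_eval r z) T)) ` {z. cmod z = 1})"
proof -
  have c: "T \<in> carrier_mat k l" by (rule RHinf_carrier[OF T])
  have "\<exists>b. \<forall>w. cmod w = 1 \<longrightarrow> cmod (ev w (T $$ (i, j))) \<le> b" if "i < k" "j < l" for i j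
    using bounded_ev_on_circle[of "T $$ (i, j)"] T that unfolding RHinf_iff mreg_def by metis
  then obtain b where b: "\<And>i j w. i < k \<Longrightarrow> j < l \<Longrightarrow> cmod w = 1 \<Longrightarrow> cmod (ev w (T $$ (i, j))) \<le> b i j"
    by metis
  let ?B = "\<Sum>i<k. \<Sum>j<l. b i j"
  have B: "?B \<ge> 0"
    by (intro sum_nonneg) (metis b norm_one norm_ge_zero order.trans lessThan_iff)
  have "sigma_max (map_mat (\<lambda>r. tf_eval r z) T) \<le> ?B" if z: "cmod z = 1" for z
    unfolding eval_eq_mev[OF z]
  proof (rule sigma_max_le[of _ k l])
    fix v :: "complex vec" assume v: "v \<in> carrier_vec l"
    show "vnorm (mev (1 / z) T *\<^sub>v v) \<le> ?B * vnorm v"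
      by (rule entrywise_bound_vnorm[of _ k l]) (use c v z b in \<open>auto simp: norm_divide\<close>)
  qed (use c B in auto)
  then show ?thesis by (intro bdd_aboveI2[where M = ?B]) simp
qed

lemma hinf_norm_bound:
  assumes T: "T \<in> RHinf k l" and w: "cmod w = 1" and v: "v \<in> carrier_vec l"
  shows "vnorm (mev w T *\<^sub>v v) \<le> hinf_norm T * vnorm v"
proof -
  have c: "mev w T \<in> carrier_mat k l" using RHinf_carrier[OF T] by simp
  have z: "cmod (1 / w) = 1" using w by (simp add: norm_divide)
  have "sigma_max (mev w T) = sigma_max (map_mat (\<lambda>r. tf_eval r (1 / w)) T)"
    unfolding eval_eq_mev[OF z] by simp
  also have "\<dots> \<le> hinf_norm T"
    unfolding hinf_norm_def using z by (intro cSUP_upper bdd_above_sigma_max[OF T]) simp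
  finally show ?thesis
    using sigma_max_bound[OF c v] by (meson mult_right_mono order.trans vnorm_nonneg)
qed

lemma hinf_norm_le:
  assumes T: "T \<in> carrier_mat k l" and c: "c \<ge> 0"
    and le: "\<And>w v. cmod w = 1 \<Longrightarrow> v \<in> carrier_vec l \<Longrightarrow> vnorm (mev w T *\<^sub>v v) \<le> c * vnorm v"
  shows "hinf_norm T \<le> c"
  unfolding hinf_norm_def
proof (rule cSUP_least)
  show "{z. cmod z = 1} \<noteq> {}" by (auto intro: exI[of _ 1])
  fix z assume "z \<in> {z. cmod z = 1}"
  then have z: "cmod z = 1" by simp
  show "sigma_max (map_mat (\<lambda>r. tf_eval r z) T) \<le> c"
    unfolding eval_eq_mev[OF z] using z T c by (intro sigma_max_le[of _ k l] le) (auto simp: norm_divide)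
qed

lemma hinf_norm_nonneg:
  assumes T: "T \<in> RHinf k l"
  shows "hinf_norm T \<ge> 0"
proof -
  have "0 \<le> sigma_max (map_mat (\<lambda>r. tf_eval r 1) T)"
    by (rule sigma_max_nonneg[of _ k l]) (use RHinf_carrier[OF T] in simp)
  also have "\<dots> \<le> hinf_norm T"
    unfolding hinf_norm_def by (intro cSUP_upper bdd_above_sigma_max[OF T]) simp
  finally show ?thesis .
qed

text \<open>If \<open>(I + T(w)) v = 0\<close>, then \<open>x \<mapsto> \<langle>T(x) v, v\<rangle>\<close> has modulus \<open>|v|\<^sup>2\<close> at \<open>x = w\<close>. This function is
  holomorphic on the closed disc and bounded by \<open>\<parallel>T\<parallel>\<^sub>\<infinity> |v|\<^sup>2\<close> on the circle, so the maximum modulus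
  principle forces \<open>v = 0\<close>.\<close>

lemma small_gain:
  assumes T: "T \<in> RHinf p p" and e: "hinf_norm T < 1" and w: "cmod w \<le> 1"
  shows "det (1\<^sub>m p + mev w T) \<noteq> 0"
proof (rule det_nonzeroI[of _ p])
  have c: "T \<in> carrier_mat p p" by (rule RHinf_carrier[OF T])
  then show "1\<^sub>m p + mev w T \<in> carrier_mat p p" by simp
  fix v assume v: "v \<in> carrier_vec p" and z: "(1\<^sub>m p + mev w T) *\<^sub>v v = 0\<^sub>v p"
  define f where "f x = cip (mev x T *\<^sub>v v) v" for x
  have "f x = (\<Sum>i<p. (\<Sum>j<p. ev x (T $$ (i, j)) * v $ j) * cnj (v $ i))" for x
    using c v index_mat_mult_vec[of "mev x T" p p v] unfolding f_def cip_def
    by (intro sum.cong) (auto simp del: index_mult_mat_vec)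
  moreover have "(\<lambda>x. \<Sum>i<p. (\<Sum>j<p. ev x (T $$ (i, j)) * v $ j) * cnj (v $ i)) holomorphic_on cball 0 1"
    using T by (intro holomorphic_intros holomorphic_on_ev) (auto simp: RHinf_iff mreg_def)
  ultimately have h: "f holomorphic_on cball 0 1" by (simp cong: holomorphic_cong)
  have "cmod (f w) \<le> hinf_norm T * vnorm v * vnorm v"
  proof (rule maximum_modulus_frontier[of f "cball 0 1"])
    show "f holomorphic_on interior (cball 0 1)"
      using h by (rule holomorphic_on_subset) auto
    show "continuous_on (closure (cball 0 1)) f"
      using holomorphic_on_imp_continuous_on[OF h] by simp
    fix x :: complex assume "x \<in> frontier (cball 0 1)"
    then have x: "cmod x = 1" by simp
    have "cmod (f x) \<le> vnorm (mev x T *\<^sub>v v) * vnorm v"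
      unfolding f_def using c v by (intro cip_bound[of _ p]) auto
    also have "\<dots> \<le> hinf_norm T * vnorm v * vnorm v"
      using hinf_norm_bound[OF T x v] by (intro mult_right_mono) auto
    finally show "cmod (f x) \<le> hinf_norm T * vnorm v * vnorm v" .
  qed (use w in auto)
  moreover have "mev w T *\<^sub>v v = - v"
  proof -
    have c': "mev w T *\<^sub>v v \<in> carrier_vec p" using c v by auto
    have "v + mev w T *\<^sub>v v = 0\<^sub>v p" using z c v by (simp add: mat_vec_simps)
    then have "(v + mev w T *\<^sub>v v) $ i = 0" if "i < p" for i using that by simp
    moreover have "(v + mev w T *\<^sub>v v) $ i = v $ i + (mev w T *\<^sub>v v) $ i" if "i < p" for i
      by (rule index_add_vec(1)) (use c c' that in simp)
    ultimately have "(mev w T *\<^sub>v v) $ i = - v $ i" if "i < p" for i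
      using that by (simp add: eq_neg_iff_add_eq_0 add.commute del: index_mult_mat_vec)
    then show ?thesis using c c' v by (intro eq_vecI) (auto simp del: index_mult_mat_vec)
  qed
  then have "f w = - of_real ((vnorm v)\<^sup>2)"
    unfolding f_def cip_self[symmetric] by (simp add: cip_def sum_negf)
  then have "cmod (f w) = (vnorm v)\<^sup>2"
    by (simp only: norm_minus_cancel norm_of_real abs_power2)
  ultimately have "(1 - hinf_norm T) * (vnorm v)\<^sup>2 \<le> 0"
    by (simp add: power2_eq_square algebra_simps)
  then have "vnorm v = 0"
    using e by (auto simp: mult_le_0_iff)
  then show "v = 0\<^sub>v p" using vnorm_eq_0_iff[OF v] by simp
qed

section \<open>Resolvents and state-space equations\<close>

lemma const_tf_dims [simp]: "dim_row (const_tf A) = dim_row A" "dim_col (const_tf A) = dim_col A"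
  by (simp_all add: const_tf_def)

lemma const_tf_carrier [simp]: "const_tf A \<in> carrier_mat k l \<longleftrightarrow> A \<in> carrier_mat k l"
  by (simp add: const_tf_def)

lemma to_fract_const_sum: "to_fract [:sum f A:] = (\<Sum>i\<in>A. to_fract [:f i:])"
proof -
  have "[:sum f A:] = (\<Sum>i\<in>A. [:f i:])"
  proof (induction A rule: infinite_finite_induct)
    case (insert x F)
    have "[:f x + sum f F:] = [:f x:] + [:sum f F:]" by simp
    then show ?case using insert by (simp only: sum.insert[OF insert(1,2)])
  qed auto
  then show ?thesis by simp
qed

lemma to_fract_const_mult: "to_fract [:a * b:] = to_fract [:a:] * to_fract [:b:]"
  by (simp flip: to_fract_mult)

lemma const_tf_mult: "dim_col A = dim_row B \<Longrightarrow> const_tf (A * B) = const_tf A * const_tf B"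
  by (rule eq_matI) (auto simp: const_tf_def scalar_prod_def to_fract_const_sum to_fract_const_mult simp del: to_fract_mult)

lemma const_tf_add: "dim_row A = dim_row B \<Longrightarrow> dim_col A = dim_col B \<Longrightarrow> const_tf (A + B) = const_tf A + const_tf B"
  by (rule eq_matI) (auto simp: const_tf_def simp flip: to_fract_add)

lemma const_tf_uminus: "const_tf (- A) = - const_tf A"
  by (rule eq_matI) (auto simp: const_tf_def simp flip: to_fract_uminus)

lemma const_tf_zero: "const_tf (0\<^sub>m k l) = 0\<^sub>m k l"
  by (rule eq_matI) (auto simp: const_tf_def)

lemma const_tf_four_block:
  "A \<in> carrier_mat k1 l1 \<Longrightarrow> B \<in> carrier_mat k1 l2 \<Longrightarrow> C \<in> carrier_mat k2 l1 \<Longrightarrow> D \<in> carrier_mat k2 l2 \<Longrightarrow>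
   const_tf (four_block_mat A B C D) = four_block_mat (const_tf A) (const_tf B) (const_tf C) (const_tf D)"
  unfolding const_tf_def by (rule map_four_block_mat)

lemma RHinf_const: "A \<in> carrier_mat k l \<Longrightarrow> const_tf A \<in> RHinf k l"
  by (simp add: RHinf_iff mreg_const)

lemma RHinf_mult: "T \<in> RHinf k n \<Longrightarrow> S \<in> RHinf n l \<Longrightarrow> T * S \<in> RHinf k l"
  by (auto simp: RHinf_iff intro: mreg_mult)

lemma RHinf_add: "T \<in> RHinf k l \<Longrightarrow> S \<in> RHinf k l \<Longrightarrow> T + S \<in> RHinf k l"
  by (auto simp: RHinf_iff intro: mreg_add)

lemma RHinf_diff: "T \<in> RHinf k l \<Longrightarrow> S \<in> RHinf k l \<Longrightarrow> T - S \<in> RHinf k l"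
  by (auto simp: RHinf_iff intro: mreg_diff)

lemma RHinf_one: "1\<^sub>m n \<in> RHinf n n"
  by (simp add: RHinf_iff mreg_one)

lemma RHinf_minv:
  assumes "T \<in> RHinf n n" "\<And>w. cmod w \<le> 1 \<Longrightarrow> det (mev w T) \<noteq> 0"
  shows "minv T \<in> RHinf n n" "T * minv T = 1\<^sub>m n" "minv T * T = 1\<^sub>m n" "invertible_mat T"
  using assms mreg_minv[of 0 n T] by (auto simp: RHinf_iff intro: mreg_minv)

definition pencil :: "real mat \<Rightarrow> tf mat" where
  "pencil A = tf_z \<cdot>\<^sub>m 1\<^sub>m (dim_row A) - const_tf A"

definition resolvent :: "real mat \<Rightarrow> tf mat" where
  "resolvent A = minv (pencil A)"

lemma transfer_matrix_resolvent:
  "transfer_matrix A B C D = const_tf C * resolvent A * const_tf B + const_tf D"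
  by (simp add: transfer_matrix_def resolvent_def pencil_def)

lemma pencil_carrier: "A \<in> carrier_mat n n \<Longrightarrow> pencil A \<in> carrier_mat n n"
  by (auto simp: pencil_def)

text \<open>Write \<open>z I - A = z J\<close> with \<open>J = I - z\<^sup>-\<^sup>1 A\<close>. The value of \<open>J\<close> at infinity is \<open>I\<close>, so the pencil is
  invertible for every \<open>A\<close>, and its inverse vanishes at infinity because of the factor \<open>z\<^sup>-\<^sup>1\<close>.\<close>

lemma resolvent:
  assumes A: "A \<in> carrier_mat n n"
  shows "resolvent A \<in> carrier_mat n n" "pencil A * resolvent A = 1\<^sub>m n" "resolvent A * pencil A = 1\<^sub>m n"
    "mreg 0 n n (resolvent A)" "mev 0 (resolvent A) = 0\<^sub>m n n"
proof -
  define J where "J = 1\<^sub>m n - tf_delay \<cdot>\<^sub>m const_tf A"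
  have r: "mreg w n n (tf_delay \<cdot>\<^sub>m const_tf A)" "mev w (tf_delay \<cdot>\<^sub>m const_tf A) = w \<cdot>\<^sub>m cmat A" for w
    using mreg_smult[OF reg_ev_delay(1) mreg_const(1)[OF A], of w] mreg_const(2)[OF A, of w] reg_ev_delay(2)[of w]
    by simp_all
  have J: "mreg 0 n n J" and "mev 0 J = 1\<^sub>m n - 0 \<cdot>\<^sub>m cmat A"
    unfolding J_def using mreg_diff[OF mreg_one(1) r(1), of 0] mreg_one(2)[of 0 n] r(2)[of 0] by simp_all
  then have "mev 0 J = 1\<^sub>m n" using A by (auto intro!: eq_matI)
  then have "det (mev 0 J) \<noteq> 0" by simp
  note m = mreg_minv[OF J this]
  have Jc: "J \<in> carrier_mat n n" "minv J \<in> carrier_mat n n" using J m(1) by (auto simp: mreg_def)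
  have dz: "tf_z * (tf_delay * a) = a" for a
    using tf_z_delay by (simp add: mult.assoc[symmetric])
  have eq: "pencil A = tf_z \<cdot>\<^sub>m J"
    using A by (auto simp: pencil_def J_def right_diff_distrib dz intro!: eq_matI)
  have c: "tf_delay \<cdot>\<^sub>m minv J \<in> carrier_mat n n" using Jc by simp
  have "pencil A * (tf_delay \<cdot>\<^sub>m minv J) = tf_z \<cdot>\<^sub>m (tf_delay \<cdot>\<^sub>m (J * minv J))"
    unfolding eq using Jc by (simp add: mat_smult_mult) (auto intro!: eq_matI simp: mult_ac)
  also have "\<dots> = 1\<^sub>m n" unfolding m(2) by (auto simp: dz intro!: eq_matI)
  finally have e: "pencil A * (tf_delay \<cdot>\<^sub>m minv J) = 1\<^sub>m n" .
  note i = minv_eqI[OF pencil_carrier[OF A] c e]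
  then have rs: "resolvent A = tf_delay \<cdot>\<^sub>m minv J" by (simp add: resolvent_def)
  show "resolvent A \<in> carrier_mat n n" "pencil A * resolvent A = 1\<^sub>m n" "resolvent A * pencil A = 1\<^sub>m n"
    unfolding rs using c e i by simp_all
  show "mreg 0 n n (resolvent A)" "mev 0 (resolvent A) = 0\<^sub>m n n"
    unfolding rs using mreg_smult[OF reg_ev_delay(1) m(1)] Jc by (auto simp: reg_ev_delay intro!: eq_matI)
qed

lemma mreg_pencil:
  assumes A: "A \<in> carrier_mat n n" and w: "w \<noteq> 0"
  shows "mreg w n n (pencil A)" "mev w (pencil A) = (1 / w) \<cdot>\<^sub>m 1\<^sub>m n - cmat A"
proof -
  have n: "dim_row A = n" using A by simp
  note z = mreg_smult[OF reg_ev_z(1)[OF w] mreg_one(1)[of w n]]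
  show "mreg w n n (pencil A)" "mev w (pencil A) = (1 / w) \<cdot>\<^sub>m 1\<^sub>m n - cmat A"
    unfolding pencil_def n
    using mreg_diff[OF z(1) mreg_const(1)[OF A]] z(2) mreg_const(2)[OF A] mreg_one(2)[of w n] reg_ev_z(2)[OF w]
    by simp_all
qed

lemma pencil_eval_mult:
  fixes B :: "complex mat"
  assumes "B \<in> carrier_mat n n" "v \<in> carrier_vec n"
  shows "(c \<cdot>\<^sub>m 1\<^sub>m n - B) *\<^sub>v v = c \<cdot>\<^sub>v v - B *\<^sub>v v"
  using assms by (simp add: mat_vec_simps)

lemma vec_eq_iff_diff_zero:
  fixes u v :: "'a::ab_group_add vec"
  assumes "u \<in> carrier_vec n" "v \<in> carrier_vec n"
  shows "u - v = 0\<^sub>v n \<longleftrightarrow> u = v"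
proof
  assume z: "u - v = 0\<^sub>v n"
  have "u $ i = v $ i" if "i < n" for i
  proof -
    have "(u - v) $ i = u $ i - v $ i" using assms that by simp
    then show ?thesis using z that by simp
  qed
  then show "u = v" using assms by (intro eq_vecI) auto
next
  assume "u = v"
  then show "u - v = 0\<^sub>v n" using assms by simp
qed

lemma schur_stable_kernel:
  assumes A: "A \<in> carrier_mat n n" and s: "schur_stable A" and l: "cmod l \<ge> 1"
    and v: "v \<in> carrier_vec n" and e: "cmat A *\<^sub>v v = l \<cdot>\<^sub>v v"
  shows "v = 0\<^sub>v n"
proof (rule ccontr)
  assume "v \<noteq> 0\<^sub>v n"
  then have "eigenvalue (cmat A) l"
    unfolding eigenvalue_def eigenvector_def using A v e by auto
  then show False using s l by (auto simp: schur_stable_def)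
qed

lemma schur_stableI:
  assumes A: "A \<in> carrier_mat n n"
    and k: "\<And>l v. cmod l \<ge> 1 \<Longrightarrow> v \<in> carrier_vec n \<Longrightarrow> cmat A *\<^sub>v v = l \<cdot>\<^sub>v v \<Longrightarrow> v = 0\<^sub>v n"
  shows "schur_stable A"
  unfolding schur_stable_def eigenvalue_def eigenvector_def
proof (intro allI impI)
  fix l assume "\<exists>v. v \<in> carrier_vec (dim_row (cmat A)) \<and> v \<noteq> 0\<^sub>v (dim_row (cmat A)) \<and> cmat A *\<^sub>v v = l \<cdot>\<^sub>v v"
  then obtain v where "v \<in> carrier_vec n" "v \<noteq> 0\<^sub>v n" "cmat A *\<^sub>v v = l \<cdot>\<^sub>v v" using A by auto
  then show "cmod l < 1" using k[of l v] by (cases "cmod l < 1") auto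
qed

text \<open>At \<open>w \<noteq> 0\<close> the pencil takes the value \<open>\<lambda> I - A\<close> with \<open>\<lambda> = 1 / w\<close>, singular only at an eigenvalue.\<close>

lemma RHinf_resolvent:
  assumes A: "A \<in> carrier_mat n n" and s: "schur_stable A"
  shows "resolvent A \<in> RHinf n n"
  unfolding RHinf_iff
proof (intro allI impI)
  fix w assume w: "cmod w \<le> 1"
  show "mreg w n n (resolvent A)"
  proof (cases "w = 0")
    case True
    then show ?thesis using resolvent(4)[OF A] by simp
  next
    case False
    have cA: "cmat A \<in> carrier_mat n n" using A by simp
    have "det (mev w (pencil A)) \<noteq> 0"
      unfolding mreg_pencil(2)[OF A False]
    proof (rule det_nonzeroI[of _ n])
      fix v assume v: "v \<in> carrier_vec n" "((1 / w) \<cdot>\<^sub>m 1\<^sub>m n - cmat A) *\<^sub>v v = 0\<^sub>v n"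
      have "(1 / w) \<cdot>\<^sub>v v = cmat A *\<^sub>v v"
        using v(2) vec_eq_iff_diff_zero[of "(1 / w) \<cdot>\<^sub>v v" n "cmat A *\<^sub>v v"] v(1) cA
        unfolding pencil_eval_mult[OF cA v(1)] by simp
      then show "v = 0\<^sub>v n"
        using schur_stable_kernel[OF A s _ v(1), of "1 / w"] w False by (simp add: norm_divide)
    qed (use A in auto)
    then show ?thesis unfolding resolvent_def by (intro mreg_minv(1) mreg_pencil(1)[OF A False])
  qed
qed

lemma pencil_mult:
  assumes A: "A \<in> carrier_mat n n" and S: "S \<in> carrier_mat n k"
  shows "pencil A * S = tf_z \<cdot>\<^sub>m S - const_tf A * S"
  using assms by (simp add: pencil_def mat_distribs mat_smult_mult)

lemma mat_eq_diff_iff: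
  fixes X Y Z :: "'a::ab_group_add mat"
  assumes "X \<in> carrier_mat k l" "Y \<in> carrier_mat k l" "Z \<in> carrier_mat k l"
  shows "X = Y + Z \<longleftrightarrow> X - Y = Z"
  using assms by (auto simp: mat_eq_iff algebra_simps)

lemma state_equation_solution:
  assumes A: "A \<in> carrier_mat n n" and S: "S \<in> carrier_mat n k" and W: "W \<in> carrier_mat n k"
    and eq: "tf_z \<cdot>\<^sub>m S = const_tf A * S + W"
  shows "S = resolvent A * W"
proof -
  note r = resolvent[OF A]
  have "pencil A * S = W"
    unfolding pencil_mult[OF A S] using mat_eq_diff_iff[of "tf_z \<cdot>\<^sub>m S" n k "const_tf A * S" W] eq A S W by simp
  then have "resolvent A * W = (resolvent A * pencil A) * S"
    using r(1) pencil_carrier[OF A] S by (simp add: mat_assoc)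
  then show ?thesis using r(3) S by simp
qed

lemma resolvent_state_equation:
  assumes A: "A \<in> carrier_mat n n" and W: "W \<in> carrier_mat n k"
  shows "tf_z \<cdot>\<^sub>m (resolvent A * W) = const_tf A * (resolvent A * W) + W"
proof -
  note r = resolvent[OF A]
  have c: "resolvent A * W \<in> carrier_mat n k" using r(1) W by simp
  have "pencil A * (resolvent A * W) = (pencil A * resolvent A) * W"
    by (rule mat_assoc[symmetric]) (use r(1) pencil_carrier[OF A] W in auto)
  also have "\<dots> = W" unfolding r(2) using W by simp
  finally have "tf_z \<cdot>\<^sub>m (resolvent A * W) - const_tf A * (resolvent A * W) = W"
    unfolding pencil_mult[OF A c] .
  then show ?thesis
    using mat_eq_diff_iff[of "tf_z \<cdot>\<^sub>m (resolvent A * W)" n k "const_tf A * (resolvent A * W)" W] c A W by simp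
qed

text \<open>A transfer matrix is recognized by exhibiting a state \<open>S\<close> that the input \<open>W\<close> drives. This avoids
  inverting pencils of block matrices in all interconnections below.\<close>

lemma transfer_matrix_mult:
  assumes A: "A \<in> carrier_mat n n" and B: "B \<in> carrier_mat n l" and C: "C \<in> carrier_mat k n" and D: "D \<in> carrier_mat k l"
    and S: "S \<in> carrier_mat n j" and W: "W \<in> carrier_mat l j"
    and eq: "tf_z \<cdot>\<^sub>m S = const_tf A * S + const_tf B * W"
  shows "transfer_matrix A B C D * W = const_tf C * S + const_tf D * W"
proof -
  have "S = resolvent A * (const_tf B * W)"
    using state_equation_solution[OF A S _ eq] B W by simp
  then show ?thesis
    unfolding transfer_matrix_resolvent using resolvent(1)[OF A] assms by (simp add: mat_assoc mat_distribs)
qed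

lemma transfer_matrix_carrier:
  "A \<in> carrier_mat n n \<Longrightarrow> B \<in> carrier_mat n l \<Longrightarrow> C \<in> carrier_mat k n \<Longrightarrow> D \<in> carrier_mat k l \<Longrightarrow>
   transfer_matrix A B C D \<in> carrier_mat k l"
  unfolding transfer_matrix_resolvent using resolvent(1) by (auto intro!: mult_carrier_mat)

section \<open>The plant\<close>

lemma mat_diff_zeroD:
  fixes X Y :: "'a::ab_group_add mat"
  assumes "X - Y = 0\<^sub>m k l" "dim_row X = dim_row Y" "dim_col X = dim_col Y"
  shows "X = Y"
proof (rule eq_matI)
  fix i j assume ij: "i < dim_row Y" "j < dim_col Y"
  have "dim_row Y = k" "dim_col Y = l"
    using arg_cong[OF assms(1), of dim_row] arg_cong[OF assms(1), of dim_col] by simp_all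
  then have "(X - Y) $$ (i, j) = 0" using assms(1) ij by simp
  then show "X $$ (i, j) = Y $$ (i, j)" using ij by simp
qed (use assms in auto)

lemma four_block_mat_eqD:
  assumes "four_block_mat A B C D = four_block_mat A' B' C' D'"
    and "A \<in> carrier_mat k1 l1" "B \<in> carrier_mat k1 l2" "C \<in> carrier_mat k2 l1" "D \<in> carrier_mat k2 l2"
    and "A' \<in> carrier_mat k1 l1" "B' \<in> carrier_mat k1 l2" "C' \<in> carrier_mat k2 l1" "D' \<in> carrier_mat k2 l2"
  shows "A = A'" "B = B'" "C = C'" "D = D'"
proof -
  have e: "four_block_mat A B C D $$ (i, j) = four_block_mat A' B' C' D' $$ (i, j)" for i j
    using assms(1) by simp
  show "A = A'" "B = B'" "C = C'" "D = D'"
  proof (rule_tac [!] eq_matI)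
    fix i j
    show "i < dim_row A' \<Longrightarrow> j < dim_col A' \<Longrightarrow> A $$ (i, j) = A' $$ (i, j)"
      using e[of i j] assms(2-) by simp
    show "i < dim_row B' \<Longrightarrow> j < dim_col B' \<Longrightarrow> B $$ (i, j) = B' $$ (i, j)"
      using e[of i "j + l1"] assms(2-) by simp
    show "i < dim_row C' \<Longrightarrow> j < dim_col C' \<Longrightarrow> C $$ (i, j) = C' $$ (i, j)"
      using e[of "i + k1" j] assms(2-) by simp
    show "i < dim_row D' \<Longrightarrow> j < dim_col D' \<Longrightarrow> D $$ (i, j) = D' $$ (i, j)"
      using e[of "i + k1" "j + l1"] assms(2-) by simp
  qed (use assms(2-) in auto)
qed

lemma pencil_add:
  assumes "A \<in> carrier_mat n n" "D \<in> carrier_mat n n"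
  shows "pencil (A + D) = pencil A - const_tf D"
proof -
  have "dim_row (A + D) = n" "dim_row A = n" using assms by auto
  then show ?thesis
    unfolding pencil_def using assms by (auto simp: const_tf_add intro!: eq_matI)
qed

text \<open>The plant with its doubly-coprime factorization, a stabilizing state feedback gain \<open>F\<close> and a
  detecting output injection gain \<open>H\<close>.\<close>

locale coprime_plant =
  fixes n m p :: nat
    and Ap Bp Cp F H :: "real mat"
    and G Ul Vl Nl Ml Ur Vr Nr Mr :: "tf mat"
  assumes Ap: "Ap \<in> carrier_mat n n" and Bp: "Bp \<in> carrier_mat n m" and Cp: "Cp \<in> carrier_mat p n"
    and F: "F \<in> carrier_mat m n" "schur_stable (Ap + Bp * F)"
    and H: "H \<in> carrier_mat n p" "schur_stable (Ap + H * Cp)"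
    and G: "G = transfer_matrix Ap Bp Cp (0\<^sub>m p m)"
    and dcf: "doubly_coprime_factorization m p G Ul Vl Nl Ml Ur Vr Nr Mr"
begin

lemma factors_RHinf:
  "Ul \<in> RHinf m m" "Vl \<in> RHinf m p" "Nl \<in> RHinf p m" "Ml \<in> RHinf p p"
  "Ur \<in> RHinf p p" "Vr \<in> RHinf m p" "Nr \<in> RHinf p m" "Mr \<in> RHinf m m"
  using dcf by (simp_all add: doubly_coprime_factorization_def)

lemmas factors_carrier = factors_RHinf[THEN RHinf_carrier]

lemma stable_dims: "Ap + Bp * F \<in> carrier_mat n n" "Ap + H * Cp \<in> carrier_mat n n"
  using Ap Bp Cp F H by auto

lemmas plant_dims [simp] = factors_carrier[THEN carrier_matD(1)] factors_carrier[THEN carrier_matD(2)]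
  carrier_matD[OF Ap] carrier_matD[OF Bp] carrier_matD[OF Cp] carrier_matD[OF F(1)] carrier_matD[OF H(1)]
  carrier_matD[OF resolvent(1)[OF Ap]] carrier_matD[OF resolvent(1)[OF stable_dims(1)]]
  carrier_matD[OF resolvent(1)[OF stable_dims(2)]] carrier_matD[OF pencil_carrier[OF Ap]]

lemma G_eq: "G = const_tf Cp * resolvent Ap * const_tf Bp"
proof -
  have "const_tf Cp * resolvent Ap * const_tf Bp \<in> carrier_mat p m"
    by (intro carrier_matI) simp_all
  then show ?thesis
    unfolding G transfer_matrix_resolvent const_tf_zero by simp
qed

lemma G_carrier: "G \<in> carrier_mat p m"
  unfolding G using Ap Bp Cp by (intro transfer_matrix_carrier) auto

lemma G_factors: "Ml * G = Nl" "G * Mr = Nr" "invertible_mat Ml" "G = minv Ml * Nl"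
proof -
  have d: "invertible_mat Mr" "invertible_mat Ml" "G = Nr * minv Mr" "G = minv Ml * Nl"
    using dcf unfolding doubly_coprime_factorization_def by blast+
  note l = invertible_matD[OF factors_carrier(4) d(2)] and r = invertible_matD[OF factors_carrier(8) d(1)]
  have "Ml * G = (Ml * minv Ml) * Nl"
    unfolding d(4) by (rule mat_assoc[symmetric]) (use l(1) in auto)
  then show "Ml * G = Nl" using l by simp
  have "G * Mr = Nr * (minv Mr * Mr)"
    unfolding d(3) by (rule mat_assoc) (use r(1) in auto)
  then show "G * Mr = Nr" using r by simp
  show "invertible_mat Ml" "G = minv Ml * Nl" by (rule d)+
qed

lemma bezout:
  "Ml * Ur - Nl * Vr = 1\<^sub>m p"
  "Mr * Ul - Vr * Nl = 1\<^sub>m m" "Mr * Vl = Vr * Ml"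
  "Nr * Ul = Ur * Nl" "Ur * Ml - Nr * Vl = 1\<^sub>m p"
proof -
  note c = factors_carrier
  have c': "- Vl \<in> carrier_mat m p" "- Nl \<in> carrier_mat p m" using c by simp_all
  let ?L = "four_block_mat Ul (- Vl) (- Nl) Ml" and ?R = "four_block_mat Mr Vr Nr Ur"
  have LR: "?L * ?R = 1\<^sub>m (m + p)" using dcf by (simp add: doubly_coprime_factorization_def)
  have RL: "?R * ?L = 1\<^sub>m (m + p)"
    by (rule mat_mult_left_right_inverse[OF _ _ LR]) (use c in auto)
  have one: "1\<^sub>m (m + p) = four_block_mat (1\<^sub>m m) (0\<^sub>m m p) (0\<^sub>m p m) (1\<^sub>m p)" by simp
  have "four_block_mat (Ul * Mr + - Vl * Nr) (Ul * Vr + - Vl * Ur) (- Nl * Mr + Ml * Nr) (- Nl * Vr + Ml * Ur)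
      = four_block_mat (1\<^sub>m m) (0\<^sub>m m p) (0\<^sub>m p m) (1\<^sub>m p)"
    unfolding one[symmetric] LR[symmetric]
    by (rule mult_four_block_mat[OF c(1) c'(1) c'(2) c(4) c(8) c(6) c(7) c(5), symmetric])
  moreover have "Ul * Mr + - Vl * Nr \<in> carrier_mat m m" "Ul * Vr + - Vl * Ur \<in> carrier_mat m p"
    "- Nl * Mr + Ml * Nr \<in> carrier_mat p m" "- Nl * Vr + Ml * Ur \<in> carrier_mat p p"
    by (rule_tac [!] carrier_matI) simp_all
  ultimately have "- Nl * Vr + Ml * Ur = 1\<^sub>m p"
    by (rule four_block_mat_eqD(4)) simp_all
  then show "Ml * Ur - Nl * Vr = 1\<^sub>m p" by (simp add: mat_ring_simps)
  have eq: "four_block_mat (Mr * Ul + Vr * - Nl) (Mr * - Vl + Vr * Ml) (Nr * Ul + Ur * - Nl) (Nr * - Vl + Ur * Ml)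
      = four_block_mat (1\<^sub>m m) (0\<^sub>m m p) (0\<^sub>m p m) (1\<^sub>m p)"
    unfolding one[symmetric] RL[symmetric]
    by (rule mult_four_block_mat[OF c(8) c(6) c(7) c(5) c(1) c'(1) c'(2) c(4), symmetric])
  have cs: "Mr * Ul + Vr * - Nl \<in> carrier_mat m m" "Mr * - Vl + Vr * Ml \<in> carrier_mat m p"
    "Nr * Ul + Ur * - Nl \<in> carrier_mat p m" "Nr * - Vl + Ur * Ml \<in> carrier_mat p p"
    by (rule_tac [!] carrier_matI) simp_all
  note e = four_block_mat_eqD[OF eq cs one_carrier_mat zero_carrier_mat zero_carrier_mat one_carrier_mat]
  show "Mr * Ul - Vr * Nl = 1\<^sub>m m" "Ur * Ml - Nr * Vl = 1\<^sub>m p"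
    using e(1,4) by (simp_all add: mat_ring_simps)
  have "Vr * Ml - Mr * Vl = 0\<^sub>m m p" using e(2) by (simp add: mat_ring_simps)
  then show "Mr * Vl = Vr * Ml"
    using mat_diff_zeroD[of "Vr * Ml" "Mr * Vl" m p] by simp
  have "Nr * Ul - Ur * Nl = 0\<^sub>m p m" using e(3) by (simp add: mat_ring_simps)
  then show "Nr * Ul = Ur * Nl"
    using mat_diff_zeroD[of "Nr * Ul" "Ur * Nl" p m] by simp
qed

text \<open>Although the resolvent of the plant may be unstable, multiplication by the denominators \<open>M\<^sub>l\<close> and
  \<open>M\<^sub>r\<close> stabilizes the map from the state to the output and that from the input to the state.\<close>

definition "obs_factor = Ml * (const_tf Cp * resolvent Ap)"

definition "ctr_factor = resolvent Ap * (const_tf Bp * Mr)"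

text \<open>Since \<open>M\<^sub>l C (z I - A)\<^sup>-\<^sup>1 B = M\<^sub>l G = N\<^sub>l\<close>, replacing \<open>A\<close> by the stable \<open>A + B F\<close> in the resolvent costs
  only the stable term \<open>N\<^sub>l F\<close>.\<close>

lemma obs_factor:
  "obs_factor \<in> RHinf p n" "obs_factor * const_tf Bp = Nl" "obs_factor * pencil Ap = Ml * const_tf Cp"
  "mev 0 obs_factor = 0\<^sub>m p n"
proof -
  note r = resolvent[OF Ap] and rF = resolvent[OF stable_dims(1)]
  show B: "obs_factor * const_tf Bp = Nl"
    unfolding obs_factor_def using G_factors(1) unfolding G_eq by (simp add: mat_assoc)
  show P: "obs_factor * pencil Ap = Ml * const_tf Cp"
    unfolding obs_factor_def using r(3) by (simp add: mat_assoc)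
  have oc: "obs_factor \<in> carrier_mat p n"
    unfolding obs_factor_def by (intro carrier_matI) simp_all
  have pF: "pencil (Ap + Bp * F) = pencil Ap - const_tf Bp * const_tf F"
    using pencil_add[of Ap n "Bp * F"] Ap Bp F(1) by (simp add: const_tf_mult)
  have "obs_factor * pencil (Ap + Bp * F) = Ml * const_tf Cp - (obs_factor * const_tf Bp) * const_tf F"
    unfolding pF using oc P by (simp add: mat_distribs mat_assoc)
  then have "obs_factor * pencil (Ap + Bp * F) = Ml * const_tf Cp - Nl * const_tf F"
    unfolding B .
  then have "obs_factor * (pencil (Ap + Bp * F) * resolvent (Ap + Bp * F)) = (Ml * const_tf Cp - Nl * const_tf F) * resolvent (Ap + Bp * F)"
    using oc pencil_carrier[OF stable_dims(1)] by (simp add: mat_assoc[symmetric])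
  then have eq: "obs_factor = (Ml * const_tf Cp - Nl * const_tf F) * resolvent (Ap + Bp * F)"
    unfolding rF(2) using oc by simp
  have R: "Ml * const_tf Cp - Nl * const_tf F \<in> RHinf p n"
    by (rule RHinf_diff[OF RHinf_mult[OF factors_RHinf(4) RHinf_const[OF Cp]] RHinf_mult[OF factors_RHinf(3) RHinf_const[OF F(1)]]])
  then show "obs_factor \<in> RHinf p n"
    unfolding eq by (rule RHinf_mult[OF _ RHinf_resolvent[OF stable_dims(1) F(2)]])
  have "mreg 0 p n (Ml * const_tf Cp - Nl * const_tf F)" using R by (simp add: RHinf_iff)
  from mreg_mult(2)[OF this rF(4)] show "mev 0 obs_factor = 0\<^sub>m p n"
    unfolding eq[symmetric] rF(5) using R[THEN RHinf_carrier] by simp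
qed

text \<open>Dually, \<open>C (z I - A)\<^sup>-\<^sup>1 B M\<^sub>r = N\<^sub>r\<close> allows \<open>A\<close> to be replaced by the stable \<open>A + H C\<close>.\<close>

lemma ctr_factor:
  "ctr_factor \<in> RHinf n m" "const_tf Cp * ctr_factor = Nr" "pencil Ap * ctr_factor = const_tf Bp * Mr"
proof -
  note r = resolvent[OF Ap] and rH = resolvent[OF stable_dims(2)]
  show C: "const_tf Cp * ctr_factor = Nr"
    unfolding ctr_factor_def using G_factors(2) unfolding G_eq by (simp add: mat_assoc)
  show P: "pencil Ap * ctr_factor = const_tf Bp * Mr"
    unfolding ctr_factor_def using r(2) by (simp add: mat_assoc[symmetric])
  have oc: "ctr_factor \<in> carrier_mat n m"
    unfolding ctr_factor_def by (intro carrier_matI) simp_all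
  have pH: "pencil (Ap + H * Cp) = pencil Ap - const_tf H * const_tf Cp"
    using pencil_add[of Ap n "H * Cp"] Ap Cp H(1) by (simp add: const_tf_mult)
  have "pencil (Ap + H * Cp) * ctr_factor = const_tf Bp * Mr - const_tf H * (const_tf Cp * ctr_factor)"
    unfolding pH using oc P by (simp add: mat_distribs mat_assoc)
  then have "(resolvent (Ap + H * Cp) * pencil (Ap + H * Cp)) * ctr_factor = resolvent (Ap + H * Cp) * (const_tf Bp * Mr - const_tf H * Nr)"
    unfolding C using oc pencil_carrier[OF stable_dims(2)] by (simp add: mat_assoc)
  then have eq: "ctr_factor = resolvent (Ap + H * Cp) * (const_tf Bp * Mr - const_tf H * Nr)"
    unfolding rH(3) using oc by simp
  show "ctr_factor \<in> RHinf n m"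
    unfolding eq by (rule RHinf_mult[OF RHinf_resolvent[OF stable_dims(2) H(2)] RHinf_diff[OF RHinf_mult[OF RHinf_const[OF Bp] factors_RHinf(8)] RHinf_mult[OF RHinf_const[OF H(1)] factors_RHinf(7)]]])
qed

lemma Nl_strictly_proper: "mev 0 Nl = 0\<^sub>m p m"
proof -
  have "mreg 0 p n obs_factor" using obs_factor(1) by (simp add: RHinf_iff)
  from mreg_mult(2)[OF this mreg_const(1)[OF Bp]] show ?thesis
    unfolding obs_factor(2,4) mreg_const(2)[OF Bp] using Bp by simp
qed

text \<open>At infinity the Bezout identity loses its second term and leaves \<open>M\<^sub>l U\<^sub>r = I\<close>.\<close>

lemma Ml_at_infinity: "det (mev 0 Ml) \<noteq> 0"
proof (rule ccontr)
  have r: "mreg 0 p p Ml" "mreg 0 p p Ur" "mreg 0 p m Nl" "mreg 0 m p Vr" using factors_RHinf by (simp_all add: RHinf_iff)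
  have "mev 0 Ml * mev 0 Ur - mev 0 Nl * mev 0 Vr = 1\<^sub>m p"
    using mreg_diff(2)[OF mreg_mult(1)[OF r(1,2)] mreg_mult(1)[OF r(3,4)]] mreg_mult(2)[OF r(1,2)] mreg_mult(2)[OF r(3,4)]
    unfolding bezout(1) mreg_one(2) by simp
  moreover have "mev 0 Ml * mev 0 Ur - 0\<^sub>m p p = mev 0 Ml * mev 0 Ur"
    by (rule eq_matI) simp_all
  ultimately have "mev 0 Ml * mev 0 Ur = 1\<^sub>m p"
    unfolding Nl_strictly_proper by simp
  then have "det (mev 0 Ml) * det (mev 0 Ur) = 1"
    using det_mult[of "mev 0 Ml" p "mev 0 Ur"] factors_carrier by simp
  moreover assume "\<not> det (mev 0 Ml) \<noteq> 0"
  ultimately show False by simp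
qed

text \<open>The kernel of \<open>[M\<^sub>l, - N\<^sub>l]\<close> at a point is the range of \<open>[N\<^sub>r; M\<^sub>r]\<close>: the product of the two Bezout matrices
  in the opposite order recovers \<open>(y, u)\<close> from \<open>e = U\<^sub>l u - V\<^sub>l y\<close>.\<close>

lemma left_kernel:
  assumes w: "cmod w \<le> 1" and y: "y \<in> carrier_vec p" and u: "u \<in> carrier_vec m"
    and eq: "mev w Ml *\<^sub>v y = mev w Nl *\<^sub>v u"
  obtains e where "e \<in> carrier_vec m" "y = mev w Nr *\<^sub>v e" "u = mev w Mr *\<^sub>v e"
proof -
  have r: "mreg w m m Ul" "mreg w m p Vl" "mreg w p m Nl" "mreg w p p Ml"
    "mreg w p p Ur" "mreg w m p Vr" "mreg w p m Nr" "mreg w m m Mr"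
    using factors_RHinf w by (simp_all add: RHinf_iff)
  have b: "mev w Mr * mev w Ul - mev w Vr * mev w Nl = 1\<^sub>m m"
    "mev w Mr * mev w Vl = mev w Vr * mev w Ml"
    "mev w Nr * mev w Ul = mev w Ur * mev w Nl"
    "mev w Ur * mev w Ml - mev w Nr * mev w Vl = 1\<^sub>m p"
    using bezout(2-5) r mreg_mult(2)[OF r(8,1)] mreg_mult(2)[OF r(6,3)] mreg_mult(2)[OF r(8,2)] mreg_mult(2)[OF r(6,4)]
      mreg_mult(2)[OF r(7,1)] mreg_mult(2)[OF r(5,3)] mreg_mult(2)[OF r(5,4)] mreg_mult(2)[OF r(7,2)]
      mreg_diff(2)[OF mreg_mult(1)[OF r(8,1)] mreg_mult(1)[OF r(6,3)]]
      mreg_diff(2)[OF mreg_mult(1)[OF r(5,4)] mreg_mult(1)[OF r(7,2)]] mreg_one(2)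
    by simp_all
  define e where "e = mev w Ul *\<^sub>v u - mev w Vl *\<^sub>v y"
  note d = carrier_vecD[OF y] carrier_vecD[OF u]
  have ec: "e \<in> carrier_vec m" unfolding e_def using d by (intro carrier_vecI) simp
  have "mev w Mr *\<^sub>v e = (mev w Mr * mev w Ul) *\<^sub>v u - (mev w Vr * mev w Ml) *\<^sub>v y"
    unfolding e_def b(2)[symmetric] using d by (simp add: mat_vec_simps)
  also have "\<dots> = (mev w Mr * mev w Ul - mev w Vr * mev w Nl) *\<^sub>v u"
    using d eq by (simp add: mat_vec_simps)
  finally have 1: "mev w Mr *\<^sub>v e = u" unfolding b(1) using u by simp
  have "mev w Nr *\<^sub>v e = (mev w Ur * mev w Nl) *\<^sub>v u - (mev w Nr * mev w Vl) *\<^sub>v y"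
    unfolding e_def b(3)[symmetric] using d by (simp add: mat_vec_simps)
  also have "\<dots> = (mev w Ur * mev w Ml - mev w Nr * mev w Vl) *\<^sub>v y"
    using d eq by (simp add: mat_vec_simps)
  finally have 2: "mev w Nr *\<^sub>v e = y" unfolding b(4) using y by simp
  show ?thesis using that[OF ec] 1 2 by simp
qed

end

section \<open>Discrete-time linear systems\<close>

text \<open>Division by a number \<open>r < 1\<close> above the spectral radius keeps the powers bounded, so the original
  powers decay like \<open>r\<^sup>t\<close>.\<close>

lemma schur_stable_trajectory:
  fixes s :: "nat \<Rightarrow> real vec"
  assumes A: "A \<in> carrier_mat n n" and st: "schur_stable A"
    and s0: "s 0 \<in> carrier_vec n" and s: "\<And>t. s (Suc t) = A *\<^sub>v s t" and i: "i < n"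
  shows "(\<lambda>t. s t $ i) \<longlonglongrightarrow> 0"
proof -
  have cA: "cmat A \<in> carrier_mat n n" and n: "n > 0" using A i by auto
  have "cmod a < 1" if "a \<in> spectrum (cmat A)" for a
    using that st by (simp add: spectrum_def schur_stable_def)
  then have "spectral_radius (cmat A) < 1"
    using spectral_radius_mem_max(1)[OF cA n] by auto
  then obtain r where r: "spectral_radius (cmat A) < r" "r < 1" using dense by blast
  have "0 \<le> spectral_radius (cmat A)" using spectral_radius_mem_max(1)[OF cA n] by auto
  then have r0: "r > 0" using r by linarith
  define B where "B = complex_of_real (1 / r) \<cdot>\<^sub>m cmat A"
  have B: "B \<in> carrier_mat n n" using cA by (simp add: B_def)
  have Bv: "B *\<^sub>v v = complex_of_real (1 / r) \<cdot>\<^sub>v (cmat A *\<^sub>v v)" if "v \<in> carrier_vec n" for v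
    using cA that by (simp add: B_def mat_vec_smult)
  have "spectral_radius B < 1"
  proof -
    obtain a where a: "a \<in> spectrum B" "spectral_radius B = cmod a"
      using spectral_radius_mem_max(1)[OF B n] by auto
    then obtain v where v: "v \<in> carrier_vec n" "v \<noteq> 0\<^sub>v n" "B *\<^sub>v v = a \<cdot>\<^sub>v v"
      using B by (auto simp: spectrum_def eigenvalue_def eigenvector_def)
    have "complex_of_real r \<cdot>\<^sub>v (B *\<^sub>v v) = cmat A *\<^sub>v v"
      using Bv[OF v(1)] r0 by (simp add: smult_smult_assoc)
    then have "eigenvector (cmat A) v (complex_of_real r * a)"
      using v cA by (simp add: eigenvector_def smult_smult_assoc)
    then have "complex_of_real r * a \<in> spectrum (cmat A)"
      unfolding spectrum_def eigenvalue_def by blast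
    then have "cmod (complex_of_real r * a) \<le> spectral_radius (cmat A)"
      by (intro spectral_radius_mem_max(2)[OF cA n]) simp
    moreover have "cmod (complex_of_real r * a) = r * cmod a" using r0 by (simp add: norm_mult)
    ultimately have "r * cmod a < r * 1" using r by linarith
    then have "cmod a < 1" using r0 by (simp only: mult_less_cancel_left_pos)
    then show ?thesis using a by simp
  qed
  then obtain C where C: "\<And>j. norm_bound (B ^\<^sub>m j) C"
    using spectral_radius_jnf_norm_bound_less_1_upper_triangular[OF B] by blast
  have sc: "s t \<in> carrier_vec n" for t
    by (induction t) (use s0 s A in auto)
  let ?c = "\<lambda>t. map_vec complex_of_real (s t)"
  have rel: "?c t = complex_of_real (r ^ t) \<cdot>\<^sub>v ((B ^\<^sub>m t) *\<^sub>v ?c 0)" for t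
  proof (induction t)
    case 0
    then show ?case using B s0 by simp
  next
    case (Suc t)
    have c: "(B ^\<^sub>m t) *\<^sub>v ?c 0 \<in> carrier_vec n"
      by (rule mult_mat_vec_carrier[OF pow_carrier_mat[OF B]]) (use s0 in simp)
    have "?c (Suc t) = cmat A *\<^sub>v ?c t"
      unfolding s by (rule of_real_hom.mult_mat_vec_hom[OF A sc])
    also have "\<dots> = complex_of_real (r ^ t) \<cdot>\<^sub>v (cmat A *\<^sub>v ((B ^\<^sub>m t) *\<^sub>v ?c 0))"
      unfolding Suc using cA c B by (simp add: mat_vec_smult)
    also have "cmat A *\<^sub>v ((B ^\<^sub>m t) *\<^sub>v ?c 0) = complex_of_real r \<cdot>\<^sub>v (B *\<^sub>v ((B ^\<^sub>m t) *\<^sub>v ?c 0))"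
      unfolding Bv[OF c] using r0 by (simp add: smult_smult_assoc)
    also have "B *\<^sub>v ((B ^\<^sub>m t) *\<^sub>v ?c 0) = (B ^\<^sub>m Suc t) *\<^sub>v ?c 0"
      by (rule pow_mat_vec_Suc[OF B, symmetric]) (use s0 in simp)
    finally show ?case by (simp add: smult_smult_assoc mult.commute)
  qed
  define D where "D = (\<Sum>j<n. C * cmod (?c 0 $ j))"
  have bound: "\<bar>s t $ i\<bar> \<le> r ^ t * D" for t
  proof -
    have Bt: "B ^\<^sub>m t \<in> carrier_mat n n" using B by simp
    have c0: "?c 0 \<in> carrier_vec n" using s0 by simp
    have "cmod (((B ^\<^sub>m t) *\<^sub>v ?c 0) $ i) \<le> (\<Sum>j<n. cmod ((B ^\<^sub>m t) $$ (i, j) * ?c 0 $ j))"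
      unfolding index_mat_mult_vec[OF Bt c0 i] by (rule norm_sum)
    also have "\<dots> \<le> D"
      unfolding D_def norm_mult using C[of t] i B
      by (intro sum_mono mult_right_mono) (auto simp: norm_bound_def)
    finally have b: "cmod (((B ^\<^sub>m t) *\<^sub>v ?c 0) $ i) \<le> D" .
    have "?c t $ i = complex_of_real (r ^ t) * ((B ^\<^sub>m t) *\<^sub>v ?c 0) $ i"
      by (subst rel) (use i B in \<open>simp del: index_mult_mat_vec\<close>)
    moreover have "?c t $ i = complex_of_real (s t $ i)" using sc[of t] i by simp
    ultimately have "\<bar>s t $ i\<bar> = r ^ t * cmod (((B ^\<^sub>m t) *\<^sub>v ?c 0) $ i)"
      using r0 by (metis norm_of_real norm_mult abs_of_nonneg zero_le_power less_imp_le)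
    then show ?thesis using b r0 by (simp add: mult_left_mono)
  qed
  have "(\<lambda>t. r ^ t * D) \<longlonglongrightarrow> 0 * D"
    using r r0 by (intro tendsto_mult tendsto_const LIMSEQ_realpow_zero) auto
  then have lim: "(\<lambda>t. r ^ t * D) \<longlonglongrightarrow> 0" by simp
  have "\<forall>\<^sub>F t in sequentially. norm (s t $ i) \<le> r ^ t * D"
    using bound by (intro always_eventually allI) simp
  then show ?thesis by (rule Lim_null_comparison[OF _ lim])
qed

lemma schur_stable_four_blockI:
  assumes c: "A \<in> carrier_mat n n" "B \<in> carrier_mat n q" "C \<in> carrier_mat q n" "D \<in> carrier_mat q q"
    and k: "\<And>l x y. cmod l \<ge> 1 \<Longrightarrow> x \<in> carrier_vec n \<Longrightarrow> y \<in> carrier_vec q \<Longrightarrow>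
      cmat A *\<^sub>v x + cmat B *\<^sub>v y = l \<cdot>\<^sub>v x \<Longrightarrow> cmat C *\<^sub>v x + cmat D *\<^sub>v y = l \<cdot>\<^sub>v y \<Longrightarrow>
      x = 0\<^sub>v n \<and> y = 0\<^sub>v q"
  shows "schur_stable (four_block_mat A B C D)"
proof (rule schur_stableI)
  show "four_block_mat A B C D \<in> carrier_mat (n + q) (n + q)" using c by simp
  fix l v assume l: "cmod l \<ge> 1" and v: "v \<in> carrier_vec (n + q)"
    and ev: "cmat (four_block_mat A B C D) *\<^sub>v v = l \<cdot>\<^sub>v v"
  define x where "x = vec_first v n"
  define y where "y = vec_last v q"
  have xy: "x \<in> carrier_vec n" "y \<in> carrier_vec q" by (simp_all add: x_def y_def)
  have [simp]: "dim_vec x = n" "dim_vec y = q" using xy by simp_all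
  have vx: "v = x @\<^sub>v y" unfolding x_def y_def using v by simp
  have "cmat (four_block_mat A B C D) = four_block_mat (cmat A) (cmat B) (cmat C) (cmat D)"
    by (rule map_four_block_mat) (use c in auto)
  then have "cmat (four_block_mat A B C D) *\<^sub>v v = (cmat A *\<^sub>v x + cmat B *\<^sub>v y) @\<^sub>v (cmat C *\<^sub>v x + cmat D *\<^sub>v y)"
    unfolding vx using four_block_mat_mult_vec[of "cmat A" n n "cmat B" q "cmat C" q "cmat D" x y] c xy by simp
  moreover have "l \<cdot>\<^sub>v v = (l \<cdot>\<^sub>v x) @\<^sub>v (l \<cdot>\<^sub>v y)" unfolding vx by (rule eq_vecI) auto
  ultimately have "(cmat A *\<^sub>v x + cmat B *\<^sub>v y) @\<^sub>v (cmat C *\<^sub>v x + cmat D *\<^sub>v y) = (l \<cdot>\<^sub>v x) @\<^sub>v (l \<cdot>\<^sub>v y)"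
    using ev by simp
  then have "cmat A *\<^sub>v x + cmat B *\<^sub>v y = l \<cdot>\<^sub>v x" "cmat C *\<^sub>v x + cmat D *\<^sub>v y = l \<cdot>\<^sub>v y"
    using append_vec_eq[of "cmat A *\<^sub>v x + cmat B *\<^sub>v y" n "l \<cdot>\<^sub>v x"] carrier_matD[OF c(1)] carrier_matD[OF c(2)]
      carrier_vecI[of "cmat A *\<^sub>v x + cmat B *\<^sub>v y" n] carrier_vecI[of "l \<cdot>\<^sub>v x" n] by simp_all
  from k[OF l xy this] show "v = 0\<^sub>v (n + q)" unfolding vx by auto
qed

lemma zero_if_unstable_mode_decays:
  fixes l a :: complex
  assumes l: "cmod l \<ge> 1"
    and re: "(\<lambda>t. Re (l ^ t * a)) \<longlonglongrightarrow> 0" and im: "(\<lambda>t. Im (l ^ t * a)) \<longlonglongrightarrow> 0"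
  shows "a = 0"
proof -
  have "(\<lambda>t. l ^ t * a) \<longlonglongrightarrow> 0"
    using re im by (subst tendsto_complex_iff) simp
  then have "(\<lambda>t. cmod (l ^ t * a)) \<longlonglongrightarrow> 0" by (rule tendsto_norm_zero)
  moreover have "cmod a \<le> cmod (l ^ t * a)" for t
    using l mult_right_mono[of 1 "cmod l ^ t" "cmod a"] by (simp add: norm_mult norm_power)
  ultimately have "cmod a \<le> 0" by (intro LIMSEQ_le_const) auto
  then show ?thesis by simp
qed

lemma map_vec_Re_mult:
  assumes A: "A \<in> carrier_mat k l" and v: "v \<in> carrier_vec l"
  shows "map_vec Re (cmat A *\<^sub>v v) = A *\<^sub>v map_vec Re v"
proof (rule eq_vecI)
  fix i assume "i < dim_vec (A *\<^sub>v map_vec Re v)"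
  then have i: "i < k" using A by simp
  have cA: "cmat A \<in> carrier_mat k l" and Rv: "map_vec Re v \<in> carrier_vec l" using A v by simp_all
  have "map_vec Re (cmat A *\<^sub>v v) $ i = Re ((cmat A *\<^sub>v v) $ i)" using A i by simp
  also have "\<dots> = (\<Sum>j<l. A $$ (i, j) * Re (v $ j))"
    unfolding index_mat_mult_vec[OF cA v i] using A i by simp
  also have "\<dots> = (A *\<^sub>v map_vec Re v) $ i"
    unfolding index_mat_mult_vec[OF A Rv i] using v by simp
  finally show "map_vec Re (cmat A *\<^sub>v v) $ i = (A *\<^sub>v map_vec Re v) $ i" .
qed (use A in simp)

lemma map_vec_Re_add: "dim_vec u = dim_vec v \<Longrightarrow> map_vec Re (u + v) = map_vec Re u + map_vec Re v"
  by (rule eq_vecI) simp_all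

lemma cmat_add: "dim_row A = dim_row B \<Longrightarrow> dim_col A = dim_col B \<Longrightarrow> cmat (A + B) = cmat A + cmat B"
  by (rule eq_matI) simp_all

lemma cmat_mult: "dim_col A = dim_row B \<Longrightarrow> cmat (A * B) = cmat A * cmat B"
  by (rule of_real_hom.mat_hom_mult[of A "dim_row A" "dim_col A" B "dim_col B"]) (auto intro: carrier_matI)

lemma eval_state_equation:
  assumes A: "A \<in> carrier_mat n n" and S: "mreg w n k S" and T: "mreg w n k T" and w: "w \<noteq> 0"
    and e: "e \<in> carrier_vec k" and eq: "pencil A * S = T"
  shows "(1 / w) \<cdot>\<^sub>v (mev w S *\<^sub>v e) = cmat A *\<^sub>v (mev w S *\<^sub>v e) + mev w T *\<^sub>v e"
proof -
  note P = mreg_pencil[OF A w]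
  have cA: "cmat A \<in> carrier_mat n n" using A by simp
  have Sc: "S \<in> carrier_mat n k" and Tc: "T \<in> carrier_mat n k" using S T by (simp_all add: mreg_def)
  have v: "mev w S *\<^sub>v e \<in> carrier_vec n" using Sc by (simp add: carrier_vecI)
  have "mev w T *\<^sub>v e = mev w (pencil A) *\<^sub>v (mev w S *\<^sub>v e)"
    unfolding eq[symmetric] mreg_mult(2)[OF P(1) S]
    by (rule assoc_mult_mat_vec) (use pencil_carrier[OF A] Sc e in auto)
  also have "\<dots> = (1 / w) \<cdot>\<^sub>v (mev w S *\<^sub>v e) - cmat A *\<^sub>v (mev w S *\<^sub>v e)"
    unfolding P(2) by (rule pencil_eval_mult[OF cA v])
  finally have 1: "mev w T *\<^sub>v e = (1 / w) \<cdot>\<^sub>v (mev w S *\<^sub>v e) - cmat A *\<^sub>v (mev w S *\<^sub>v e)" .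
  show ?thesis unfolding 1 using A Sc by (intro eq_vecI) simp_all
qed

section \<open>Closed-loop modes\<close>

text \<open>The plant in feedback with a realization of \<open>K\<close>, whose gains \<open>F\<^sub>K\<close> and \<open>H\<^sub>K\<close> witness
  stabilizability and detectability.\<close>

locale controlled_plant = coprime_plant n m p Ap Bp Cp F H G Ul Vl Nl Ml Ur Vr Nr Mr
  for n m p Ap Bp Cp F H G Ul Vl Nl Ml Ur Vr Nr Mr +
  fixes q :: nat and AK BK CK DK FK HK :: "real mat" and K :: "tf mat"
  assumes AK: "AK \<in> carrier_mat q q" and BK: "BK \<in> carrier_mat q p"
    and CK: "CK \<in> carrier_mat m q" and DK: "DK \<in> carrier_mat m p"
    and FK: "FK \<in> carrier_mat p q" "schur_stable (AK + BK * FK)"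
    and HK: "HK \<in> carrier_mat q m" "schur_stable (AK + HK * CK)"
    and K: "K = transfer_matrix AK BK CK DK"
begin

lemma ctrl_stable_dims: "AK + BK * FK \<in> carrier_mat q q" "AK + HK * CK \<in> carrier_mat q q"
  using AK BK CK FK HK by auto

lemma K_carrier: "K \<in> carrier_mat m p"
  unfolding K by (rule transfer_matrix_carrier[OF AK BK CK DK])

lemmas ctrl_dims [simp] = carrier_matD[OF AK] carrier_matD[OF BK] carrier_matD[OF CK] carrier_matD[OF DK]
  carrier_matD[OF FK(1)] carrier_matD[OF HK(1)] carrier_matD[OF K_carrier] carrier_matD[OF resolvent(1)[OF AK]]
  carrier_matD[OF resolvent(1)[OF ctrl_stable_dims(1)]] carrier_matD[OF resolvent(1)[OF ctrl_stable_dims(2)]]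
  carrier_matD[OF pencil_carrier[OF AK]]

text \<open>Closing the loop around the controller with the gain \<open>F\<^sub>K\<close> and an auxiliary input \<open>e\<close>, so that
  \<open>y = F\<^sub>K \<xi> + e\<close>, gives stable maps from \<open>e\<close> to \<open>\<xi>\<close>, \<open>y\<close> and \<open>u\<close>. The last two are right factors of \<open>K\<close>.\<close>

definition "SF = resolvent (AK + BK * FK) * const_tf BK"
definition "XF = 1\<^sub>m p + const_tf FK * SF"
definition "YF = const_tf CK * SF + const_tf DK * XF"
definition "QF = Ml * XF - Nl * YF"

lemma right_factors_RHinf: "SF \<in> RHinf q p" "XF \<in> RHinf p p" "YF \<in> RHinf m p" "QF \<in> RHinf p p"
proof -
  show S: "SF \<in> RHinf q p"
    unfolding SF_def by (rule RHinf_mult[OF RHinf_resolvent[OF ctrl_stable_dims(1) FK(2)] RHinf_const[OF BK]])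
  show X: "XF \<in> RHinf p p"
    unfolding XF_def by (rule RHinf_add[OF RHinf_one RHinf_mult[OF RHinf_const[OF FK(1)] S]])
  show Y: "YF \<in> RHinf m p"
    unfolding YF_def by (rule RHinf_add[OF RHinf_mult[OF RHinf_const[OF CK] S] RHinf_mult[OF RHinf_const[OF DK] X]])
  show "QF \<in> RHinf p p"
    unfolding QF_def by (rule RHinf_diff[OF RHinf_mult[OF factors_RHinf(4) X] RHinf_mult[OF factors_RHinf(3) Y]])
qed

lemmas right_factors_carrier = right_factors_RHinf[THEN RHinf_carrier]

lemmas right_factors_dims [simp] = right_factors_carrier[THEN carrier_matD(1)] right_factors_carrier[THEN carrier_matD(2)]

lemma SF_state_equation:
  "tf_z \<cdot>\<^sub>m SF = const_tf AK * SF + const_tf BK * XF"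
  "pencil AK * SF = const_tf BK * XF"
proof -
  have "tf_z \<cdot>\<^sub>m SF = const_tf (AK + BK * FK) * SF + const_tf BK"
    unfolding SF_def by (rule resolvent_state_equation[OF ctrl_stable_dims(1)]) (use BK in simp)
  also have "\<dots> = const_tf AK * SF + const_tf BK * XF"
    by (simp add: XF_def const_tf_add const_tf_mult mat_distribs mat_assoc mat_add_ac)
  finally show z: "tf_z \<cdot>\<^sub>m SF = const_tf AK * SF + const_tf BK * XF" .
  show "pencil AK * SF = const_tf BK * XF"
    unfolding pencil_mult[OF AK right_factors_carrier(1)] z by (rule eq_matI) simp_all
qed

lemma K_right_factor: "K * XF = YF"
  unfolding K YF_def
  by (rule transfer_matrix_mult[OF AK BK CK DK right_factors_carrier(1,2) SF_state_equation(1)])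

lemma XF_at_infinity: "mev 0 XF = 1\<^sub>m p"
proof -
  note r = resolvent(4,5)[OF ctrl_stable_dims(1)]
  have B: "mreg 0 q p (const_tf BK)" and Fc: "mreg 0 p q (const_tf FK)" using BK FK by (simp_all add: mreg_const)
  have S: "mreg 0 q p SF" using right_factors_RHinf by (simp add: RHinf_iff)
  have "mev 0 SF = 0\<^sub>m q p" unfolding SF_def mreg_mult(2)[OF r(1) B] r(2) by simp
  then have "mev 0 (const_tf FK * SF) = 0\<^sub>m p p" unfolding mreg_mult(2)[OF Fc S] by simp
  then show ?thesis
    unfolding XF_def mreg_add(2)[OF mreg_one(1) mreg_mult(1)[OF Fc S]] mreg_one(2) by simp
qed

lemma XF_invertible: "invertible_mat XF"
proof -
  have "mreg 0 p p XF" using right_factors_RHinf by (simp add: RHinf_iff)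
  then show ?thesis using mreg_minv(4)[of 0 p XF] by (simp add: XF_at_infinity)
qed

lemma eval_right_factors:
  assumes w: "cmod w \<le> 1"
  shows "mev w XF = 1\<^sub>m p + cmat FK * mev w SF" "mev w YF = cmat CK * mev w SF + cmat DK * mev w XF"
    "mev w QF = mev w Ml * mev w XF - mev w Nl * mev w YF"
proof -
  have r: "mreg w p p Ml" "mreg w p m Nl" "mreg w p p XF" "mreg w m p YF" "mreg w q p SF"
    using factors_RHinf right_factors_RHinf w by (simp_all add: RHinf_iff)
  note C = mreg_const[OF CK, of w] and D = mreg_const[OF DK, of w] and F' = mreg_const[OF FK(1), of w]
  show "mev w XF = 1\<^sub>m p + cmat FK * mev w SF"
    unfolding XF_def mreg_add(2)[OF mreg_one(1) mreg_mult(1)[OF F'(1) r(5)]] mreg_mult(2)[OF F'(1) r(5)]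
      F'(2) mreg_one(2) ..
  show "mev w YF = cmat CK * mev w SF + cmat DK * mev w XF"
    unfolding YF_def mreg_add(2)[OF mreg_mult(1)[OF C(1) r(5)] mreg_mult(1)[OF D(1) r(3)]]
      mreg_mult(2)[OF C(1) r(5)] mreg_mult(2)[OF D(1) r(3)] C(2) D(2) ..
  show "mev w QF = mev w Ml * mev w XF - mev w Nl * mev w YF"
    unfolding QF_def mreg_diff(2)[OF mreg_mult(1)[OF r(1,3)] mreg_mult(1)[OF r(2,4)]]
      mreg_mult(2)[OF r(1,3)] mreg_mult(2)[OF r(2,4)] ..
qed

lemma QF_at_infinity: "det (mev 0 QF) \<noteq> 0"
proof -
  have "mev 0 QF = mev 0 Ml * 1\<^sub>m p - 0\<^sub>m p m * mev 0 YF"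
    using eval_right_factors(3)[of 0] by (simp only: XF_at_infinity Nl_strictly_proper norm_zero zero_le_one)
  also have "\<dots> = mev 0 Ml" by (rule eq_matI) simp_all
  finally show ?thesis using Ml_at_infinity by simp
qed

text \<open>A solution of the closed-loop equations that evolves as \<open>\<lambda>\<^sup>t\<close>.\<close>

definition mode :: "complex \<Rightarrow> complex vec \<Rightarrow> complex vec \<Rightarrow> complex vec \<Rightarrow> complex vec \<Rightarrow> bool" where
  "mode l x \<xi> u y \<longleftrightarrow> x \<in> carrier_vec n \<and> \<xi> \<in> carrier_vec q \<and> u \<in> carrier_vec m \<and> y \<in> carrier_vec p \<and>
     l \<cdot>\<^sub>v x = cmat Ap *\<^sub>v x + cmat Bp *\<^sub>v u \<and> y = cmat Cp *\<^sub>v x \<and>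
     l \<cdot>\<^sub>v \<xi> = cmat AK *\<^sub>v \<xi> + cmat BK *\<^sub>v y \<and> u = cmat CK *\<^sub>v \<xi> + cmat DK *\<^sub>v y"

lemma mode_smult:
  assumes "mode l x \<xi> u y"
  shows "mode l (c \<cdot>\<^sub>v x) (c \<cdot>\<^sub>v \<xi>) (c \<cdot>\<^sub>v u) (c \<cdot>\<^sub>v y)"
proof -
  have d: "dim_vec x = n" "dim_vec \<xi> = q" "dim_vec u = m" "dim_vec y = p" using assms by (auto simp: mode_def)
  have add: "c \<cdot>\<^sub>v (a + b) = c \<cdot>\<^sub>v a + c \<cdot>\<^sub>v b" if "dim_vec a = dim_vec b" for a b :: "complex vec"
    using that by (intro eq_vecI) (simp_all add: algebra_simps)
  have l: "l \<cdot>\<^sub>v (c \<cdot>\<^sub>v v) = c \<cdot>\<^sub>v (l \<cdot>\<^sub>v v)" for v by (simp add: smult_smult_assoc mult.commute)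
  have e: "l \<cdot>\<^sub>v x = cmat Ap *\<^sub>v x + cmat Bp *\<^sub>v u" "y = cmat Cp *\<^sub>v x"
    "l \<cdot>\<^sub>v \<xi> = cmat AK *\<^sub>v \<xi> + cmat BK *\<^sub>v y" "u = cmat CK *\<^sub>v \<xi> + cmat DK *\<^sub>v y"
    using assms unfolding mode_def by blast+
  have sm: "cmat A *\<^sub>v (c \<cdot>\<^sub>v v) = c \<cdot>\<^sub>v (cmat A *\<^sub>v v)" if "dim_col A = dim_vec v" for A v
    using that by (simp add: mat_vec_smult)
  have m1: "l \<cdot>\<^sub>v (c \<cdot>\<^sub>v x) = cmat Ap *\<^sub>v (c \<cdot>\<^sub>v x) + cmat Bp *\<^sub>v (c \<cdot>\<^sub>v u)"
    unfolding l arg_cong[OF e(1), of "\<lambda>v. c \<cdot>\<^sub>v v"] by (simp add: d sm add)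
  have m2: "c \<cdot>\<^sub>v y = cmat Cp *\<^sub>v (c \<cdot>\<^sub>v x)"
    unfolding arg_cong[OF e(2), of "\<lambda>v. c \<cdot>\<^sub>v v"] by (simp add: d sm)
  have m3: "l \<cdot>\<^sub>v (c \<cdot>\<^sub>v \<xi>) = cmat AK *\<^sub>v (c \<cdot>\<^sub>v \<xi>) + cmat BK *\<^sub>v (c \<cdot>\<^sub>v y)"
    unfolding l arg_cong[OF e(3), of "\<lambda>v. c \<cdot>\<^sub>v v"] by (simp add: d sm add)
  have m4: "c \<cdot>\<^sub>v u = cmat CK *\<^sub>v (c \<cdot>\<^sub>v \<xi>) + cmat DK *\<^sub>v (c \<cdot>\<^sub>v y)"
    unfolding arg_cong[OF e(4), of "\<lambda>v. c \<cdot>\<^sub>v v"] by (simp add: d sm add)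
  show ?thesis
    unfolding mode_def by (intro conjI m1 m2 m3 m4 carrier_vecI) (simp_all add: d)
qed

text \<open>A kernel vector \<open>e\<close> of \<open>M\<^sub>l X\<^sub>F - N\<^sub>l Y\<^sub>F\<close> at \<open>w\<close> prescribes controller signals \<open>y = X\<^sub>F e\<close> and \<open>u = Y\<^sub>F e\<close> with
  \<open>M\<^sub>l y = N\<^sub>l u\<close>. By \<open>left_kernel\<close> such a pair is a plant response to the input \<open>u\<close>, with a state supplied
  by \<open>ctr_factor\<close>. The state cannot vanish together with \<open>\<xi>\<close>, since \<open>e = y - F\<^sub>K \<xi>\<close>.\<close>

lemma mode_of_kernel:
  assumes w: "cmod w \<le> 1" "w \<noteq> 0" and e: "e \<in> carrier_vec p" and z: "mev w QF *\<^sub>v e = 0\<^sub>v p" and e0: "e \<noteq> 0\<^sub>v p"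
  obtains x \<xi> u y where "mode (1 / w) x \<xi> u y" "\<not> (x = 0\<^sub>v n \<and> \<xi> = 0\<^sub>v q)"
proof -
  have r: "mreg w p p XF" "mreg w q p SF" "mreg w m m Mr" "mreg w n m ctr_factor"
    using factors_RHinf right_factors_RHinf ctr_factor(1) w by (simp_all add: RHinf_iff)
  note cB = mreg_const[OF BK, of w] and cBp = mreg_const[OF Bp, of w] and cCp = mreg_const[OF Cp, of w]
  note ef = eval_right_factors[OF w(1)]
  have [simp]: "dim_vec e = p" "dim_row ctr_factor = n" "dim_col ctr_factor = m"
    using e mreg_carrier[OF r(4)] by simp_all
  define \<xi> where "\<xi> = mev w SF *\<^sub>v e"
  define y where "y = mev w XF *\<^sub>v e"
  define u where "u = mev w YF *\<^sub>v e"
  have [simp]: "dim_vec \<xi> = q" "dim_vec y = p" "dim_vec u = m" by (simp_all add: \<xi>_def y_def u_def)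
  have "mev w Ml *\<^sub>v y - mev w Nl *\<^sub>v u = 0\<^sub>v p"
    using z unfolding ef(3) by (simp add: y_def u_def mat_vec_simps)
  then have eq: "mev w Ml *\<^sub>v y = mev w Nl *\<^sub>v u"
    by (subst (asm) vec_eq_iff_diff_zero) (rule carrier_vecI, simp)+
  obtain d where d: "d \<in> carrier_vec m" "y = mev w Nr *\<^sub>v d" "u = mev w Mr *\<^sub>v d"
    by (rule left_kernel[OF w(1) _ _ eq]) (rule carrier_vecI, simp)+
  have [simp]: "dim_vec d = m" using d(1) by simp
  define x where "x = mev w ctr_factor *\<^sub>v d"
  have [simp]: "dim_vec x = n" by (simp add: x_def)
  have BM: "mreg w n m (const_tf Bp * Mr)" by (rule mreg_mult(1)[OF cBp(1) r(3)])
  have BX: "mreg w q p (const_tf BK * XF)" by (rule mreg_mult(1)[OF cB(1) r(1)])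
  have "(1 / w) \<cdot>\<^sub>v x = cmat Ap *\<^sub>v x + mev w (const_tf Bp * Mr) *\<^sub>v d"
    unfolding x_def by (rule eval_state_equation[OF Ap r(4) BM w(2) d(1) ctr_factor(3)])
  then have m1: "(1 / w) \<cdot>\<^sub>v x = cmat Ap *\<^sub>v x + cmat Bp *\<^sub>v u"
    unfolding mreg_mult(2)[OF cBp(1) r(3)] cBp(2) d(3) by (simp add: mat_vec_simps)
  have "y = mev w (const_tf Cp * ctr_factor) *\<^sub>v d" unfolding ctr_factor(2) by (rule d(2))
  then have m2: "y = cmat Cp *\<^sub>v x"
    unfolding mreg_mult(2)[OF cCp(1) r(4)] cCp(2) x_def by (simp add: mat_vec_simps)
  have "(1 / w) \<cdot>\<^sub>v \<xi> = cmat AK *\<^sub>v \<xi> + mev w (const_tf BK * XF) *\<^sub>v e"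
    unfolding \<xi>_def by (rule eval_state_equation[OF AK r(2) BX w(2) e SF_state_equation(2)])
  then have m3: "(1 / w) \<cdot>\<^sub>v \<xi> = cmat AK *\<^sub>v \<xi> + cmat BK *\<^sub>v y"
    unfolding mreg_mult(2)[OF cB(1) r(1)] cB(2) y_def by (simp add: mat_vec_simps)
  have m4: "u = cmat CK *\<^sub>v \<xi> + cmat DK *\<^sub>v y"
    unfolding u_def \<xi>_def y_def ef(2) by (simp add: mat_vec_simps)
  have ye: "y = e + cmat FK *\<^sub>v \<xi>"
    unfolding y_def \<xi>_def ef(1) by (simp add: mat_vec_simps)
  have zero: "cmat A *\<^sub>v 0\<^sub>v k = 0\<^sub>v j" if "A \<in> carrier_mat j k" for A j k
    using that by (intro eq_vecI) (auto simp: scalar_prod_def)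
  have "\<not> (x = 0\<^sub>v n \<and> \<xi> = 0\<^sub>v q)"
  proof
    assume "x = 0\<^sub>v n \<and> \<xi> = 0\<^sub>v q"
    then have "0\<^sub>v p = e + 0\<^sub>v p" using m2 ye zero[OF Cp] zero[OF FK(1)] by simp
    then show False using e e0 by simp
  qed
  moreover have "mode (1 / w) x \<xi> u y"
    unfolding mode_def by (intro conjI m1 m2 m3 m4 carrier_vecI) simp_all
  ultimately show ?thesis using that by blast
qed

text \<open>Conversely, the signals of a mode that does not decay have the form \<open>y = X\<^sub>F e\<close>, \<open>u = Y\<^sub>F e\<close> with \<open>e = y - F\<^sub>K \<xi>\<close>,
  because \<open>A\<^sub>K + B\<^sub>K F\<^sub>K\<close> has no eigenvalue there, and they satisfy \<open>M\<^sub>l y = N\<^sub>l u\<close> by \<open>obs_factor\<close>. So \<open>e\<close> is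
  a kernel vector and vanishes, which leaves a plant mode invisible at the output. Detectability of
  the plant excludes it.\<close>

lemma mode_trivial:
  assumes nz: "\<And>w. cmod w \<le> 1 \<Longrightarrow> det (mev w QF) \<noteq> 0"
    and mo: "mode l x \<xi> u y" and l: "cmod l \<ge> 1"
  shows "x = 0\<^sub>v n" "\<xi> = 0\<^sub>v q"
proof -
  define w where "w = 1 / l"
  have w: "cmod w \<le> 1" "w \<noteq> 0" "1 / w = l" using l by (auto simp: w_def norm_divide divide_simps)
  have r: "mreg w p p Ml" "mreg w p n obs_factor" "mreg w q q (resolvent (AK + BK * FK))"
    using factors_RHinf obs_factor(1) RHinf_resolvent[OF ctrl_stable_dims(1) FK(2)] w by (simp_all add: RHinf_iff)
  note cB = mreg_const[OF BK, of w] and cBp = mreg_const[OF Bp, of w] and cCp = mreg_const[OF Cp, of w]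
  note ef = eval_right_factors[OF w(1)]
  have [simp]: "dim_vec x = n" "dim_vec \<xi> = q" "dim_vec u = m" "dim_vec y = p"
    "dim_row obs_factor = p" "dim_col obs_factor = n"
    using mo mreg_carrier[OF r(2)] by (auto simp: mode_def)
  have m1: "l \<cdot>\<^sub>v x = cmat Ap *\<^sub>v x + cmat Bp *\<^sub>v u" and m2: "y = cmat Cp *\<^sub>v x"
    and m3: "l \<cdot>\<^sub>v \<xi> = cmat AK *\<^sub>v \<xi> + cmat BK *\<^sub>v y" and m4: "u = cmat CK *\<^sub>v \<xi> + cmat DK *\<^sub>v y"
    using mo by (simp_all add: mode_def)
  \<comment> \<open>the auxiliary input that the gain \<open>F\<^sub>K\<close> would need to produce \<open>y\<close>\<close>
  define e where "e = y - cmat FK *\<^sub>v \<xi>"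
  have [simp]: "dim_vec e = p" by (simp add: e_def)
  have ye: "y = e + cmat FK *\<^sub>v \<xi>" unfolding e_def by (rule eq_vecI) simp_all
  have xi: "\<xi> = mev w SF *\<^sub>v e"
  proof -
    note P = mreg_pencil[OF ctrl_stable_dims(1) w(2)]
    have cA: "cmat (AK + BK * FK) \<in> carrier_mat q q" using ctrl_stable_dims(1) by simp
    have ce: "cmat (AK + BK * FK) = cmat AK + cmat BK * cmat FK"
      by (simp add: cmat_add cmat_mult)
    have v: "\<xi> \<in> carrier_vec q" by (rule carrier_vecI) simp
    have "mev w (pencil (AK + BK * FK)) *\<^sub>v \<xi> = l \<cdot>\<^sub>v \<xi> - (cmat AK *\<^sub>v \<xi> + cmat BK *\<^sub>v (cmat FK *\<^sub>v \<xi>))"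
      unfolding P(2) w(3) pencil_eval_mult[OF cA v] ce by (simp add: mat_vec_simps)
    also have "\<dots> = cmat BK *\<^sub>v e"
      unfolding m3 unfolding ye by (simp add: mat_vec_simps) (rule eq_vecI; simp del: index_mult_mat_vec)
    finally have "cmat BK *\<^sub>v e = mev w (pencil (AK + BK * FK)) *\<^sub>v \<xi>" ..
    then have "mev w SF *\<^sub>v e = mev w (resolvent (AK + BK * FK)) *\<^sub>v (mev w (pencil (AK + BK * FK)) *\<^sub>v \<xi>)"
      unfolding SF_def mreg_mult(2)[OF r(3) cB(1)] cB(2) by (simp add: mat_vec_assoc)
    also have "\<dots> = (mev w (resolvent (AK + BK * FK)) * mev w (pencil (AK + BK * FK))) *\<^sub>v \<xi>"
      by (rule mat_vec_assoc[symmetric]) (use carrier_matD[OF pencil_carrier[OF ctrl_stable_dims(1)]] in simp_all)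
    also have "mev w (resolvent (AK + BK * FK)) * mev w (pencil (AK + BK * FK)) = 1\<^sub>m q"
      unfolding mreg_mult(2)[OF r(3) P(1), symmetric] resolvent(3)[OF ctrl_stable_dims(1)] mreg_one(2) ..
    finally show ?thesis using v by simp
  qed
  have yX: "y = mev w XF *\<^sub>v e"
    unfolding ye ef(1) using xi by (simp add: mat_vec_simps)
  have uY: "u = mev w YF *\<^sub>v e"
    unfolding m4 ef(2) using xi yX by (simp add: mat_vec_simps)
  have eq: "mev w Ml *\<^sub>v y = mev w Nl *\<^sub>v u"
  proof -
    note P = mreg_pencil[OF Ap w(2)]
    have cA: "cmat Ap \<in> carrier_mat n n" using Ap by simp
    have v: "x \<in> carrier_vec n" by (rule carrier_vecI) simp
    have "mev w (pencil Ap) *\<^sub>v x = cmat Bp *\<^sub>v u"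
      unfolding P(2) w(3) pencil_eval_mult[OF cA v] m1 by (rule eq_vecI; simp del: index_mult_mat_vec)
    then have "mev w obs_factor *\<^sub>v (mev w (pencil Ap) *\<^sub>v x) = mev w obs_factor *\<^sub>v (cmat Bp *\<^sub>v u)" by simp
    moreover have "mev w obs_factor *\<^sub>v (mev w (pencil Ap) *\<^sub>v x) = mev w (obs_factor * pencil Ap) *\<^sub>v x"
      unfolding mreg_mult(2)[OF r(2) P(1)] by (rule mat_vec_assoc[symmetric]) simp_all
    moreover have "\<dots> = mev w Ml *\<^sub>v y"
      unfolding obs_factor(3) mreg_mult(2)[OF r(1) cCp(1)] cCp(2) m2 by (simp add: mat_vec_assoc)
    moreover have "mev w obs_factor *\<^sub>v (cmat Bp *\<^sub>v u) = mev w (obs_factor * const_tf Bp) *\<^sub>v u"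
      unfolding mreg_mult(2)[OF r(2) cBp(1)] cBp(2) by (rule mat_vec_assoc[symmetric]) simp_all
    ultimately show ?thesis unfolding obs_factor(2) by simp
  qed
  have "mev w QF *\<^sub>v e = mev w Ml *\<^sub>v y - mev w Nl *\<^sub>v u"
    unfolding yX uY ef(3) by (simp add: mat_vec_simps)
  also have "\<dots> = 0\<^sub>v p" unfolding eq by (rule eq_vecI) simp_all
  finally have "mev w QF *\<^sub>v e = 0\<^sub>v p" .
  then have e0: "e = 0\<^sub>v p"
    by (intro det_nonzeroD[of "mev w QF" p e] nz[OF w(1)] carrier_vecI carrier_matI) simp_all
  have zero: "A *\<^sub>v 0\<^sub>v k = 0\<^sub>v (dim_row A)" if "dim_col A = k" for A :: "complex mat" and k
    using that by (intro eq_vecI) (auto simp: scalar_prod_def)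
  show xi0: "\<xi> = 0\<^sub>v q" using xi e0 by (simp add: zero)
  have y0: "y = 0\<^sub>v p" using yX e0 by (simp add: zero)
  have u0: "u = 0\<^sub>v m" using m4 xi0 y0 by (simp add: zero)
  have Ax: "cmat Ap *\<^sub>v x = l \<cdot>\<^sub>v x" unfolding m1 u0 by (rule eq_vecI) (simp_all add: zero)
  have ce: "cmat (Ap + H * Cp) = cmat Ap + cmat H * cmat Cp"
    by (simp add: cmat_add cmat_mult)
  have "cmat (Ap + H * Cp) *\<^sub>v x = cmat Ap *\<^sub>v x + cmat H *\<^sub>v y"
    unfolding ce m2 by (simp add: mat_vec_simps)
  also have "\<dots> = l \<cdot>\<^sub>v x" unfolding y0 Ax by (rule eq_vecI) (simp_all add: zero)
  finally show "x = 0\<^sub>v n"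
    by (intro schur_stable_kernel[OF stable_dims(2) H(2) l] carrier_vecI) simp_all
qed

text \<open>The real part of \<open>\<lambda>\<^sup>t\<close> times a mode is an admissible real trajectory.\<close>

lemma mode_trajectory:
  fixes x \<xi> :: "complex vec"
  assumes st: "internally_stabilizes Ap Bp Cp AK BK CK DK" and mo: "mode l x \<xi> u y"
  shows "i < n \<Longrightarrow> (\<lambda>t. Re (l ^ t * x $ i)) \<longlonglongrightarrow> 0" "i < q \<Longrightarrow> (\<lambda>t. Re (l ^ t * \<xi> $ i)) \<longlonglongrightarrow> 0"
proof -
  let ?R = "\<lambda>t v. map_vec Re (l ^ t \<cdot>\<^sub>v v)"
  have [simp]: "dim_vec x = n" "dim_vec \<xi> = q" "dim_vec u = m" "dim_vec y = p"
    using mo by (auto simp: mode_def)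
  have mt: "mode l (l ^ t \<cdot>\<^sub>v x) (l ^ t \<cdot>\<^sub>v \<xi>) (l ^ t \<cdot>\<^sub>v u) (l ^ t \<cdot>\<^sub>v y)" for t
    by (rule mode_smult[OF mo])
  have sm: "l ^ Suc t \<cdot>\<^sub>v v = l \<cdot>\<^sub>v (l ^ t \<cdot>\<^sub>v v)" for t v by (simp add: smult_smult_assoc)
  have "?R (Suc t) x = Ap *\<^sub>v ?R t x + Bp *\<^sub>v ?R t u \<and> ?R t y = Cp *\<^sub>v ?R t x \<and>
      ?R (Suc t) \<xi> = AK *\<^sub>v ?R t \<xi> + BK *\<^sub>v ?R t y \<and> ?R t u = CK *\<^sub>v ?R t \<xi> + DK *\<^sub>v ?R t y" for t
  proof -
    have e: "l \<cdot>\<^sub>v (l ^ t \<cdot>\<^sub>v x) = cmat Ap *\<^sub>v (l ^ t \<cdot>\<^sub>v x) + cmat Bp *\<^sub>v (l ^ t \<cdot>\<^sub>v u)"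
      "l ^ t \<cdot>\<^sub>v y = cmat Cp *\<^sub>v (l ^ t \<cdot>\<^sub>v x)"
      "l \<cdot>\<^sub>v (l ^ t \<cdot>\<^sub>v \<xi>) = cmat AK *\<^sub>v (l ^ t \<cdot>\<^sub>v \<xi>) + cmat BK *\<^sub>v (l ^ t \<cdot>\<^sub>v y)"
      "l ^ t \<cdot>\<^sub>v u = cmat CK *\<^sub>v (l ^ t \<cdot>\<^sub>v \<xi>) + cmat DK *\<^sub>v (l ^ t \<cdot>\<^sub>v y)"
      using mt[of t] unfolding mode_def by blast+
    have c: "l ^ t \<cdot>\<^sub>v x \<in> carrier_vec n" "l ^ t \<cdot>\<^sub>v \<xi> \<in> carrier_vec q" "l ^ t \<cdot>\<^sub>v u \<in> carrier_vec m" "l ^ t \<cdot>\<^sub>v y \<in> carrier_vec p"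
      by (rule_tac [!] carrier_vecI) simp_all
    have "?R (Suc t) x = Ap *\<^sub>v ?R t x + Bp *\<^sub>v ?R t u"
      unfolding sm e(1) using map_vec_Re_mult[OF Ap c(1)] map_vec_Re_mult[OF Bp c(3)] by (simp add: map_vec_Re_add)
    moreover have "?R t y = Cp *\<^sub>v ?R t x"
      unfolding e(2) by (rule map_vec_Re_mult[OF Cp c(1)])
    moreover have "?R (Suc t) \<xi> = AK *\<^sub>v ?R t \<xi> + BK *\<^sub>v ?R t y"
      unfolding sm e(3) using map_vec_Re_mult[OF AK c(2)] map_vec_Re_mult[OF BK c(4)] by (simp add: map_vec_Re_add)
    moreover have "?R t u = CK *\<^sub>v ?R t \<xi> + DK *\<^sub>v ?R t y"
      unfolding e(4) using map_vec_Re_mult[OF CK c(2)] map_vec_Re_mult[OF DK c(4)] by (simp add: map_vec_Re_add)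
    ultimately show ?thesis by blast
  qed
  then have "(\<forall>i<n. (\<lambda>t. ?R t x $ i) \<longlonglongrightarrow> 0) \<and> (\<forall>i<q. (\<lambda>t. ?R t \<xi> $ i) \<longlonglongrightarrow> 0)"
    using st[unfolded internally_stabilizes_def, rule_format, of "\<lambda>t. ?R t x" "\<lambda>t. ?R t \<xi>" "\<lambda>t. ?R t u" "\<lambda>t. ?R t y"]
      carrier_vecI[of "?R 0 x" n] carrier_vecI[of "?R 0 \<xi>" q]
    by simp
  then show "i < n \<Longrightarrow> (\<lambda>t. Re (l ^ t * x $ i)) \<longlonglongrightarrow> 0" "i < q \<Longrightarrow> (\<lambda>t. Re (l ^ t * \<xi> $ i)) \<longlonglongrightarrow> 0"
    by simp_all
qed

text \<open>The imaginary part is the real part of the mode multiplied by \<open>- \<i>\<close>, so the whole complex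
  trajectory tends to \<open>0\<close>. As \<open>|\<lambda>| \<ge> 1\<close>, only the zero mode can do this.\<close>

lemma stable_imp_mode_trivial:
  assumes st: "internally_stabilizes Ap Bp Cp AK BK CK DK" and mo: "mode l x \<xi> u y" and l: "cmod l \<ge> 1"
  shows "x = 0\<^sub>v n" "\<xi> = 0\<^sub>v q"
proof -
  have [simp]: "dim_vec x = n" "dim_vec \<xi> = q" using mo by (auto simp: mode_def)
  note re = mode_trajectory[OF st mo]
  have im: "i < n \<Longrightarrow> (\<lambda>t. Im (l ^ t * x $ i)) \<longlonglongrightarrow> 0" "i < q \<Longrightarrow> (\<lambda>t. Im (l ^ t * \<xi> $ i)) \<longlonglongrightarrow> 0" for i
    using mode_trajectory[OF st mode_smult[OF mo, of "- \<i>"], of i]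
    by (simp_all add: mult.left_commute[of _ \<i>] add.commute)
  show "x = 0\<^sub>v n" "\<xi> = 0\<^sub>v q"
    using zero_if_unstable_mode_decays[OF l re(1) im(1)] zero_if_unstable_mode_decays[OF l re(2) im(2)]
    by (auto intro!: eq_vecI)
qed

text \<open>Eliminating \<open>u\<close> and \<open>y\<close> leaves an autonomous system in \<open>(x, \<xi>)\<close> whose eigenvectors are the modes.\<close>

lemma mode_trivial_imp_stable:
  assumes tr: "\<And>l x \<xi> u y. cmod l \<ge> 1 \<Longrightarrow> mode l x \<xi> u y \<Longrightarrow> x = 0\<^sub>v n \<and> \<xi> = 0\<^sub>v q"
  shows "internally_stabilizes Ap Bp Cp AK BK CK DK"
proof -
  define A11 where "A11 = Ap + Bp * (DK * Cp)"
  define A12 where "A12 = Bp * CK"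
  define A21 where "A21 = BK * Cp"
  define A where "A = four_block_mat A11 A12 A21 AK"
  have c: "A11 \<in> carrier_mat n n" "A12 \<in> carrier_mat n q" "A21 \<in> carrier_mat q n"
    unfolding A11_def A12_def A21_def using Ap Bp Cp AK BK CK DK by (auto intro!: mult_carrier_mat)
  have Ac: "A \<in> carrier_mat (n + q) (n + q)" unfolding A_def using c AK by simp
  have "schur_stable A"
    unfolding A_def
  proof (rule schur_stable_four_blockI[OF c AK])
    fix l x \<xi> assume l: "cmod l \<ge> 1" and xc: "x \<in> carrier_vec n" "\<xi> \<in> carrier_vec q"
      and e: "cmat A11 *\<^sub>v x + cmat A12 *\<^sub>v \<xi> = l \<cdot>\<^sub>v x" "cmat A21 *\<^sub>v x + cmat AK *\<^sub>v \<xi> = l \<cdot>\<^sub>v \<xi>"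
    have [simp]: "dim_vec x = n" "dim_vec \<xi> = q" using xc by simp_all
    define y where "y = cmat Cp *\<^sub>v x"
    define u where "u = cmat CK *\<^sub>v \<xi> + cmat DK *\<^sub>v y"
    have [simp]: "dim_vec y = p" "dim_vec u = m" by (simp_all add: y_def u_def)
    have cs: "cmat A11 = cmat Ap + cmat Bp * (cmat DK * cmat Cp)" "cmat A12 = cmat Bp * cmat CK"
      "cmat A21 = cmat BK * cmat Cp"
      unfolding A11_def A12_def A21_def by (simp_all add: cmat_add cmat_mult)
    have m1: "l \<cdot>\<^sub>v x = cmat Ap *\<^sub>v x + cmat Bp *\<^sub>v u"
      unfolding e(1)[symmetric] cs u_def y_def
      by (simp add: mat_vec_simps) (rule eq_vecI; simp del: index_mult_mat_vec)
    have m3: "l \<cdot>\<^sub>v \<xi> = cmat AK *\<^sub>v \<xi> + cmat BK *\<^sub>v y"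
      unfolding e(2)[symmetric] cs y_def
      by (simp add: mat_vec_simps) (rule eq_vecI; simp del: index_mult_mat_vec)
    have "mode l x \<xi> u y"
      unfolding mode_def by (intro conjI m1 m3 u_def y_def xc carrier_vecI) simp_all
    from tr[OF l this] show "x = 0\<^sub>v n \<and> \<xi> = 0\<^sub>v q" .
  qed
  show ?thesis
    unfolding internally_stabilizes_def
  proof (intro allI impI)
    fix x \<xi> u y :: "nat \<Rightarrow> real vec"
    assume as: "x 0 \<in> carrier_vec (dim_row Ap) \<and> \<xi> 0 \<in> carrier_vec (dim_row AK) \<and>
      (\<forall>t. x (Suc t) = Ap *\<^sub>v x t + Bp *\<^sub>v u t \<and> y t = Cp *\<^sub>v x t \<and>
         \<xi> (Suc t) = AK *\<^sub>v \<xi> t + BK *\<^sub>v y t \<and> u t = CK *\<^sub>v \<xi> t + DK *\<^sub>v y t)"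
    have xd: "dim_vec (x t) = n" "dim_vec (\<xi> t) = q" for t
      using as by (cases t; simp)+
    define s where "s t = x t @\<^sub>v \<xi> t" for t
    have "s (Suc t) = A *\<^sub>v s t" for t
    proof -
      have f: "x (Suc t) = Ap *\<^sub>v x t + Bp *\<^sub>v u t" "y t = Cp *\<^sub>v x t"
         "\<xi> (Suc t) = AK *\<^sub>v \<xi> t + BK *\<^sub>v y t" "u t = CK *\<^sub>v \<xi> t + DK *\<^sub>v y t" using as by blast+
      have "A *\<^sub>v s t = (A11 *\<^sub>v x t + A12 *\<^sub>v \<xi> t) @\<^sub>v (A21 *\<^sub>v x t + AK *\<^sub>v \<xi> t)"
        unfolding A_def s_def by (rule four_block_mat_mult_vec[OF c AK]) (rule carrier_vecI, simp add: xd)+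
      moreover have "A11 *\<^sub>v x t + A12 *\<^sub>v \<xi> t = x (Suc t)"
        unfolding f(1,4,2) A11_def A12_def using xd[of t]
        by (simp add: mat_vec_simps) (rule eq_vecI; simp del: index_mult_mat_vec)
      moreover have "A21 *\<^sub>v x t + AK *\<^sub>v \<xi> t = \<xi> (Suc t)"
        unfolding f(3,2) A21_def using xd[of t]
        by (simp add: mat_vec_simps) (rule eq_vecI; simp del: index_mult_mat_vec)
      ultimately show ?thesis by (simp add: s_def)
    qed
    moreover have "s 0 \<in> carrier_vec (n + q)" unfolding s_def by (rule carrier_vecI) (simp add: xd)
    ultimately have lim: "(\<lambda>t. s t $ i) \<longlonglongrightarrow> 0" if "i < n + q" for i
      using schur_stable_trajectory[OF Ac \<open>schur_stable A\<close>, of s i] that by blast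
    have "(\<lambda>t. x t $ i) \<longlonglongrightarrow> 0" if "i < n" for i
      using lim[of i] that by (simp add: s_def xd)
    moreover have "(\<lambda>t. \<xi> t $ i) \<longlonglongrightarrow> 0" if "i < q" for i
      using lim[of "n + i"] that by (simp add: s_def xd)
    ultimately show "(\<forall>i<dim_row Ap. (\<lambda>t. x t $ i) \<longlonglongrightarrow> 0) \<and> (\<forall>i<dim_row AK. (\<lambda>t. \<xi> t $ i) \<longlonglongrightarrow> 0)"
      by simp
  qed
qed

lemma stable_iff_QF:
  "internally_stabilizes Ap Bp Cp AK BK CK DK \<longleftrightarrow> (\<forall>w. cmod w \<le> 1 \<longrightarrow> det (mev w QF) \<noteq> 0)"
proof
  assume st: "internally_stabilizes Ap Bp Cp AK BK CK DK"
  show "\<forall>w. cmod w \<le> 1 \<longrightarrow> det (mev w QF) \<noteq> 0"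
  proof (intro allI impI)
    fix w assume w: "cmod w \<le> 1"
    show "det (mev w QF) \<noteq> 0"
    proof (cases "w = 0")
      case True
      then show ?thesis using QF_at_infinity by simp
    next
      case False
      show ?thesis
      proof (rule det_nonzeroI[of _ p])
        fix e assume e: "e \<in> carrier_vec p" "mev w QF *\<^sub>v e = 0\<^sub>v p"
        have l: "cmod (1 / w) \<ge> 1" using w False by (simp add: norm_divide)
        show "e = 0\<^sub>v p"
        proof (rule ccontr)
          assume "e \<noteq> 0\<^sub>v p"
          then obtain x \<xi> u y where "mode (1 / w) x \<xi> u y" "\<not> (x = 0\<^sub>v n \<and> \<xi> = 0\<^sub>v q)"
            using mode_of_kernel[OF w False e] by blast
          then show False using stable_imp_mode_trivial[OF st _ l] by blast
        qed
      qed (use right_factors_carrier in simp)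
    qed
  qed
next
  assume "\<forall>w. cmod w \<le> 1 \<longrightarrow> det (mev w QF) \<noteq> 0"
  then show "internally_stabilizes Ap Bp Cp AK BK CK DK"
    using mode_trivial by (intro mode_trivial_imp_stable) blast
qed

end

context controlled_plant
begin

text \<open>When \<open>M\<^sub>l X\<^sub>F - N\<^sub>l Y\<^sub>F\<close> is a unit, dividing both right factors by it normalizes it to the identity.\<close>

lemma stable_imp_bezout_factors:
  assumes st: "internally_stabilizes Ap Bp Cp AK BK CK DK"
  obtains X Y where "X \<in> RHinf p p" "Y \<in> RHinf m p" "invertible_mat X" "K = Y * minv X" "Ml * X - Nl * Y = 1\<^sub>m p"
proof -
  have "\<And>w. cmod w \<le> 1 \<Longrightarrow> det (mev w QF) \<noteq> 0" using st stable_iff_QF by blast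
  note Qi = RHinf_minv[OF right_factors_RHinf(4) this]
  note Xi = invertible_matD[OF right_factors_carrier(2) XF_invertible]
  note c [simp] = carrier_matD[OF RHinf_carrier[OF Qi(1)]] carrier_matD[OF Xi(1)]
  define X where "X = XF * minv QF"
  define Y where "Y = YF * minv QF"
  have X: "X \<in> RHinf p p" and Y: "Y \<in> RHinf m p"
    unfolding X_def Y_def
    using RHinf_mult[OF right_factors_RHinf(2) Qi(1)] RHinf_mult[OF right_factors_RHinf(3) Qi(1)] by simp_all
  have Xc: "X \<in> carrier_mat p p" and Yc: "Y \<in> carrier_mat m p" by (rule RHinf_carrier[OF X], rule RHinf_carrier[OF Y])
  have "Ml * (XF * Z) - Nl * (YF * Z) = QF * Z" if "dim_row Z = p" for Z
    unfolding QF_def using that by (simp add: mat_distribs mat_assoc)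
  then have "Ml * X - Nl * Y = QF * minv QF"
    unfolding X_def Y_def by simp
  then have bez: "Ml * X - Nl * Y = 1\<^sub>m p" using Qi(2) by simp
  have "X * (QF * minv XF) = XF * ((minv QF * QF) * minv XF)"
    unfolding X_def by (simp add: mat_assoc)
  also have "\<dots> = 1\<^sub>m p" by (simp add: Qi(3) Xi(2))
  finally have XQ: "X * (QF * minv XF) = 1\<^sub>m p" .
  have inv: "invertible_mat X"
    by (rule minv_eqI(2)[OF Xc _ XQ]) (rule carrier_matI; simp)
  note i = invertible_matD[OF Xc inv]
  have "K * X = Y"
    unfolding X_def Y_def K_right_factor[symmetric] by (simp add: mat_assoc)
  then have "Y * minv X = K * (X * minv X)"
    using Xc i(1) K_carrier by (simp add: mat_assoc[symmetric])
  then have "K = Y * minv X" unfolding i(2) using K_carrier by simp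
  then show ?thesis using that X Y inv bez by blast
qed

text \<open>The controller state driven by \<open>X\<close> has the output \<open>Y\<close>, so \<open>\<Xi>\<close> is also the state of the stable
  observer \<open>A\<^sub>K + H\<^sub>K C\<^sub>K\<close> fed with \<open>X\<close> and \<open>Y\<close>. Hence \<open>\<Xi>\<close> and \<open>W = X - F\<^sub>K \<Xi>\<close> are stable, \<open>(X, Y)\<close> is
  \<open>(X\<^sub>F, Y\<^sub>F) W\<close>, and taking determinants in \<open>M\<^sub>l X - N\<^sub>l Y = (M\<^sub>l X\<^sub>F - N\<^sub>l Y\<^sub>F) W\<close> gives the criterion.\<close>

lemma bezout_factors_imp_stable:
  assumes X: "X \<in> RHinf p p" and Y: "Y \<in> RHinf m p" and inv: "invertible_mat X" and KXY: "K = Y * minv X"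
    and nz: "\<And>w. cmod w \<le> 1 \<Longrightarrow> det (mev w (Ml * X - Nl * Y)) \<noteq> 0"
  shows "internally_stabilizes Ap Bp Cp AK BK CK DK"
proof -
  note i = invertible_matD[OF RHinf_carrier[OF X] inv]
  note [simp] = carrier_matD[OF RHinf_carrier[OF X]] carrier_matD[OF RHinf_carrier[OF Y]] carrier_matD[OF i(1)]
  have KX: "K * X = Y" unfolding KXY by (simp add: mat_assoc i(3))
  define \<Xi> where "\<Xi> = resolvent AK * (const_tf BK * X)"
  have [simp]: "dim_row \<Xi> = q" "dim_col \<Xi> = p" by (simp_all add: \<Xi>_def)
  have \<Xi>c: "\<Xi> \<in> carrier_mat q p" by (rule carrier_matI) simp_all
  have BX: "const_tf BK * X \<in> carrier_mat q p" by (rule carrier_matI) simp_all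
  have z: "tf_z \<cdot>\<^sub>m \<Xi> = const_tf AK * \<Xi> + const_tf BK * X"
    unfolding \<Xi>_def by (rule resolvent_state_equation[OF AK BX])
  have Yeq: "Y = const_tf CK * \<Xi> + const_tf DK * X"
    unfolding KX[symmetric] K by (rule transfer_matrix_mult[OF AK BK CK DK \<Xi>c RHinf_carrier[OF X] z])
  define W where "W = X - const_tf FK * \<Xi>"
  have [simp]: "dim_row W = p" "dim_col W = p" by (simp_all add: W_def)
  have "\<Xi> = resolvent (AK + HK * CK) * (const_tf BK * X - const_tf HK * (Y - const_tf DK * X))"
  proof (rule state_equation_solution[OF ctrl_stable_dims(2) \<Xi>c])
    show "const_tf BK * X - const_tf HK * (Y - const_tf DK * X) \<in> carrier_mat q p" by (rule carrier_matI) simp_all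
    show "tf_z \<cdot>\<^sub>m \<Xi> = const_tf (AK + HK * CK) * \<Xi> + (const_tf BK * X - const_tf HK * (Y - const_tf DK * X))"
      unfolding z Yeq by (simp add: const_tf_add const_tf_mult mat_ring_simps)
  qed
  then have "\<Xi> \<in> RHinf q p"
    using RHinf_mult[OF RHinf_resolvent[OF ctrl_stable_dims(2) HK(2)] RHinf_diff[OF RHinf_mult[OF RHinf_const[OF BK] X]
      RHinf_mult[OF RHinf_const[OF HK(1)] RHinf_diff[OF Y RHinf_mult[OF RHinf_const[OF DK] X]]]]] by simp
  then have W: "W \<in> RHinf p p"
    unfolding W_def by (rule RHinf_diff[OF X RHinf_mult[OF RHinf_const[OF FK(1)]]])
  have "\<Xi> = resolvent (AK + BK * FK) * (const_tf BK * W)"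
  proof (rule state_equation_solution[OF ctrl_stable_dims(1) \<Xi>c])
    show "const_tf BK * W \<in> carrier_mat q p" by (rule carrier_matI) simp_all
    show "tf_z \<cdot>\<^sub>m \<Xi> = const_tf (AK + BK * FK) * \<Xi> + const_tf BK * W"
      unfolding z W_def by (simp add: const_tf_add const_tf_mult mat_ring_simps)
  qed
  then have SW: "SF * W = \<Xi>" unfolding SF_def by (simp add: mat_assoc)
  have XW: "XF * W = X"
    unfolding XF_def by (simp add: mat_distribs mat_assoc SW) (simp add: W_def mat_ring_simps)
  have YW: "YF * W = Y"
    unfolding YF_def Yeq by (simp add: mat_distribs mat_assoc SW XW)
  have QW: "QF * W = Ml * X - Nl * Y"
    unfolding QF_def by (simp add: mat_distribs mat_assoc XW YW)
  have "det (mev w QF) \<noteq> 0" if w: "cmod w \<le> 1" for w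
  proof -
    have r: "mreg w p p QF" "mreg w p p W" using right_factors_RHinf W w by (simp_all add: RHinf_iff)
    have "det (mev w (QF * W)) = det (mev w QF) * det (mev w W)"
      unfolding mreg_mult(2)[OF r] by (rule det_mult) (rule carrier_matI; simp)+
    then show ?thesis using nz[OF w] unfolding QW by auto
  qed
  then show ?thesis using stable_iff_QF by blast
qed

end

section \<open>Block matrices\<close>

lemma append_rows_mult:
  fixes A B D :: "'a::comm_ring_1 mat"
  assumes "dim_col A = dim_row D" "dim_col B = dim_row D"
  shows "(A @\<^sub>r B) * D = (A * D) @\<^sub>r (B * D)"
proof -
  let ?a = "dim_row A" and ?b = "dim_row B" and ?c = "dim_row D" and ?d = "dim_col D"
  have D: "D = four_block_mat D (0\<^sub>m ?c 0) (0\<^sub>m 0 ?d) (0\<^sub>m 0 0)" by (rule eq_matI) simp_all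
  have "(A @\<^sub>r B) * D = four_block_mat A (0\<^sub>m ?a 0) B (0\<^sub>m ?b 0) * four_block_mat D (0\<^sub>m ?c 0) (0\<^sub>m 0 ?d) (0\<^sub>m 0 0)"
    by (subst D) (simp only: append_rows_def)
  also have "\<dots> = four_block_mat (A * D + 0\<^sub>m ?a 0 * 0\<^sub>m 0 ?d) (A * 0\<^sub>m ?c 0 + 0\<^sub>m ?a 0 * 0\<^sub>m 0 0)
      (B * D + 0\<^sub>m ?b 0 * 0\<^sub>m 0 ?d) (B * 0\<^sub>m ?c 0 + 0\<^sub>m ?b 0 * 0\<^sub>m 0 0)"
    by (rule mult_four_block_mat[of _ ?a ?c _ 0 _ ?b _ _ ?d _ 0]) (rule carrier_matI; simp add: assms)+
  finally show ?thesis using assms by (simp add: append_rows_def mat_add_cancel)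
qed

lemma append_rows_mult_append_cols:
  fixes A B C D :: "'a::comm_ring_1 mat"
  assumes "dim_col A = dim_row C" "dim_col B = dim_row C" "dim_row D = dim_row C"
  shows "(A @\<^sub>r B) * append_cols C D = four_block_mat (A * C) (A * D) (B * C) (B * D)"
proof -
  let ?a = "dim_row A" and ?b = "dim_row B" and ?k = "dim_row C" and ?c = "dim_col C" and ?d = "dim_col D"
  have "(A @\<^sub>r B) * append_cols C D = four_block_mat (A * C + 0\<^sub>m ?a 0 * 0\<^sub>m 0 ?c) (A * D + 0\<^sub>m ?a 0 * 0\<^sub>m 0 ?d)
      (B * C + 0\<^sub>m ?b 0 * 0\<^sub>m 0 ?c) (B * D + 0\<^sub>m ?b 0 * 0\<^sub>m 0 ?d)"
    unfolding append_rows_def append_cols_def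
    by (rule mult_four_block_mat[of _ ?a ?k _ 0 _ ?b _ _ ?c _ ?d]) (rule carrier_matI; simp add: assms)+
  then show ?thesis using assms by (simp add: mat_add_cancel)
qed

lemma append_cols_mult_append_rows:
  fixes A B C D :: "'a::comm_ring_1 mat"
  assumes "dim_row B = dim_row A" "dim_col A = dim_row C" "dim_col B = dim_row D" "dim_col D = dim_col C"
  shows "append_cols A B * (C @\<^sub>r D) = A * C + B * D"
proof -
  let ?k = "dim_row A" and ?c = "dim_col C"
  have "append_cols A B * (C @\<^sub>r D) =
      four_block_mat (A * C + B * D) (A * 0\<^sub>m (dim_row C) 0 + B * 0\<^sub>m (dim_row D) 0)
        (0\<^sub>m 0 (dim_row C) * C + 0\<^sub>m 0 (dim_row D) * D)
        (0\<^sub>m 0 (dim_row C) * 0\<^sub>m (dim_row C) 0 + 0\<^sub>m 0 (dim_row D) * 0\<^sub>m (dim_row D) 0)"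
    unfolding append_rows_def append_cols_def assms(2-4)
    by (rule mult_four_block_mat[of _ ?k "dim_row C" _ "dim_row D" _ 0 _ _ ?c _ 0]) (rule carrier_matI; simp add: assms)+
  also have "\<dots> = A * C + B * D" using assms by (intro eq_matI) simp_all
  finally show ?thesis .
qed

lemma four_block_mult_append_rows:
  fixes A B C D S T :: "'a::comm_ring_1 mat"
  assumes "dim_row B = dim_row A" "dim_row D = dim_row C" "dim_col C = dim_col A" "dim_col D = dim_col B"
    "dim_row S = dim_col A" "dim_row T = dim_col B" "dim_col T = dim_col S"
  shows "four_block_mat A B C D * (S @\<^sub>r T) = (A * S + B * T) @\<^sub>r (C * S + D * T)"
proof -
  let ?a = "dim_row A" and ?b = "dim_row C" and ?c = "dim_col A" and ?d = "dim_col B" and ?k = "dim_col S"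
  have "four_block_mat A B C D * (S @\<^sub>r T) = four_block_mat (A * S + B * T) (A * 0\<^sub>m ?c 0 + B * 0\<^sub>m ?d 0)
      (C * S + D * T) (C * 0\<^sub>m ?c 0 + D * 0\<^sub>m ?d 0)"
    unfolding append_rows_def assms(5,6)
    by (rule mult_four_block_mat[of _ ?a ?c _ ?d _ ?b _ _ ?k _ 0]) (rule carrier_matI; simp add: assms)+
  then show ?thesis using assms by (simp add: append_rows_def mat_add_cancel)
qed

lemma append_rows_dims [simp]:
  "dim_row (A @\<^sub>r B) = dim_row A + dim_row B" "dim_col (A @\<^sub>r B) = dim_col A"
  by (simp_all add: append_rows_def)

lemma append_cols_dims [simp]:
  "dim_row (append_cols A B) = dim_row A" "dim_col (append_cols A B) = dim_col A + dim_col B"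
  by (simp_all add: append_cols_def)

lemma append_rows_add:
  fixes A B C D :: "'a::comm_ring_1 mat"
  assumes "dim_row A = dim_row C" "dim_row B = dim_row D" "dim_col A = dim_col C" "dim_col B = dim_col A" "dim_col D = dim_col C"
  shows "(A @\<^sub>r B) + (C @\<^sub>r D) = (A + C) @\<^sub>r (B + D)"
  using assms by (intro eq_matI) (auto simp: append_rows_def)

lemma append_rows_smult:
  fixes A B :: "'a::comm_ring_1 mat"
  assumes "dim_col B = dim_col A"
  shows "k \<cdot>\<^sub>m (A @\<^sub>r B) = (k \<cdot>\<^sub>m A) @\<^sub>r (k \<cdot>\<^sub>m B)"
  using assms by (intro eq_matI) (auto simp: append_rows_def)

lemma const_tf_append_rows: "dim_col B = dim_col A \<Longrightarrow> const_tf (A @\<^sub>r B) = const_tf A @\<^sub>r const_tf B"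
  by (intro eq_matI) (auto simp: append_rows_def const_tf_def)

lemma const_tf_append_cols: "dim_row B = dim_row A \<Longrightarrow> const_tf (append_cols A B) = append_cols (const_tf A) (const_tf B)"
  by (intro eq_matI) (auto simp: append_cols_def const_tf_def)

section \<open>The closed-loop map\<close>

locale approx_bezout = coprime_plant n m p Ap Bp Cp F H G Ul Vl Nl Ml Ur Vr Nr Mr
  for n m p Ap Bp Cp F H G Ul Vl Nl Ml Ur Vr Nr Mr +
  fixes X Y :: "tf mat" and \<epsilon> :: real
  assumes X: "X \<in> RHinf p p" and Y: "Y \<in> RHinf m p"
    and approx: "hinf_norm (Ml * X - Nl * Y - 1\<^sub>m p) < \<epsilon>" and \<epsilon>: "\<epsilon> < 1"
begin

lemmas XY_dims [simp] = carrier_matD[OF RHinf_carrier[OF X]] carrier_matD[OF RHinf_carrier[OF Y]]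
  carrier_matD[OF G_carrier]

definition "Q = Ml * X - Nl * Y"
definition "\<Delta> = Ml * X - Nl * Y - 1\<^sub>m p"

lemma Q_RHinf: "Q \<in> RHinf p p"
  unfolding Q_def by (rule RHinf_diff[OF RHinf_mult[OF factors_RHinf(4) X] RHinf_mult[OF factors_RHinf(3) Y]])

lemma \<Delta>_RHinf: "\<Delta> \<in> RHinf p p"
  unfolding \<Delta>_def Q_def[symmetric] by (rule RHinf_diff[OF Q_RHinf RHinf_one])

lemmas Q_dims [simp] = carrier_matD[OF RHinf_carrier[OF Q_RHinf]] carrier_matD[OF RHinf_carrier[OF \<Delta>_RHinf]]

lemma Q_eq: "Q = 1\<^sub>m p + \<Delta>"
  unfolding \<Delta>_def Q_def[symmetric] by (rule eq_matI) simp_all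

lemma \<epsilon>_pos: "\<epsilon> > 0"
  using approx hinf_norm_nonneg[OF \<Delta>_RHinf] unfolding \<Delta>_def by linarith

lemma mev_Q:
  assumes "cmod w \<le> 1"
  shows "mev w Q = 1\<^sub>m p + mev w \<Delta>"
proof -
  have "mreg w p p \<Delta>" using \<Delta>_RHinf assms by (simp add: RHinf_iff)
  from mreg_add(2)[OF mreg_one(1) this] show ?thesis unfolding Q_eq mreg_one(2) .
qed

lemma Q_nonsingular: "cmod w \<le> 1 \<Longrightarrow> det (mev w Q) \<noteq> 0"
  unfolding mev_Q using approx \<epsilon> by (intro small_gain[OF \<Delta>_RHinf]) (auto simp: \<Delta>_def)

lemma Q_inverse: "minv Q \<in> RHinf p p" "Q * minv Q = 1\<^sub>m p" "minv Q * Q = 1\<^sub>m p"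
  using RHinf_minv[OF Q_RHinf Q_nonsingular] by simp_all

lemmas Q_inverse_dims [simp] = carrier_matD[OF RHinf_carrier[OF Q_inverse(1)]]

text \<open>Since \<open>N\<^sub>l\<close> vanishes at infinity, \<open>Q\<close> equals \<open>M\<^sub>l X\<close> there.\<close>

lemma X_nonsingular_at_infinity: "det (mev 0 X) \<noteq> 0"
proof -
  have r: "mreg 0 p p Ml" "mreg 0 p m Nl" "mreg 0 p p X" "mreg 0 m p Y"
    using factors_RHinf X Y by (simp_all add: RHinf_iff)
  have "mev 0 Q = mev 0 Ml * mev 0 X - 0\<^sub>m p m * mev 0 Y"
    unfolding Q_def mreg_diff(2)[OF mreg_mult(1)[OF r(1,3)] mreg_mult(1)[OF r(2,4)]]
      mreg_mult(2)[OF r(1,3)] mreg_mult(2)[OF r(2,4)] Nl_strictly_proper ..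
  also have "\<dots> = mev 0 Ml * mev 0 X" by (rule eq_matI) simp_all
  finally have "det (mev 0 Q) = det (mev 0 Ml) * det (mev 0 X)"
    using det_mult[of "mev 0 Ml" p "mev 0 X"] carrier_matI[of "mev 0 Ml" p p] carrier_matI[of "mev 0 X" p p] by simp
  then show ?thesis using Q_nonsingular[of 0] by auto
qed

lemma X_inverse: "invertible_mat X" "minv X \<in> carrier_mat p p" "X * minv X = 1\<^sub>m p" "minv X * X = 1\<^sub>m p"
proof -
  have "mreg 0 p p X" using X by (simp add: RHinf_iff)
  from mreg_minv[OF this X_nonsingular_at_infinity]
  show "invertible_mat X" "minv X \<in> carrier_mat p p" "X * minv X = 1\<^sub>m p" "minv X * X = 1\<^sub>m p"
    by (auto simp: mreg_def)
qed

lemmas X_inverse_dims [simp] = carrier_matD[OF X_inverse(2)]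

definition "K = Y * minv X"

lemma K_dims [simp]: "dim_row K = m" "dim_col K = p"
  by (simp_all add: K_def)

lemma K_mult_X: "K * X = Y"
  unfolding K_def by (simp add: mat_assoc X_inverse(4))

definition "L = four_block_mat (1\<^sub>m p) (- G) (- K) (1\<^sub>m m)"

text \<open>The approximate response of the theorem with \<open>Q\<^sup>-\<^sup>1\<close> inserted after \<open>X\<close> and \<open>Y\<close>. It is exact because
  \<open>X - G Y = M\<^sub>l\<^sup>-\<^sup>1 Q\<close>.\<close>

definition "Linv = four_block_mat (X * minv Q * Ml) (X * minv Q * Nl) (Y * minv Q * Ml) (1\<^sub>m m + Y * minv Q * Nl)"

lemma Ml_inverse: "minv Ml \<in> carrier_mat p p" "Ml * minv Ml = 1\<^sub>m p" "minv Ml * Ml = 1\<^sub>m p"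
  using invertible_matD[OF factors_carrier(4) G_factors(3)] by simp_all

lemmas Ml_inverse_dims [simp] = carrier_matD[OF Ml_inverse(1)]

lemma plant_loop: "X - G * Y = minv Ml * Q"
proof -
  have "minv Ml * Q = (minv Ml * Ml) * X - (minv Ml * Nl) * Y"
    unfolding Q_def by (simp add: mat_distribs mat_assoc)
  then show ?thesis unfolding Ml_inverse(3) G_factors(4)[symmetric] by simp
qed

lemma L_mult_Linv: "L * Linv = 1\<^sub>m (p + m)"
proof -
  let ?Z = "minv Q"
  have X1: "X * ?Z * T - G * (Y * ?Z * T) = minv Ml * T" if [simp]: "dim_row T = p" for T
  proof -
    have "X * ?Z * T - G * (Y * ?Z * T) = (X - G * Y) * (?Z * T)" by (simp add: mat_distribs mat_assoc)
    also have "\<dots> = minv Ml * ((Q * ?Z) * T)" unfolding plant_loop by (simp add: mat_assoc)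
    finally show ?thesis unfolding Q_inverse(2) by simp
  qed
  have K1: "K * (X * ?Z * T) = Y * ?Z * T" if [simp]: "dim_row T = p" for T
  proof -
    have "K * (X * ?Z * T) = (K * X) * (?Z * T)" by (simp add: mat_assoc)
    then show ?thesis unfolding K_mult_X by (simp add: mat_assoc)
  qed
  have "L * Linv = four_block_mat (1\<^sub>m p * (X * ?Z * Ml) + - G * (Y * ?Z * Ml)) (1\<^sub>m p * (X * ?Z * Nl) + - G * (1\<^sub>m m + Y * ?Z * Nl))
    (- K * (X * ?Z * Ml) + 1\<^sub>m m * (Y * ?Z * Ml)) (- K * (X * ?Z * Nl) + 1\<^sub>m m * (1\<^sub>m m + Y * ?Z * Nl))"
    unfolding L_def Linv_def
    by (rule mult_four_block_mat[of _ p p _ m _ m _ _ p _ m]) (rule carrier_matI; simp)+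
  moreover have "1\<^sub>m p * (X * ?Z * Ml) + - G * (Y * ?Z * Ml) = 1\<^sub>m p"
    using X1[of Ml] by (simp add: Ml_inverse(3) mat_minus_uminus)
  moreover have "1\<^sub>m p * (X * ?Z * Nl) + - G * (1\<^sub>m m + Y * ?Z * Nl) = 0\<^sub>m p m"
  proof -
    have "1\<^sub>m p * (X * ?Z * Nl) + - G * (1\<^sub>m m + Y * ?Z * Nl) = (X * ?Z * Nl - G * (Y * ?Z * Nl)) - G"
      by (simp add: mat_ring_simps)
    also have "\<dots> = G - G" using X1[of Nl] by (simp add: G_factors(4)[symmetric])
    also have "\<dots> = 0\<^sub>m p m" by (rule eq_matI) simp_all
    finally show ?thesis .
  qed
  moreover have "- K * (X * ?Z * Ml) + 1\<^sub>m m * (Y * ?Z * Ml) = 0\<^sub>m m p"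
    using K1[of Ml] by (simp add: mat_add_cancel)
  moreover have "- K * (X * ?Z * Nl) + 1\<^sub>m m * (1\<^sub>m m + Y * ?Z * Nl) = 1\<^sub>m m"
    using K1[of Nl] by (simp add: mat_ring_simps)
  ultimately show ?thesis by simp
qed

lemma L_inverse: "minv L = Linv" "invertible_mat L"
proof -
  have "L \<in> carrier_mat (p + m) (p + m)" "Linv \<in> carrier_mat (p + m) (p + m)"
    unfolding L_def Linv_def by (rule carrier_matI; simp)+
  from minv_eqI[OF this L_mult_Linv] show "minv L = Linv" "invertible_mat L" by simp_all
qed

definition "E = minv L - four_block_mat (X * Ml) (X * Nl) (Y * Ml) (1\<^sub>m m + Y * Nl)"

lemma E_eq: "E = (X @\<^sub>r Y) * (minv Q - 1\<^sub>m p) * append_cols Ml Nl"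
proof -
  let ?D = "minv Q - 1\<^sub>m p"
  have e: "T * minv Q * S - T * S = T * ?D * S" if "dim_col T = p" "dim_row S = p" for T S :: "tf mat"
    using that by (simp add: mat_ring_simps)
  have "E = four_block_mat (X * ?D * Ml) (X * ?D * Nl) (Y * ?D * Ml) (Y * ?D * Nl)"
    unfolding E_def L_inverse(1) Linv_def
    by (rule eq_matI) (auto simp: e[symmetric])
  also have "\<dots> = ((X * ?D) @\<^sub>r (Y * ?D)) * append_cols Ml Nl"
    by (rule append_rows_mult_append_cols[symmetric]) simp_all
  also have "(X * ?D) @\<^sub>r (Y * ?D) = (X @\<^sub>r Y) * ?D"
    by (rule append_rows_mult[symmetric]) simp_all
  finally show ?thesis .
qed

lemma outer_RHinf: "X @\<^sub>r Y \<in> RHinf (p + m) p" "append_cols Ml Nl \<in> RHinf p (p + m)"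
  using X Y factors_RHinf by (auto simp: RHinf_iff intro: mreg_append_rows mreg_append_cols)

lemma E_RHinf: "E \<in> RHinf (p + m) (p + m)"
  unfolding E_eq by (rule RHinf_mult[OF RHinf_mult[OF outer_RHinf(1) RHinf_diff[OF Q_inverse(1) RHinf_one]] outer_RHinf(2)])

text \<open>For \<open>u = Q\<^sup>-\<^sup>1 v\<close> one has \<open>v = u + \<Delta> u\<close>. Hence \<open>(Q\<^sup>-\<^sup>1 - I) v = - \<Delta> u\<close>, while
  \<open>|u| \<le> |v| + \<epsilon> |u|\<close> bounds \<open>|u|\<close> by \<open>|v| / (1 - \<epsilon>)\<close>.\<close>

lemma inverse_gap:
  assumes w: "cmod w = 1" and v: "v \<in> carrier_vec p"
  shows "vnorm (mev w (minv Q - 1\<^sub>m p) *\<^sub>v v) \<le> \<epsilon> / (1 - \<epsilon>) * vnorm v"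
proof -
  have r: "mreg w p p Q" "mreg w p p (minv Q)" "mreg w p p \<Delta>" using Q_RHinf Q_inverse(1) \<Delta>_RHinf w by (simp_all add: RHinf_iff)
  have [simp]: "dim_vec v = p" using v by simp
  define u where "u = mev w (minv Q) *\<^sub>v v"
  have [simp]: "dim_vec u = p" by (simp add: u_def)
  have uc: "u \<in> carrier_vec p" by (rule carrier_vecI) simp
  define d where "d = mev w \<Delta> *\<^sub>v u"
  have [simp]: "dim_vec d = p" by (simp add: d_def)
  have dc: "d \<in> carrier_vec p" by (rule carrier_vecI) simp
  have "mev w Q * mev w (minv Q) = 1\<^sub>m p"
    unfolding mreg_mult(2)[OF r(1,2), symmetric] Q_inverse(2) mreg_one(2) ..
  then have "mev w Q *\<^sub>v u = v"
    unfolding u_def using mat_vec_assoc[of "mev w Q" "mev w (minv Q)" v] v by simp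
  then have vu: "v = u + d"
    unfolding d_def using w by (simp add: mev_Q mat_vec_simps)
  have db: "vnorm d \<le> \<epsilon> * vnorm u"
  proof -
    have "vnorm d \<le> hinf_norm \<Delta> * vnorm u" unfolding d_def by (rule hinf_norm_bound[OF \<Delta>_RHinf w uc])
    also have "\<dots> \<le> \<epsilon> * vnorm u" using approx by (intro mult_right_mono) (simp_all add: \<Delta>_def)
    finally show ?thesis .
  qed
  have "u = v + - d" unfolding vu by (rule eq_vecI) simp_all
  then have "vnorm u \<le> vnorm v + vnorm d"
    using vnorm_triangle[OF v, of "- d"] dc by (simp add: vnorm_uminus)
  then have "(1 - \<epsilon>) * vnorm u \<le> vnorm v" using db by (simp add: algebra_simps)
  then have "vnorm u \<le> vnorm v / (1 - \<epsilon>)" using \<epsilon> by (simp add: field_simps)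
  then have "\<epsilon> * vnorm u \<le> \<epsilon> * (vnorm v / (1 - \<epsilon>))" using \<epsilon>_pos by (intro mult_left_mono) simp_all
  moreover have "mev w (minv Q - 1\<^sub>m p) *\<^sub>v v = - d"
  proof -
    have "mev w (minv Q - 1\<^sub>m p) *\<^sub>v v = u - v"
      unfolding mreg_diff(2)[OF r(2) mreg_one(1)] mreg_one(2) u_def by (simp add: mat_vec_simps)
    also have "\<dots> = - d" unfolding vu by (rule eq_vecI) simp_all
    finally show ?thesis .
  qed
  ultimately show ?thesis using db by (simp add: vnorm_uminus)
qed

lemma E_bound: "hinf_norm E \<le> \<epsilon> / (1 - \<epsilon>) * hinf_norm (X @\<^sub>r Y) * hinf_norm (append_cols Ml Nl)"
proof (rule hinf_norm_le[OF RHinf_carrier[OF E_RHinf]])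
  let ?a = "hinf_norm (X @\<^sub>r Y)" and ?b = "hinf_norm (append_cols Ml Nl)" and ?g = "\<epsilon> / (1 - \<epsilon>)"
  have a: "?a \<ge> 0" and b: "?b \<ge> 0" by (rule hinf_norm_nonneg[OF outer_RHinf(1)], rule hinf_norm_nonneg[OF outer_RHinf(2)])
  have g: "?g \<ge> 0" using \<epsilon> \<epsilon>_pos by simp
  show "?g * ?a * ?b \<ge> 0" by (intro mult_nonneg_nonneg a b g)
  fix w :: complex and v :: "complex vec" assume w: "cmod w = 1" and v: "v \<in> carrier_vec (p + m)"
  let ?D = "minv Q - 1\<^sub>m p"
  have D: "?D \<in> RHinf p p" by (rule RHinf_diff[OF Q_inverse(1) RHinf_one])
  have r: "mreg w (p + m) p (X @\<^sub>r Y)" "mreg w p p ?D" "mreg w p (p + m) (append_cols Ml Nl)"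
    using outer_RHinf D w by (simp_all add: RHinf_iff)
  note c = r[THEN mreg_carrier]
  define v1 where "v1 = mev w (append_cols Ml Nl) *\<^sub>v v"
  define v2 where "v2 = mev w ?D *\<^sub>v v1"
  have v1: "v1 \<in> carrier_vec p" unfolding v1_def by (rule mult_mat_vec_carrier[OF _ v]) (use c in simp)
  have v2: "v2 \<in> carrier_vec p" unfolding v2_def by (rule mult_mat_vec_carrier[OF _ v1]) (use c in simp)
  have "mev w E *\<^sub>v v = mev w (X @\<^sub>r Y) *\<^sub>v v2"
    unfolding E_eq mreg_mult(2)[OF mreg_mult(1)[OF r(1,2)] r(3)] mreg_mult(2)[OF r(1,2)] v2_def v1_def
    using carrier_matD[OF c(1)] carrier_matD[OF c(2)] carrier_matD[OF c(3)] carrier_vecD[OF v] by (simp add: mat_vec_assoc)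
  then have "vnorm (mev w E *\<^sub>v v) \<le> ?a * vnorm v2" using hinf_norm_bound[OF outer_RHinf(1) w v2] by simp
  also have "\<dots> \<le> ?a * (?g * vnorm v1)" using inverse_gap[OF w v1] a unfolding v2_def by (rule mult_left_mono)
  also have "\<dots> \<le> ?a * (?g * (?b * vnorm v))"
    using hinf_norm_bound[OF outer_RHinf(2) w v] a g unfolding v1_def by (intro mult_left_mono)
  finally show "vnorm (mev w E *\<^sub>v v) \<le> ?g * ?a * ?b * vnorm v" by (simp add: mult_ac)
qed

end

section \<open>Realizations of stable transfer matrices\<close>

definition stably_realizable :: "nat \<Rightarrow> nat \<Rightarrow> tf mat \<Rightarrow> bool" where
  "stably_realizable k l T \<longleftrightarrow> (\<exists>q A B C D. A \<in> carrier_mat q q \<and> B \<in> carrier_mat q l \<and>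
     C \<in> carrier_mat k q \<and> D \<in> carrier_mat k l \<and> schur_stable A \<and> T = transfer_matrix A B C D)"

lemma to_fract_power: "to_fract (a ^ k) = to_fract a ^ k"
  by (induction k) simp_all

lemma to_fract_poly:
  assumes "degree a \<le> N"
  shows "to_fract a = (\<Sum>k\<le>N. to_fract [:coeff a k:] * tf_z ^ k)"
proof -
  have "to_fract a = to_fract (\<Sum>k\<le>N. monom (coeff a k) k)"
    using poly_as_sum_of_monoms'[OF assms] by simp
  also have "\<dots> = (\<Sum>k\<le>N. to_fract (monom (coeff a k) k))" by simp
  also have "\<dots> = (\<Sum>k\<le>N. to_fract [:coeff a k:] * tf_z ^ k)"
  proof (rule sum.cong[OF refl])
    fix k
    have "monom (coeff a k) k = [:coeff a k:] * [:0, 1:] ^ k" by (simp add: monom_altdef)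
    then show "to_fract (monom (coeff a k) k) = to_fract [:coeff a k:] * tf_z ^ k"
      by (simp only: to_fract_mult to_fract_power tf_z_def)
  qed
  finally show ?thesis .
qed

lemma transfer_matrix_eqI:
  assumes "A \<in> carrier_mat n n" "B \<in> carrier_mat n l" "C \<in> carrier_mat k n" "D \<in> carrier_mat k l"
    and "S \<in> carrier_mat n l" and "tf_z \<cdot>\<^sub>m S = const_tf A * S + const_tf B"
  shows "transfer_matrix A B C D = const_tf C * S + const_tf D"
proof -
  have "transfer_matrix A B C D * 1\<^sub>m l = const_tf C * S + const_tf D * 1\<^sub>m l"
    by (rule transfer_matrix_mult[OF assms(1-5)]) (use assms in simp_all)
  then show ?thesis using assms(2,4) transfer_matrix_carrier[OF assms(1-4)] by simp
qed

text \<open>Companion form: with denominator \<open>b\<close> of degree \<open>d\<close> the states are \<open>z\<^sup>h / b\<close> for \<open>h < d\<close>. An eigenvector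
  for \<open>\<lambda>\<close> is a multiple of \<open>(1, \<lambda>, \<dots>, \<lambda>\<^sup>d\<^sup>-\<^sup>1)\<close> and its last row says \<open>b(\<lambda>) = 0\<close>, so every eigenvalue is
  a pole.\<close>

lemma single_entry_stably_realizable:
  assumes r: "\<And>w. cmod w \<le> 1 \<Longrightarrow> reg w r" and i: "i < k" and j: "j < l"
  shows "stably_realizable k l (mat k l (\<lambda>(a, b). if a = i \<and> b = j then r else 0))"
proof -
  define a where "a = tf_num r"
  define b where "b = tf_den r"
  define d where "d = degree b"
  define \<beta> where "\<beta> = lead_coeff b"
  \<comment> \<open>the feedthrough: subtracting \<open>c\<close> leaves a numerator of degree below \<open>d\<close>\<close>
  define c where "c = coeff a d / \<beta>"
  have stable: "tf_proper r" "\<And>z. tf_pole r z \<Longrightarrow> cmod z < 1" using r stable_iff_reg[of r] by blast+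
  have b0: "b \<noteq> 0" unfolding b_def by (rule tf_den_nonzero)
  then have \<beta>: "\<beta> \<noteq> 0" by (simp add: \<beta>_def)
  have \<beta>d: "coeff b d = \<beta>" by (simp add: \<beta>_def d_def)
  have da: "degree a \<le> d" using stable(1) by (simp add: tf_proper_def a_def b_def d_def)
  have fb0: "to_fract b \<noteq> 0" using b0 by simp
  have rab: "r = to_fract a / to_fract b"
    unfolding a_def b_def by (subst (1) tf_num_den[of r]) (rule Fract_conv_to_fract)
  define A where "A = mat d d (\<lambda>(h, h'). if Suc h < d then if h' = Suc h then 1 else 0 else - coeff b h' / \<beta>)"
  define B where "B = mat d l (\<lambda>(h, h'). if Suc h = d \<and> h' = j then 1 / \<beta> else 0)"
  define C where "C = mat k d (\<lambda>(h, h'). if h = i then coeff a h' - c * coeff b h' else 0)"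
  define D where "D = mat k l (\<lambda>(h, h'). if h = i \<and> h' = j then c else 0)"
  define S where "S = mat d l (\<lambda>(h, h'). if h' = j then tf_z ^ h / to_fract b else 0)"
  have car: "A \<in> carrier_mat d d" "B \<in> carrier_mat d l" "C \<in> carrier_mat k d" "D \<in> carrier_mat k l" "S \<in> carrier_mat d l"
    by (simp_all add: A_def B_def C_def D_def S_def)
  have split: "(\<Sum>h\<le>d. f h) = (\<Sum>h<d. f h) + f d" for f :: "nat \<Rightarrow> 'x::comm_monoid_add"
    by (simp add: lessThan_Suc_atMost[symmetric])
  have bz: "to_fract b = (\<Sum>h<d. to_fract [:coeff b h:] * tf_z ^ h) + to_fract [:\<beta>:] * tf_z ^ d"
    using to_fract_poly[of b d, unfolded split \<beta>d] by (simp add: d_def)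
  have az: "to_fract a = (\<Sum>h<d. to_fract [:coeff a h:] * tf_z ^ h) + to_fract [:c:] * (to_fract [:\<beta>:] * tf_z ^ d)"
    unfolding to_fract_poly[OF da, unfolded split] using \<beta> by (simp add: c_def mult.assoc[symmetric] to_fract_const_mult[symmetric] del: to_fract_mult)
  have \<beta>f: "to_fract [:\<beta>:] \<noteq> 0" using \<beta> by simp
  have inv\<beta>: "to_fract [:1 / \<beta>:] = 1 / to_fract [:\<beta>:]"
  proof -
    have "to_fract [:1 / \<beta>:] * to_fract [:\<beta>:] = 1"
      using \<beta> by (simp add: to_fract_const_mult[symmetric] one_pCons[symmetric] del: to_fract_mult)
    then show ?thesis using \<beta>f by (simp add: field_simps)
  qed
  have st: "schur_stable A"
  proof (rule schur_stableI[OF car(1)])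
    fix z v assume z: "cmod z \<ge> 1" and v: "v \<in> carrier_vec d" and e: "cmat A *\<^sub>v v = z \<cdot>\<^sub>v v"
    have cA: "cmat A \<in> carrier_mat d d" using car(1) by simp
    have comp: "z * v $ h = (\<Sum>h'<d. complex_of_real (A $$ (h, h')) * v $ h')" if h: "h < d" for h
    proof -
      have "(z \<cdot>\<^sub>v v) $ h = (\<Sum>h'<d. cmat A $$ (h, h') * v $ h')"
        unfolding e[symmetric] by (rule index_mat_mult_vec[OF cA v h])
      then show ?thesis using v h car(1) by simp
    qed
    have step: "v $ Suc h = z * v $ h" if h: "Suc h < d" for h
    proof -
      have "z * v $ h = (\<Sum>h'<d. (if h' = Suc h then v $ h' else 0))"
        unfolding comp[OF Suc_lessD[OF h]] using h by (intro sum.cong) (auto simp: A_def)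
      then show ?thesis using h by simp
    qed
    have pw: "v $ h = z ^ h * v $ 0" if "h < d" for h
      using that by (induction h) (simp_all add: step)
    show "v = 0\<^sub>v d"
    proof (cases "d = 0")
      case True
      then show ?thesis using v by auto
    next
      case False
      then have d1: "d - 1 < d" "Suc (d - 1) = d" by simp_all
      have "z * v $ (d - 1) = (\<Sum>h<d. - (complex_of_real (coeff b h) / \<beta>) * (z ^ h * v $ 0))"
        unfolding comp[OF d1(1)]
      proof (rule sum.cong[OF refl])
        fix h assume "h \<in> {..<d}"
        then have h: "h < d" by simp
        show "complex_of_real (A $$ (d - 1, h)) * v $ h = - (complex_of_real (coeff b h) / \<beta>) * (z ^ h * v $ 0)"
          unfolding pw[OF h] using h by (simp add: A_def)
      qed
      moreover have "z * v $ (d - 1) = z ^ d * v $ 0"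
      proof -
        have "z ^ d = z * z ^ (d - 1)" by (subst (1) d1(2)[symmetric]) (rule power_Suc)
        then show ?thesis using pw[OF d1(1)] by (simp add: mult.assoc)
      qed
      ultimately have q: "z ^ d * v $ 0 = (\<Sum>h<d. - (complex_of_real (coeff b h) / \<beta>) * (z ^ h * v $ 0))"
        by simp
      have "\<beta> * (z ^ d * v $ 0) = (\<Sum>h<d. \<beta> * (- (complex_of_real (coeff b h) / \<beta>) * (z ^ h * v $ 0)))"
        unfolding q by (rule sum_distrib_left)
      also have "\<dots> = - (\<Sum>h<d. complex_of_real (coeff b h) * z ^ h) * v $ 0"
        using \<beta> by (simp add: sum_distrib_left sum_distrib_right sum_negf mult_ac)
      finally have "((\<Sum>h<d. complex_of_real (coeff b h) * z ^ h) + \<beta> * z ^ d) * v $ 0 = 0"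
        by (simp add: distrib_right mult.assoc)
      moreover have "poly (map_poly complex_of_real b) z = (\<Sum>h<d. complex_of_real (coeff b h) * z ^ h) + \<beta> * z ^ d"
        by (simp add: poly_altdef degree_map_poly coeff_map_poly split d_def[symmetric] \<beta>d)
      moreover have "poly (map_poly complex_of_real b) z \<noteq> 0"
        using stable(2)[of z] z by (auto simp: tf_pole_def b_def)
      ultimately have "v $ 0 = 0" by auto
      then have "v $ h = 0" if "h < d" for h using pw[OF that] by simp
      then show ?thesis using v by (intro eq_vecI) auto
    qed
  qed
  have "tf_z \<cdot>\<^sub>m S = const_tf A * S + const_tf B"
  proof (rule eq_matI)
    fix h h' assume hh: "h < dim_row (const_tf A * S + const_tf B)" "h' < dim_col (const_tf A * S + const_tf B)"
    then have h: "h < d" and h': "h' < l" using car by simp_all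
    have rhs: "(const_tf A * S + const_tf B) $$ (h, h') = (\<Sum>g<d. to_fract [:A $$ (h, g):] * S $$ (g, h')) + to_fract [:B $$ (h, h'):]"
      using h h' car by (simp add: scalar_prod_def const_tf_def lessThan_atLeast0)
    show "(tf_z \<cdot>\<^sub>m S) $$ (h, h') = (const_tf A * S + const_tf B) $$ (h, h')"
    proof (cases "h' = j")
      case False
      then have "S $$ (g, h') = 0" if "g < d" for g using that h' by (simp add: S_def)
      then show ?thesis unfolding rhs using False h h' car by (simp add: B_def)
    next
      case True
      have Sg: "S $$ (g, h') = tf_z ^ g / to_fract b" if "g < d" for g using that h' True by (simp add: S_def)
      show ?thesis
      proof (cases "Suc h < d")
        case True
        have "(\<Sum>g<d. to_fract [:A $$ (h, g):] * S $$ (g, h')) = (\<Sum>g<d. if g = Suc h then S $$ (g, h') else 0)"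
          using True h by (intro sum.cong) (auto simp: A_def one_pCons[symmetric])
        also have "\<dots> = tf_z ^ Suc h / to_fract b" using True by (simp add: Sg)
        finally show ?thesis unfolding rhs using True h h' car by (simp add: B_def Sg)
      next
        case False
        then have hd: "Suc h = d" using h by simp
        have "(\<Sum>g<d. to_fract [:A $$ (h, g):] * S $$ (g, h')) = (\<Sum>g<d. - (to_fract [:1 / \<beta>:] / to_fract b) * (to_fract [:coeff b g:] * tf_z ^ g))"
        proof (rule sum.cong[OF refl])
          fix g assume "g \<in> {..<d}"
          then have g: "g < d" by simp
          have "to_fract [:A $$ (h, g):] = - (to_fract [:1 / \<beta>:] * to_fract [:coeff b g:])"
            using g h False by (simp add: A_def to_fract_const_mult[symmetric] to_fract_uminus[symmetric] del: to_fract_mult to_fract_uminus)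
          then show "to_fract [:A $$ (h, g):] * S $$ (g, h') = - (to_fract [:1 / \<beta>:] / to_fract b) * (to_fract [:coeff b g:] * tf_z ^ g)"
            by (simp add: Sg[OF g])
        qed
        also have "\<dots> = - (to_fract [:1 / \<beta>:] / to_fract b) * (to_fract b - to_fract [:\<beta>:] * tf_z ^ d)"
          unfolding sum_distrib_left[symmetric] using bz by simp
        also have "\<dots> = tf_z ^ d / to_fract b - to_fract [:1 / \<beta>:]"
          unfolding inv\<beta> using \<beta>f fb0 by (simp add: field_simps)
        finally have "(const_tf A * S + const_tf B) $$ (h, h') = tf_z ^ d / to_fract b"
          unfolding rhs using True h h' hd by (simp add: B_def)
        moreover have "tf_z * S $$ (h, h') = tf_z ^ d / to_fract b"
          unfolding Sg[OF h] hd[symmetric] by simp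
        ultimately show ?thesis using h h' car by simp
      qed
    qed
  qed (use car in simp_all)
  then have tm: "transfer_matrix A B C D = const_tf C * S + const_tf D" by (rule transfer_matrix_eqI[OF car])
  have "mat k l (\<lambda>(a, b). if a = i \<and> b = j then r else 0) = const_tf C * S + const_tf D"
  proof (rule eq_matI)
    fix h h' assume hh: "h < dim_row (const_tf C * S + const_tf D)" "h' < dim_col (const_tf C * S + const_tf D)"
    then have h: "h < k" and h': "h' < l" using car by simp_all
    have rhs: "(const_tf C * S + const_tf D) $$ (h, h') = (\<Sum>g<d. to_fract [:C $$ (h, g):] * S $$ (g, h')) + to_fract [:D $$ (h, h'):]"
      using h h' car by (simp add: scalar_prod_def const_tf_def lessThan_atLeast0)
    show "mat k l (\<lambda>(a, b). if a = i \<and> b = j then r else 0) $$ (h, h') = (const_tf C * S + const_tf D) $$ (h, h')"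
    proof (cases "h = i \<and> h' = j")
      case False
      have "(\<Sum>g<d. to_fract [:C $$ (h, g):] * S $$ (g, h')) = 0"
        using False h h' by (intro sum.neutral ballI) (auto simp: S_def C_def)
      then show ?thesis unfolding rhs using False h h' by (auto simp: D_def)
    next
      case True
      have "(\<Sum>g<d. to_fract [:C $$ (h, g):] * S $$ (g, h')) =
        (\<Sum>g<d. (to_fract [:coeff a g:] * tf_z ^ g) / to_fract b - to_fract [:c:] * ((to_fract [:coeff b g:] * tf_z ^ g) / to_fract b))"
      proof (rule sum.cong[OF refl])
        fix g assume "g \<in> {..<d}"
        then have g: "g < d" by simp
        have e: "to_fract [:coeff a g - c * coeff b g:] = to_fract [:coeff a g:] - to_fract [:c:] * to_fract [:coeff b g:]"
          by (simp add: to_fract_const_mult[symmetric] to_fract_diff[symmetric] del: to_fract_mult to_fract_diff)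
        show "to_fract [:C $$ (h, g):] * S $$ (g, h') = (to_fract [:coeff a g:] * tf_z ^ g) / to_fract b - to_fract [:c:] * ((to_fract [:coeff b g:] * tf_z ^ g) / to_fract b)"
        proof -
          have C: "C $$ (h, g) = coeff a g - c * coeff b g" and S: "S $$ (g, h') = tf_z ^ g / to_fract b"
            using g h h' True by (simp_all add: C_def S_def)
          show ?thesis unfolding C S e by (simp add: left_diff_distrib diff_divide_distrib mult.assoc)
        qed
      qed
      also have "\<dots> = (to_fract a - to_fract [:c:] * (to_fract [:\<beta>:] * tf_z ^ d)) / to_fract b - to_fract [:c:] * ((to_fract b - to_fract [:\<beta>:] * tf_z ^ d) / to_fract b)"
        unfolding sum_subtractf sum_distrib_left[symmetric] sum_divide_distrib[symmetric] using az bz by simp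
      also have "\<dots> = r - to_fract [:c:]"
        unfolding rab using fb0 by (simp add: field_simps)
      finally show ?thesis unfolding rhs using True h h' by (simp add: D_def)
    qed
  qed (use car in simp_all)
  then show ?thesis
    unfolding stably_realizable_def using car st tm by metis
qed

lemma stably_realizable_zero: "stably_realizable k l (0\<^sub>m k l)"
proof -
  have "transfer_matrix (0\<^sub>m 0 0) (0\<^sub>m 0 l) (0\<^sub>m k 0) (0\<^sub>m k l) = const_tf (0\<^sub>m k 0) * 0\<^sub>m 0 l + const_tf (0\<^sub>m k l)"
    by (rule transfer_matrix_eqI[of _ 0 _ l _ k]) (simp_all add: const_tf_zero mat_eq_iff)
  also have "\<dots> = 0\<^sub>m k l" by (simp add: const_tf_zero mat_add_cancel)
  finally have eq: "0\<^sub>m k l = transfer_matrix (0\<^sub>m 0 0) (0\<^sub>m 0 l) (0\<^sub>m k 0) (0\<^sub>m k l)" ..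
  have "schur_stable (0\<^sub>m 0 0)"
    by (rule schur_stableI[of _ 0]) (auto intro: eq_vecI)
  then show ?thesis unfolding stably_realizable_def using eq zero_carrier_mat by blast
qed

lemma schur_stable_block_upper:
  assumes A: "A \<in> carrier_mat n n" "schur_stable A" and B: "B \<in> carrier_mat n q"
    and D: "D \<in> carrier_mat q q" "schur_stable D"
  shows "schur_stable (four_block_mat A B (0\<^sub>m q n) D)"
proof (rule schur_stable_four_blockI[OF A(1) B zero_carrier_mat D(1)])
  fix l x y assume l: "cmod l \<ge> 1" and xy: "x \<in> carrier_vec n" "y \<in> carrier_vec q"
    and e: "cmat A *\<^sub>v x + cmat B *\<^sub>v y = l \<cdot>\<^sub>v x" "cmat (0\<^sub>m q n) *\<^sub>v x + cmat D *\<^sub>v y = l \<cdot>\<^sub>v y"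
  have "cmat D *\<^sub>v y = l \<cdot>\<^sub>v y"
    unfolding e(2)[symmetric] using xy D(1) by (intro eq_vecI) (auto simp: scalar_prod_def)
  then have y: "y = 0\<^sub>v q" by (rule schur_stable_kernel[OF D l xy(2)])
  have "cmat A *\<^sub>v x = l \<cdot>\<^sub>v x"
    unfolding e(1)[symmetric] y using xy A(1) B by (intro eq_vecI) (auto simp: scalar_prod_def)
  then show "x = 0\<^sub>v n \<and> y = 0\<^sub>v q" using schur_stable_kernel[OF A l xy(1)] y by simp
qed

lemma schur_stable_block_lower:
  assumes A: "A \<in> carrier_mat n n" "schur_stable A" and C: "C \<in> carrier_mat q n"
    and D: "D \<in> carrier_mat q q" "schur_stable D"
  shows "schur_stable (four_block_mat A (0\<^sub>m n q) C D)"
proof (rule schur_stable_four_blockI[OF A(1) zero_carrier_mat C D(1)])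
  fix l x y assume l: "cmod l \<ge> 1" and xy: "x \<in> carrier_vec n" "y \<in> carrier_vec q"
    and e: "cmat A *\<^sub>v x + cmat (0\<^sub>m n q) *\<^sub>v y = l \<cdot>\<^sub>v x" "cmat C *\<^sub>v x + cmat D *\<^sub>v y = l \<cdot>\<^sub>v y"
  have "cmat A *\<^sub>v x = l \<cdot>\<^sub>v x"
    unfolding e(1)[symmetric] using xy A(1) by (intro eq_vecI) (auto simp: scalar_prod_def)
  then have x: "x = 0\<^sub>v n" by (rule schur_stable_kernel[OF A l xy(1)])
  have "cmat D *\<^sub>v y = l \<cdot>\<^sub>v y"
    unfolding e(2)[symmetric] x using xy C D(1) by (intro eq_vecI) (auto simp: scalar_prod_def)
  then show "x = 0\<^sub>v n \<and> y = 0\<^sub>v q" using schur_stable_kernel[OF D l xy(2)] x by simp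
qed

lemma stably_realizable_add:
  assumes "stably_realizable k l T1" "stably_realizable k l T2"
  shows "stably_realizable k l (T1 + T2)"
proof -
  obtain q1 A1 B1 C1 D1 where c1: "A1 \<in> carrier_mat q1 q1" "B1 \<in> carrier_mat q1 l" "C1 \<in> carrier_mat k q1" "D1 \<in> carrier_mat k l"
    and s1: "schur_stable A1" and t1: "T1 = transfer_matrix A1 B1 C1 D1"
    using assms(1) unfolding stably_realizable_def by blast
  obtain q2 A2 B2 C2 D2 where c2: "A2 \<in> carrier_mat q2 q2" "B2 \<in> carrier_mat q2 l" "C2 \<in> carrier_mat k q2" "D2 \<in> carrier_mat k l"
    and s2: "schur_stable A2" and t2: "T2 = transfer_matrix A2 B2 C2 D2"
    using assms(2) unfolding stably_realizable_def by blast
  note [simp] = carrier_matD[OF c1(1)] carrier_matD[OF c1(2)] carrier_matD[OF c1(3)] carrier_matD[OF c1(4)]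
    carrier_matD[OF c2(1)] carrier_matD[OF c2(2)] carrier_matD[OF c2(3)] carrier_matD[OF c2(4)]
    carrier_matD[OF resolvent(1)[OF c1(1)]] carrier_matD[OF resolvent(1)[OF c2(1)]]
  define S1 where "S1 = resolvent A1 * const_tf B1"
  define S2 where "S2 = resolvent A2 * const_tf B2"
  have [simp]: "dim_row S1 = q1" "dim_col S1 = l" "dim_row S2 = q2" "dim_col S2 = l" by (simp_all add: S1_def S2_def)
  have z: "tf_z \<cdot>\<^sub>m S1 = const_tf A1 * S1 + const_tf B1" "tf_z \<cdot>\<^sub>m S2 = const_tf A2 * S2 + const_tf B2"
    unfolding S1_def S2_def
    using resolvent_state_equation[OF c1(1), of "const_tf B1" l] resolvent_state_equation[OF c2(1), of "const_tf B2" l] c1(2) c2(2)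
    by simp_all
  define A where "A = four_block_mat A1 (0\<^sub>m q1 q2) (0\<^sub>m q2 q1) A2"
  define B where "B = B1 @\<^sub>r B2"
  define C where "C = append_cols C1 C2"
  have car: "A \<in> carrier_mat (q1 + q2) (q1 + q2)" "B \<in> carrier_mat (q1 + q2) l" "C \<in> carrier_mat k (q1 + q2)" "D1 + D2 \<in> carrier_mat k l"
    unfolding A_def B_def C_def by (rule_tac [!] carrier_matI) simp_all
  have cA: "const_tf A = four_block_mat (const_tf A1) (0\<^sub>m q1 q2) (0\<^sub>m q2 q1) (const_tf A2)"
    unfolding A_def using const_tf_four_block[OF c1(1) zero_carrier_mat zero_carrier_mat c2(1)] by (simp add: const_tf_zero)
  have S: "S1 @\<^sub>r S2 \<in> carrier_mat (q1 + q2) l" by (rule carrier_matI) simp_all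
  have "tf_z \<cdot>\<^sub>m (S1 @\<^sub>r S2) = const_tf A * (S1 @\<^sub>r S2) + const_tf B"
    unfolding cA B_def
    by (simp add: append_rows_smult z const_tf_append_rows four_block_mult_append_rows append_rows_add mat_add_cancel)
  from transfer_matrix_eqI[OF car S this]
  have "transfer_matrix A B C (D1 + D2) = (const_tf C1 * S1 + const_tf C2 * S2) + (const_tf D1 + const_tf D2)"
    unfolding C_def by (simp add: const_tf_append_cols append_cols_mult_append_rows const_tf_add)
  also have "\<dots> = T1 + T2"
    unfolding t1 t2 transfer_matrix_resolvent S1_def S2_def by (simp add: mat_ring_simps)
  finally have eq: "T1 + T2 = transfer_matrix A B C (D1 + D2)" ..
  have "schur_stable A"
    unfolding A_def by (rule schur_stable_block_upper[OF c1(1) s1 zero_carrier_mat c2(1) s2])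
  then show ?thesis unfolding stably_realizable_def using car eq by blast
qed

text \<open>A matrix is the sum of its single-entry parts, and a sum is realized by parallel connection.\<close>

lemma RHinf_stably_realizable:
  assumes T: "T \<in> RHinf k l"
  shows "stably_realizable k l T"
proof -
  define f where "f P = mat k l (\<lambda>ab. if ab \<in> P then T $$ ab else 0)" for P
  have c: "T \<in> carrier_mat k l" by (rule RHinf_carrier[OF T])
  have "stably_realizable k l (f P)" if "finite P" "P \<subseteq> {..<k} \<times> {..<l}" for P
    using that
  proof (induction P)
    case empty
    have "f {} = 0\<^sub>m k l" by (rule eq_matI) (simp_all add: f_def)
    then show ?case using stably_realizable_zero by simp
  next
    case (insert ij P)
    obtain i j where ij: "ij = (i, j)" "i < k" "j < l" using insert.prems by (cases ij) auto
    have r: "reg w (T $$ (i, j))" if "cmod w \<le> 1" for w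
      using T that ij by (simp add: RHinf_iff mreg_def)
    have "f (insert ij P) = f P + mat k l (\<lambda>(a, b). if a = i \<and> b = j then T $$ (i, j) else 0)"
      using insert.hyps(2) unfolding f_def ij(1) by (intro eq_matI) auto
    then show ?case
      using stably_realizable_add[OF _ single_entry_stably_realizable[OF r ij(2,3)]] insert by simp
  qed
  then have "stably_realizable k l (f ({..<k} \<times> {..<l}))" by simp
  moreover have "f ({..<k} \<times> {..<l}) = T" using c by (intro eq_matI) (auto simp: f_def)
  ultimately show ?thesis by simp
qed

section \<open>An observer-based realization of the controller\<close>

context approx_bezout
begin

text \<open>The state \<open>S\<^sub>o\<close> of an observer of the plant whose input and output are taken to be \<open>Y\<close> and \<open>X\<close>, and its
  innovation.\<close>

definition "S\<^sub>o = resolvent (Ap + H * Cp) * (const_tf Bp * Y - const_tf H * X)"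
definition "inno = const_tf Cp * S\<^sub>o - X"

lemma observer_RHinf: "S\<^sub>o \<in> RHinf n p" "inno \<in> RHinf p p"
proof -
  show S: "S\<^sub>o \<in> RHinf n p"
    unfolding S\<^sub>o_def by (rule RHinf_mult[OF RHinf_resolvent[OF stable_dims(2) H(2)]
      RHinf_diff[OF RHinf_mult[OF RHinf_const[OF Bp] Y] RHinf_mult[OF RHinf_const[OF H(1)] X]]])
  show "inno \<in> RHinf p p"
    unfolding inno_def by (rule RHinf_diff[OF RHinf_mult[OF RHinf_const[OF Cp] S] X])
qed

lemmas observer_dims [simp] = carrier_matD[OF RHinf_carrier[OF observer_RHinf(1)]] carrier_matD[OF RHinf_carrier[OF observer_RHinf(2)]]
  carrier_matD[OF RHinf_carrier[OF obs_factor(1)]]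

lemma observer_state_equation:
  "tf_z \<cdot>\<^sub>m S\<^sub>o = const_tf Ap * S\<^sub>o + (const_tf Bp * Y + const_tf H * inno)"
  "pencil Ap * S\<^sub>o = const_tf Bp * Y + const_tf H * inno"
proof -
  have "tf_z \<cdot>\<^sub>m S\<^sub>o = const_tf (Ap + H * Cp) * S\<^sub>o + (const_tf Bp * Y - const_tf H * X)"
    unfolding S\<^sub>o_def by (rule resolvent_state_equation[OF stable_dims(2)]) (rule carrier_matI; simp)
  also have "\<dots> = const_tf Ap * S\<^sub>o + (const_tf Bp * Y + const_tf H * inno)"
    by (simp add: inno_def const_tf_add const_tf_mult mat_ring_simps)
  finally show z: "tf_z \<cdot>\<^sub>m S\<^sub>o = const_tf Ap * S\<^sub>o + (const_tf Bp * Y + const_tf H * inno)" .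
  show "pencil Ap * S\<^sub>o = const_tf Bp * Y + const_tf H * inno"
    unfolding pencil_mult[OF Ap RHinf_carrier[OF observer_RHinf(1)]] z by (rule eq_matI) simp_all
qed

text \<open>The observer equation is the plant equation with the additional input \<open>H e\<close>, where \<open>e\<close> is the
  innovation. Applying \<open>M\<^sub>l C (z I - A)\<^sup>-\<^sup>1\<close> to it gives \<open>M\<^sub>l (X + e) = N\<^sub>l Y + M\<^sub>l C (z I - A)\<^sup>-\<^sup>1 H e\<close>.
  So a stable multiple of \<open>e\<close> is \<open>Q\<close>, which is a unit.\<close>

lemma innovation_unit:
  obtains Z where "Z \<in> RHinf p p" "Z * inno = 1\<^sub>m p" "inno * Z = 1\<^sub>m p"
proof -
  \<comment> \<open>the stable multiplier that takes the innovation to \<open>Q\<close>\<close>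
  define W where "W = obs_factor * const_tf H - Ml"
  have W: "W \<in> RHinf p p"
    unfolding W_def by (rule RHinf_diff[OF RHinf_mult[OF obs_factor(1) RHinf_const[OF H(1)]] factors_RHinf(4)])
  note [simp] = carrier_matD[OF RHinf_carrier[OF W]]
  have "Ml * (const_tf Cp * S\<^sub>o) = (obs_factor * pencil Ap) * S\<^sub>o"
    unfolding obs_factor(3) by (simp add: mat_assoc)
  also have "\<dots> = obs_factor * (const_tf Bp * Y + const_tf H * inno)"
    unfolding observer_state_equation(2)[symmetric] by (simp add: mat_assoc)
  also have "\<dots> = (obs_factor * const_tf Bp) * Y + obs_factor * (const_tf H * inno)"
    by (simp add: mat_distribs mat_assoc)
  finally have 1: "Ml * (const_tf Cp * S\<^sub>o) = Nl * Y + obs_factor * (const_tf H * inno)"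
    unfolding obs_factor(2) .
  have "Ml * inno = Ml * (const_tf Cp * S\<^sub>o) - Ml * X"
    unfolding inno_def by (simp add: mat_distribs)
  then have 2: "Ml * inno = Nl * Y + obs_factor * (const_tf H * inno) - Ml * X"
    unfolding 1 .
  have "W * inno = obs_factor * (const_tf H * inno) - Ml * inno"
    unfolding W_def by (simp add: mat_distribs mat_assoc)
  also have "\<dots> = Q"
    unfolding 2 Q_def by (rule eq_matI) simp_all
  finally have WQ: "W * inno = Q" .
  define Z where "Z = minv Q * W"
  have Z: "Z \<in> RHinf p p" unfolding Z_def by (rule RHinf_mult[OF Q_inverse(1) W])
  have Zi: "Z * inno = 1\<^sub>m p"
    unfolding Z_def using Q_inverse(3) WQ by (simp add: mat_assoc)
  have "inno * Z = 1\<^sub>m p"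
    by (rule minv_eqI(3)[OF RHinf_carrier[OF Z] RHinf_carrier[OF observer_RHinf(2)] Zi])
  then show ?thesis using that Z Zi by blast
qed

text \<open>The stable parameter \<open>T = (Y - F S\<^sub>o) e\<^sup>-\<^sup>1\<close> makes \<open>u = F x + T e\<close> the control law that produces \<open>Y\<close> from
  \<open>X\<close>. Joining the observer with a stable realization of \<open>T\<close> realizes this law. Its stabilizing gain
  outputs \<open>y = C x\<close>, which switches the innovation off. Its detecting gain feeds \<open>- B u\<close> back into the
  observer, which cancels the control. Either gain leaves a block triangular matrix with stable
  diagonal blocks.\<close>

lemma controller_has_realization: "\<exists>q AK BK CK DK. controller_realization q m p AK BK CK DK K"
proof -
  obtain Z where Z: "Z \<in> RHinf p p" and Zi: "Z * inno = 1\<^sub>m p" by (rule innovation_unit)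
  define T where "T = (Y - const_tf F * S\<^sub>o) * Z"
  have T: "T \<in> RHinf m p"
    unfolding T_def by (rule RHinf_mult[OF RHinf_diff[OF Y RHinf_mult[OF RHinf_const[OF F(1)] observer_RHinf(1)]] Z])
  obtain q AQ BQ CQ DQ where c: "AQ \<in> carrier_mat q q" "BQ \<in> carrier_mat q p" "CQ \<in> carrier_mat m q" "DQ \<in> carrier_mat m p"
    and sQ: "schur_stable AQ" and TQ: "T = transfer_matrix AQ BQ CQ DQ"
    using RHinf_stably_realizable[OF T] unfolding stably_realizable_def by blast
  note [simp] = carrier_matD[OF c(1)] carrier_matD[OF c(2)] carrier_matD[OF c(3)] carrier_matD[OF c(4)]
    carrier_matD[OF RHinf_carrier[OF Z]] carrier_matD[OF resolvent(1)[OF c(1)]]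
  define S where "S = resolvent AQ * (const_tf BQ * inno)"
  have [simp]: "dim_row S = q" "dim_col S = p" by (simp_all add: S_def)
  have Sc: "S \<in> carrier_mat q p" by (rule carrier_matI) simp_all
  have zS: "tf_z \<cdot>\<^sub>m S = const_tf AQ * S + const_tf BQ * inno"
    unfolding S_def by (rule resolvent_state_equation[OF c(1)]) (rule carrier_matI; simp)
  have "T * inno = Y - const_tf F * S\<^sub>o"
    unfolding T_def using Zi by (simp add: mat_assoc)
  moreover have "T * inno = const_tf CQ * S + const_tf DQ * inno"
    unfolding TQ by (rule transfer_matrix_mult[OF c Sc RHinf_carrier[OF observer_RHinf(2)] zS])
  ultimately have "Y - const_tf F * S\<^sub>o = const_tf CQ * S + const_tf DQ * inno" by simp
  then have Yeq: "Y = const_tf F * S\<^sub>o + (const_tf CQ * S + const_tf DQ * inno)"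
    using mat_eq_diff_iff[of Y m p "const_tf F * S\<^sub>o" "const_tf CQ * S + const_tf DQ * inno"]
      carrier_matI[of Y m p] carrier_matI[of "const_tf F * S\<^sub>o" m p] carrier_matI[of "const_tf CQ * S + const_tf DQ * inno" m p]
    by simp
  define A11 where "A11 = Ap + Bp * F + H * Cp + Bp * DQ * Cp"
  define AK where "AK = four_block_mat A11 (Bp * CQ) (BQ * Cp) AQ"
  define BK where "BK = (- H - Bp * DQ) @\<^sub>r (- BQ)"
  define CK where "CK = append_cols (F + DQ * Cp) CQ"
  define DK where "DK = - DQ"
  have [simp]: "dim_row A11 = n" "dim_col A11 = n" by (simp_all add: A11_def)
  have A11: "A11 \<in> carrier_mat n n" and A12: "Bp * CQ \<in> carrier_mat n q" and A21: "BQ * Cp \<in> carrier_mat q n"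
    by (rule carrier_matI; simp)+
  have car: "AK \<in> carrier_mat (n + q) (n + q)" "BK \<in> carrier_mat (n + q) p" "CK \<in> carrier_mat m (n + q)" "DK \<in> carrier_mat m p"
    unfolding AK_def BK_def CK_def DK_def by (rule_tac [!] carrier_matI) simp_all
  have KX: "K * X = transfer_matrix AK BK CK DK * X"
  proof -
    have Sx: "S\<^sub>o @\<^sub>r S \<in> carrier_mat (n + q) p" by (rule carrier_matI) simp_all
    have cA: "const_tf AK = four_block_mat (const_tf A11) (const_tf (Bp * CQ)) (const_tf (BQ * Cp)) (const_tf AQ)"
      unfolding AK_def by (rule const_tf_four_block[OF A11 A12 A21 c(1)])
    have BY: "const_tf Bp * Y = const_tf Bp * (const_tf F * S\<^sub>o + (const_tf CQ * S + const_tf DQ * inno))"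
      by (rule arg_cong[OF Yeq])
    have top: "const_tf A11 * S\<^sub>o + const_tf (Bp * CQ) * S + const_tf (- H - Bp * DQ) * X
        = const_tf Ap * S\<^sub>o + (const_tf Bp * Y + const_tf H * inno)"
      unfolding BY unfolding inno_def A11_def
      by (simp add: const_tf_add const_tf_mult const_tf_uminus mat_ring_simps)
    have bot: "const_tf (BQ * Cp) * S\<^sub>o + const_tf AQ * S + const_tf (- BQ) * X = const_tf AQ * S + const_tf BQ * inno"
      unfolding inno_def by (simp add: const_tf_mult const_tf_uminus mat_ring_simps)
    have "const_tf AK * (S\<^sub>o @\<^sub>r S) + const_tf BK * X = (const_tf A11 * S\<^sub>o + const_tf (Bp * CQ) * S + const_tf (- H - Bp * DQ) * X)
        @\<^sub>r (const_tf (BQ * Cp) * S\<^sub>o + const_tf AQ * S + const_tf (- BQ) * X)"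
      unfolding cA BK_def by (simp add: const_tf_append_rows four_block_mult_append_rows append_rows_mult append_rows_add)
    also have "\<dots> = tf_z \<cdot>\<^sub>m (S\<^sub>o @\<^sub>r S)"
      unfolding top bot by (simp add: append_rows_smult observer_state_equation(1) zS)
    finally have "tf_z \<cdot>\<^sub>m (S\<^sub>o @\<^sub>r S) = const_tf AK * (S\<^sub>o @\<^sub>r S) + const_tf BK * X" ..
    from transfer_matrix_mult[OF car Sx RHinf_carrier[OF X] this]
    have "transfer_matrix AK BK CK DK * X = const_tf CK * (S\<^sub>o @\<^sub>r S) + const_tf DK * X" .
    also have "\<dots> = const_tf (F + DQ * Cp) * S\<^sub>o + const_tf CQ * S + const_tf (- DQ) * X"
      unfolding CK_def DK_def by (simp add: const_tf_append_cols append_cols_mult_append_rows)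
    also have "\<dots> = const_tf F * S\<^sub>o + (const_tf CQ * S + const_tf DQ * inno)"
      unfolding inno_def by (simp add: const_tf_add const_tf_mult const_tf_uminus mat_ring_simps)
    finally have t: "transfer_matrix AK BK CK DK * X = const_tf F * S\<^sub>o + (const_tf CQ * S + const_tf DQ * inno)" .
    show ?thesis unfolding K_mult_X t by (rule Yeq)
  qed
  have tc: "transfer_matrix AK BK CK DK \<in> carrier_mat m p" by (rule transfer_matrix_carrier[OF car])
  have "K = K * X * minv X" by (simp add: mat_assoc X_inverse(3))
  also have "\<dots> = transfer_matrix AK BK CK DK"
    unfolding KX using carrier_matD[OF tc] by (simp add: mat_assoc X_inverse(3))
  finally have Keq: "K = transfer_matrix AK BK CK DK" .
  have st: "stabilizable AK BK"
    unfolding stabilizable_def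
  proof (rule bexI)
    show "append_cols Cp (0\<^sub>m p q) \<in> carrier_mat (dim_col BK) (dim_row AK)"
      using car by (intro carrier_matI) simp_all
    have "BK * append_cols Cp (0\<^sub>m p q) = four_block_mat ((- H - Bp * DQ) * Cp) ((- H - Bp * DQ) * 0\<^sub>m p q) (- BQ * Cp) (- BQ * 0\<^sub>m p q)"
      unfolding BK_def by (rule append_rows_mult_append_cols) simp_all
    then have "AK + BK * append_cols Cp (0\<^sub>m p q) = four_block_mat (A11 + (- H - Bp * DQ) * Cp) (Bp * CQ + (- H - Bp * DQ) * 0\<^sub>m p q)
        (BQ * Cp + - BQ * Cp) (AQ + - BQ * 0\<^sub>m p q)"
      unfolding AK_def by (simp only:) (rule add_four_block_mat[of _ n n _ q _ q]; (rule carrier_matI; simp))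
    also have "A11 + (- H - Bp * DQ) * Cp = Ap + Bp * F" unfolding A11_def by (simp add: mat_ring_simps)
    also have "Bp * CQ + (- H - Bp * DQ) * 0\<^sub>m p q = Bp * CQ" by (simp add: mat_add_cancel)
    also have "BQ * Cp + - BQ * Cp = 0\<^sub>m q n" by (simp add: mat_add_cancel)
    also have "AQ + - BQ * 0\<^sub>m p q = AQ" by (rule eq_matI) simp_all
    finally have e: "AK + BK * append_cols Cp (0\<^sub>m p q) = four_block_mat (Ap + Bp * F) (Bp * CQ) (0\<^sub>m q n) AQ" .
    show "schur_stable (AK + BK * append_cols Cp (0\<^sub>m p q))"
      unfolding e by (rule schur_stable_block_upper[OF stable_dims(1) F(2) A12 c(1) sQ])
  qed
  have de: "detectable CK AK"
    unfolding detectable_def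
  proof (rule bexI)
    show "(- Bp) @\<^sub>r 0\<^sub>m q m \<in> carrier_mat (dim_row AK) (dim_row CK)"
      using car by (intro carrier_matI) simp_all
    have "((- Bp) @\<^sub>r 0\<^sub>m q m) * CK = four_block_mat (- Bp * (F + DQ * Cp)) (- Bp * CQ) (0\<^sub>m q m * (F + DQ * Cp)) (0\<^sub>m q m * CQ)"
      unfolding CK_def by (rule append_rows_mult_append_cols) simp_all
    then have "AK + ((- Bp) @\<^sub>r 0\<^sub>m q m) * CK = four_block_mat (A11 + - Bp * (F + DQ * Cp)) (Bp * CQ + - Bp * CQ)
        (BQ * Cp + 0\<^sub>m q m * (F + DQ * Cp)) (AQ + 0\<^sub>m q m * CQ)"
      unfolding AK_def by (simp only:) (rule add_four_block_mat[of _ n n _ q _ q]; (rule carrier_matI; simp))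
    also have "A11 + - Bp * (F + DQ * Cp) = Ap + H * Cp"
      unfolding A11_def by (simp add: mat_ring_simps) (rule eq_matI; simp)
    also have "Bp * CQ + - Bp * CQ = 0\<^sub>m n q" by (simp add: mat_add_cancel)
    also have "BQ * Cp + 0\<^sub>m q m * (F + DQ * Cp) = BQ * Cp" by (simp add: mat_add_cancel)
    also have "AQ + 0\<^sub>m q m * CQ = AQ" by (simp add: mat_add_cancel)
    finally have e: "AK + ((- Bp) @\<^sub>r 0\<^sub>m q m) * CK = four_block_mat (Ap + H * Cp) (0\<^sub>m n q) (BQ * Cp) AQ" .
    show "schur_stable (AK + ((- Bp) @\<^sub>r 0\<^sub>m q m) * CK)"
      unfolding e by (rule schur_stable_block_lower[OF stable_dims(2) H(2) A21 c(1) sQ])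
  qed
  show ?thesis
    unfolding controller_realization_def using car st de Keq by blast
qed

end

lemma vnorm_zero_mat_mult:
  assumes "v \<in> carrier_vec l"
  shows "vnorm (0\<^sub>m k l *\<^sub>v v) = 0"
proof -
  have "0\<^sub>m k l *\<^sub>v v = 0\<^sub>v k" using assms by (intro eq_vecI) (auto simp: scalar_prod_def)
  then show ?thesis by simp
qed

lemma controlled_plantI:
  assumes cp: "coprime_plant n m p Ap Bp Cp F H G Ul Vl Nl Ml Ur Vr Nr Mr"
    and cr: "controller_realization q m p AK BK CK DK K"
  obtains FK HK where "controlled_plant n m p Ap Bp Cp F H G Ul Vl Nl Ml Ur Vr Nr Mr q AK BK CK DK FK HK K"
proof -
  have c: "AK \<in> carrier_mat q q" "BK \<in> carrier_mat q p" "CK \<in> carrier_mat m q" "DK \<in> carrier_mat m p"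
    "stabilizable AK BK" "detectable CK AK" "K = transfer_matrix AK BK CK DK"
    using cr unfolding controller_realization_def by blast+
  obtain FK where FK: "FK \<in> carrier_mat p q" "schur_stable (AK + BK * FK)"
    using c(1,2,5) unfolding stabilizable_def by auto
  obtain HK where HK: "HK \<in> carrier_mat q m" "schur_stable (AK + HK * CK)"
    using c(1,3,6) unfolding detectable_def by auto
  show ?thesis
    by (rule that[of FK HK], intro controlled_plant.intro cp controlled_plant_axioms.intro c FK HK)
qed

theorem theorem2:
  fixes n m p :: nat
    and Ap Bp Cp :: "real mat"
    and G Ul Vl Nl Ml Ur Vr Nr Mr :: "tf mat"
  assumes "Ap \<in> carrier_mat n n" "Bp \<in> carrier_mat n m" "Cp \<in> carrier_mat p n"
    and "stabilizable Ap Bp" "detectable Cp Ap"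
    and "G = transfer_matrix Ap Bp Cp (0\<^sub>m p m)"
    and "doubly_coprime_factorization m p G Ul Vl Nl Ml Ur Vr Nr Mr"
  shows "(\<forall>K q AK BK CK DK. controller_realization q m p AK BK CK DK K \<longrightarrow>
           (internally_stabilizes Ap Bp Cp AK BK CK DK \<longleftrightarrow>
            (\<exists>X\<in>RHinf p p. \<exists>Y\<in>RHinf m p. \<exists>\<epsilon>::real.
               invertible_mat X \<and> K = Y * minv X \<and>
               hinf_norm (Ml * X - Nl * Y - 1\<^sub>m p) < \<epsilon> \<and> \<epsilon> < 1)))
       \<and>
         (\<forall>X\<in>RHinf p p. \<forall>Y\<in>RHinf m p. \<forall>\<epsilon>::real.
           hinf_norm (Ml * X - Nl * Y - 1\<^sub>m p) < \<epsilon> \<and> \<epsilon> < 1 \<longrightarrow>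
           (let K = Y * minv X;
                L = four_block_mat (1\<^sub>m p) (- G) (- K) (1\<^sub>m m);
                E = minv L - four_block_mat (X * Ml) (X * Nl) (Y * Ml) (1\<^sub>m m + Y * Nl)
            in invertible_mat X \<and>
               (\<exists>q AK BK CK DK. controller_realization q m p AK BK CK DK K) \<and>
               (\<forall>q AK BK CK DK. controller_realization q m p AK BK CK DK K \<longrightarrow>
                  internally_stabilizes Ap Bp Cp AK BK CK DK) \<and>
               invertible_mat L \<and> E \<in> RHinf (p + m) (p + m) \<and>
               hinf_norm E \<le> \<epsilon> / (1 - \<epsilon>) * hinf_norm (X @\<^sub>r Y) * hinf_norm (append_cols Ml Nl)))"
proof -
  obtain F where F: "F \<in> carrier_mat m n" "schur_stable (Ap + Bp * F)"
    using assms(1,2,4) unfolding stabilizable_def by auto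
  obtain H where H: "H \<in> carrier_mat n p" "schur_stable (Ap + H * Cp)"
    using assms(1,3,5) unfolding detectable_def by auto
  have cp: "coprime_plant n m p Ap Bp Cp F H G Ul Vl Nl Ml Ur Vr Nr Mr"
    by (rule coprime_plant.intro[OF assms(1-3) F H assms(6,7)])
  interpret coprime_plant n m p Ap Bp Cp F H G Ul Vl Nl Ml Ur Vr Nr Mr by (rule cp)
  have ab: "approx_bezout n m p Ap Bp Cp F H G Ul Vl Nl Ml Ur Vr Nr Mr X Y \<epsilon>"
    if "X \<in> RHinf p p" "Y \<in> RHinf m p" "hinf_norm (Ml * X - Nl * Y - 1\<^sub>m p) < \<epsilon>" "\<epsilon> < 1" for X Y \<epsilon>
    by (intro approx_bezout.intro cp approx_bezout_axioms.intro that)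
  have necessary: "\<exists>X\<in>RHinf p p. \<exists>Y\<in>RHinf m p. \<exists>\<epsilon>::real. invertible_mat X \<and> K = Y * minv X \<and>
      hinf_norm (Ml * X - Nl * Y - 1\<^sub>m p) < \<epsilon> \<and> \<epsilon> < 1"
    if cr: "controller_realization q m p AK BK CK DK K" and st: "internally_stabilizes Ap Bp Cp AK BK CK DK"
    for K q AK BK CK DK
  proof -
    obtain FK HK where "controlled_plant n m p Ap Bp Cp F H G Ul Vl Nl Ml Ur Vr Nr Mr q AK BK CK DK FK HK K"
      by (rule controlled_plantI[OF cp cr])
    then interpret k: controlled_plant n m p Ap Bp Cp F H G Ul Vl Nl Ml Ur Vr Nr Mr q AK BK CK DK FK HK K .
    obtain X Y where XY: "X \<in> RHinf p p" "Y \<in> RHinf m p" "invertible_mat X" "K = Y * minv X" "Ml * X - Nl * Y = 1\<^sub>m p"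
      by (rule k.stable_imp_bezout_factors[OF st])
    have "hinf_norm (0\<^sub>m p p) \<le> 0"
      by (rule hinf_norm_le[of _ p p]) (simp_all add: mreg_zero vnorm_zero_mat_mult)
    moreover have "Ml * X - Nl * Y - 1\<^sub>m p = 0\<^sub>m p p" unfolding XY(5) by (rule eq_matI) simp_all
    \<comment> \<open>any bound strictly between \<open>0\<close> and \<open>1\<close> would do, the norm being \<open>0\<close>\<close>
    ultimately have "hinf_norm (Ml * X - Nl * Y - 1\<^sub>m p) < 1 / 2" by simp
    then show ?thesis using XY(1-4) by (intro bexI[of _ X] bexI[of _ Y] exI[of _ "1 / 2"]) simp_all
  qed
  have sufficient: "internally_stabilizes Ap Bp Cp AK BK CK DK"
    if cr: "controller_realization q m p AK BK CK DK (Y * minv X)"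
      and XY: "X \<in> RHinf p p" "Y \<in> RHinf m p" "hinf_norm (Ml * X - Nl * Y - 1\<^sub>m p) < \<epsilon>" "\<epsilon> < 1"
    for q AK BK CK DK X Y \<epsilon>
  proof -
    obtain FK HK where "controlled_plant n m p Ap Bp Cp F H G Ul Vl Nl Ml Ur Vr Nr Mr q AK BK CK DK FK HK (Y * minv X)"
      by (rule controlled_plantI[OF cp cr])
    then interpret k: controlled_plant n m p Ap Bp Cp F H G Ul Vl Nl Ml Ur Vr Nr Mr q AK BK CK DK FK HK "Y * minv X" .
    interpret b: approx_bezout n m p Ap Bp Cp F H G Ul Vl Nl Ml Ur Vr Nr Mr X Y \<epsilon> by (rule ab[OF XY])
    show ?thesis
      by (rule k.bezout_factors_imp_stable[OF XY(1,2) b.X_inverse(1) refl b.Q_nonsingular[unfolded b.Q_def]])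
  qed
  have bound: "let K = Y * minv X;
                L = four_block_mat (1\<^sub>m p) (- G) (- K) (1\<^sub>m m);
                E = minv L - four_block_mat (X * Ml) (X * Nl) (Y * Ml) (1\<^sub>m m + Y * Nl)
            in invertible_mat X \<and>
               (\<exists>q AK BK CK DK. controller_realization q m p AK BK CK DK K) \<and>
               (\<forall>q AK BK CK DK. controller_realization q m p AK BK CK DK K \<longrightarrow>
                  internally_stabilizes Ap Bp Cp AK BK CK DK) \<and>
               invertible_mat L \<and> E \<in> RHinf (p + m) (p + m) \<and>
               hinf_norm E \<le> \<epsilon> / (1 - \<epsilon>) * hinf_norm (X @\<^sub>r Y) * hinf_norm (append_cols Ml Nl)"
    if XY: "X \<in> RHinf p p" "Y \<in> RHinf m p" "hinf_norm (Ml * X - Nl * Y - 1\<^sub>m p) < \<epsilon>" "\<epsilon> < 1" for X Y \<epsilon>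
  proof -
    interpret b: approx_bezout n m p Ap Bp Cp F H G Ul Vl Nl Ml Ur Vr Nr Mr X Y \<epsilon> by (rule ab[OF XY])
    show ?thesis
      unfolding Let_def
      using b.X_inverse(1) b.controller_has_realization[unfolded b.K_def] sufficient[OF _ XY]
        b.L_inverse(2)[unfolded b.L_def b.K_def] b.E_RHinf[unfolded b.E_def b.L_def b.K_def]
        b.E_bound[unfolded b.E_def b.L_def b.K_def]
      by blast
  qed
  show ?thesis
    using necessary sufficient bound by blast
qed

end
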